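(* Let $N \geq 5$ be an integer and let $p>1$ be real. Let $\Sigma$ be one of the following: $\Sigma = \mathbb{R}^N$; the half space $\Sigma = \mathbb{R}^N_+$; or an exterior domain $\Sigma = \mathbb{R}^N\setminus\overline{\Omega}$ or $\Sigma = \mathbb{R}^N_+\setminus\overline{\Omega}$, where $\Omega$ is a bounded smooth domain of $\mathbb{R}^N$. Let $u$ be a classical stable solution of $$\Delta^2 u = u^p, \quad u>0 \ \text{ in } \Sigma, \qquad u = \Delta u = 0 \ \text{ on } \partial\Sigma,$$ and set $v = -\Delta u$. Then $$v \geq \sqrt{\frac{2}{p+1}}\, u^{\frac{p+1}{2}} \quad \text{in } \Sigma,$$ and consequently $v>0$ in $\Sigma$.
   Context: $\mathbb{R}^N_+ = \{x \in \mathbb{R}^N : x_N > 0\}$. A classical solution is a function $u \in C^4(\overline{\Sigma})$ satisfying the equation, the positivity, and the boundary conditions pointwise (when $\Sigma = \mathbb{R}^N$ there is no boundary condition). Let $E = H^2(\Sigma)\cap H^1_0(\Sigma)$. A solution $u$ is called stable if $$\Lambda_0(\phi) := \int_{\Sigma} |\Delta \phi|^2\, dx - p\int_{\Sigma} u^{p-1}\phi^2\, dx \geq 0 \quad \text{for every } \phi \in E.$$ *)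

theory Defs
  imports "HOL-Analysis.Analysis"
begin

section \<open>Classical derivatives and spaces of differentiable functions\<close>

definition partial :: "'n::finite \<Rightarrow> (real^'n \<Rightarrow> real) \<Rightarrow> real^'n \<Rightarrow> real" where
  "partial i f x = frechet_derivative f (at x) (axis i 1)"

primrec partials :: "'n::finite list \<Rightarrow> (real^'n \<Rightarrow> real) \<Rightarrow> real^'n \<Rightarrow> real" where
  "partials [] f = f"
| "partials (i # is) f = partial i (partials is f)"

text \<open>Meant for open sets only.\<close>

definition Ck_on :: "nat \<Rightarrow> (real^'n::finite) set \<Rightarrow> (real^'n \<Rightarrow> real) \<Rightarrow> bool" where
  "Ck_on k S f \<longleftrightarrow>
     (\<forall>is. length is < k \<longrightarrow> (\<forall>x\<in>S. partials is f differentiable (at x))) \<and>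
     (\<forall>is. length is \<le> k \<longrightarrow> continuous_on S (partials is f))"

definition smooth_on :: "(real^'n::finite) set \<Rightarrow> (real^'n \<Rightarrow> real) \<Rightarrow> bool" where
  "smooth_on S f \<longleftrightarrow> (\<forall>k. Ck_on k S f)"

text \<open>
  \<open>C\<^sup>k(closure S)\<close> for open \<open>S\<close>: all partial derivatives of order at most \<open>k\<close> extend
  continuously from \<open>S\<close> to \<open>closure S\<close>. No boundedness is imposed at infinity. The function
  itself is given on \<open>closure S\<close>; its values elsewhere are irrelevant.
\<close>

definition Ck_closure :: "nat \<Rightarrow> (real^'n::finite) set \<Rightarrow> (real^'n \<Rightarrow> real) \<Rightarrow> bool" where
  "Ck_closure k S f \<longleftrightarrow>
     Ck_on k S f \<and> continuous_on (closure S) f \<and>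
     (\<forall>is. length is \<le> k \<longrightarrow>
        (\<exists>g. continuous_on (closure S) g \<and> (\<forall>x\<in>S. g x = partials is f x)))"

definition laplacian :: "(real^'n::finite \<Rightarrow> real) \<Rightarrow> real^'n \<Rightarrow> real" where
  "laplacian f x = (\<Sum>i\<in>UNIV. partial i (partial i f) x)"


section \<open>Domains\<close>

text \<open>The index type has no canonical last element; the index \<open>k\<close> plays the role of \<open>N\<close>.\<close>

definition half_space :: "'n::finite \<Rightarrow> (real^'n) set" where
  "half_space k = {x. x $ k > 0}"

text \<open>
  Near each boundary point the set lies strictly on one side of the graph of a smooth function
  of the other \<open>N - 1\<close> coordinates, after relabelling (\<open>i\<close>) and reorienting (\<open>s\<close>) the axes.
  Such a function is encoded as a smooth function on the whole space not depending on the
  \<open>i\<close>-th coordinate.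
\<close>

definition smooth_boundary :: "(real^'n::finite) set \<Rightarrow> bool" where
  "smooth_boundary U \<longleftrightarrow>
     (\<forall>x0\<in>frontier U. \<exists>r>0. \<exists>i. \<exists>s\<in>{1, -1::real}. \<exists>\<gamma>.
        smooth_on UNIV \<gamma> \<and>
        (\<forall>x y. (\<forall>j. j \<noteq> i \<longrightarrow> x $ j = y $ j) \<longrightarrow> \<gamma> x = \<gamma> y) \<and>
        U \<inter> ball x0 r = {x \<in> ball x0 r. s * x $ i > \<gamma> x})"

definition bounded_smooth_domain :: "(real^'n::finite) set \<Rightarrow> bool" where
  "bounded_smooth_domain U \<longleftrightarrow>
     open U \<and> connected U \<and> U \<noteq> {} \<and> bounded U \<and> smooth_boundary U"


section \<open>Sobolev spaces\<close>

text \<open>Elements are functions rather than equivalence classes modulo null sets.\<close>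

definition test_function :: "(real^'n::finite) set \<Rightarrow> (real^'n \<Rightarrow> real) \<Rightarrow> bool" where
  "test_function S \<psi> \<longleftrightarrow>
     smooth_on UNIV \<psi> \<and> (\<exists>K. compact K \<and> K \<subseteq> S \<and> (\<forall>x. x \<notin> K \<longrightarrow> \<psi> x = 0))"

definition locally_integrable :: "(real^'n::finite) set \<Rightarrow> (real^'n \<Rightarrow> real) \<Rightarrow> bool" where
  "locally_integrable S f \<longleftrightarrow> (\<forall>K. compact K \<and> K \<subseteq> S \<longrightarrow> f absolutely_integrable_on K)"

definition has_weak_partial ::
  "(real^'n::finite) set \<Rightarrow> 'n \<Rightarrow> (real^'n \<Rightarrow> real) \<Rightarrow> (real^'n \<Rightarrow> real) \<Rightarrow> bool" where
  "has_weak_partial S i f g \<longleftrightarrow>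
     locally_integrable S f \<and> locally_integrable S g \<and>
     (\<forall>\<psi>. test_function S \<psi> \<longrightarrow>
        (LINT x|lebesgue_on S. f x * partial i \<psi> x) = - (LINT x|lebesgue_on S. g x * \<psi> x))"

text \<open>Determined only up to a null set of \<open>S\<close>, so to be used under integrals over \<open>S\<close>.\<close>

definition weak_partial ::
  "(real^'n::finite) set \<Rightarrow> 'n \<Rightarrow> (real^'n \<Rightarrow> real) \<Rightarrow> real^'n \<Rightarrow> real" where
  "weak_partial S i f = (SOME g. has_weak_partial S i f g)"

definition weak_laplacian ::
  "(real^'n::finite) set \<Rightarrow> (real^'n \<Rightarrow> real) \<Rightarrow> real^'n \<Rightarrow> real" where
  "weak_laplacian S f x = (\<Sum>i\<in>UNIV. weak_partial S i (weak_partial S i f) x)"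

definition L2 :: "(real^'n::finite) set \<Rightarrow> (real^'n \<Rightarrow> real) set" where
  "L2 S = {f \<in> borel_measurable (lebesgue_on S). integrable (lebesgue_on S) (\<lambda>x. (f x)\<^sup>2)}"

text \<open>\<open>sobolev S k\<close> is \<open>H\<^sup>k(S)\<close>.\<close>

primrec sobolev :: "(real^'n::finite) set \<Rightarrow> nat \<Rightarrow> (real^'n \<Rightarrow> real) set" where
  "sobolev S 0 = L2 S"
| "sobolev S (Suc k) = {f \<in> L2 S. \<forall>i. \<exists>g \<in> sobolev S k. has_weak_partial S i f g}"

definition H1_norm :: "(real^'n::finite) set \<Rightarrow> (real^'n \<Rightarrow> real) \<Rightarrow> real" where
  "H1_norm S f =
     sqrt ((LINT x|lebesgue_on S. (f x)\<^sup>2) +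
           (\<Sum>i\<in>UNIV. LINT x|lebesgue_on S. (weak_partial S i f x)\<^sup>2))"

definition H1_0 :: "(real^'n::finite) set \<Rightarrow> (real^'n \<Rightarrow> real) set" where
  "H1_0 S = {f \<in> sobolev S 1. \<exists>\<phi>::nat \<Rightarrow> real^'n \<Rightarrow> real.
     (\<forall>n. test_function S (\<phi> n)) \<and> (\<lambda>n. H1_norm S (\<lambda>x. \<phi> n x - f x)) \<longlonglongrightarrow> 0}"


section \<open>Stable classical solutions\<close>

text \<open>
  On the boundary \<open>laplacian u\<close> stands for its continuous extension from \<open>S\<close>, whence the limit.
\<close>

definition classical_solution ::
  "(real^'n::finite) set \<Rightarrow> real \<Rightarrow> (real^'n \<Rightarrow> real) \<Rightarrow> bool" where
  "classical_solution S p u \<longleftrightarrow>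
     Ck_closure 4 S u \<and>
     (\<forall>x\<in>S. laplacian (laplacian u) x = u x powr p \<and> u x > 0) \<and>
     (\<forall>x\<in>frontier S. u x = 0 \<and> (laplacian u \<longlongrightarrow> 0) (at x within S))"

text \<open>
  Extended real valued: the first integral is finite on \<open>H\<^sup>2(S)\<close>, but the second one may be
  infinite, in which case the value is \<open>-\<infinity>\<close>.
\<close>

definition Lambda0 ::
  "(real^'n::finite) set \<Rightarrow> real \<Rightarrow> (real^'n \<Rightarrow> real) \<Rightarrow> (real^'n \<Rightarrow> real) \<Rightarrow> ereal" where
  "Lambda0 S p u \<phi> =
     enn2ereal (\<integral>\<^sup>+x. ennreal (\<bar>weak_laplacian S \<phi> x\<bar>\<^sup>2) \<partial>lebesgue_on S) -
     ereal p * enn2ereal (\<integral>\<^sup>+x. ennreal (u x powr (p - 1) * (\<phi> x)\<^sup>2) \<partial>lebesgue_on S)"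

definition stable_solution ::
  "(real^'n::finite) set \<Rightarrow> real \<Rightarrow> (real^'n \<Rightarrow> real) \<Rightarrow> bool" where
  "stable_solution S p u \<longleftrightarrow>
     classical_solution S p u \<and> (\<forall>\<phi> \<in> sobolev S 2 \<inter> H1_0 S. Lambda0 S p u \<phi> \<ge> 0)"

end

theory Submission
  imports Defs
begin

text \<open>
  Write \<open>w = \<Delta>u = - v\<close>, \<open>q = (p + 1) / 2\<close>, \<open>\<beta> = q\<^sup>-\<^sup>1\<^sup>/\<^sup>2\<close> and
  \<open>\<zeta> = \<beta> u\<^sup>q + w\<close>; the assertion is \<open>\<zeta> \<le> 0\<close> in the
  domain \<open>S\<close>. It rests on two facts.

  First, \<open>\<zeta>\<close> is subharmonic where it is positive: \<open>\<Delta>\<zeta> \<ge> \<beta> q u\<^sup>q\<^sup>-\<^sup>1 \<zeta>\<close>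
  (\<open>zeta_laplacian\<close>). As \<open>\<zeta>\<close> tends to 0 at the frontier of \<open>S\<close>, its positive part,
  extended by 0, is subharmonic on the whole space.

  Second, stability forces the positive part to be small on average. The function \<open>u \<eta>\<close>, with
  a cutoff \<open>\<eta>\<close> at radius \<open>R\<close>, vanishes on the frontier and so is an admissible test
  function. Comparing the stability inequality for it with the equation multiplied by \<open>u \<eta>\<^sup>2\<close>
  cancels the terms \<open>w\<^sup>2 \<eta>\<^sup>2\<close>, and what is left can be absorbed; the result is that the integral
  of \<open>u\<^sup>p\<^sup>+\<^sup>1 + w\<^sup>2\<close> over the ball of radius \<open>R\<close> is at most of order
  \<open>R\<^sup>N\<^sup>-\<^sup>4\<close> (\<open>energy_absorbed\<close>, \<open>energy_growth\<close>), hence so is that of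
  \<open>(\<zeta>\<^sub>+)\<^sup>2\<close>.

  A nonnegative subharmonic function whose mean over the ball of radius \<open>R\<close> tends to 0 vanishes.
  Instead of the mean value property, the proof integrates it against a truncation of
  \<open>(1 + |x|\<^sup>2)\<^sup>(\<^sup>2\<^sup>-\<^sup>N\<^sup>)\<^sup>/\<^sup>2\<close>, whose Laplacian is
  negative near the origin and at most of order \<open>R\<^sup>-\<^sup>N\<close> elsewhere (\<open>barrier\<close>,
  \<open>zeta_le_eps\<close>).

  Each integration by parts involves a factor tending to 0 at the frontier, and this takes the place of
  a boundary integral. Truncating that factor near 0 produces compact support in \<open>S\<close>; removing the truncation uses that the gradient of a function vanishes almost everywhere on its zero
  set (\<open>partial_zero_on_level_set\<close>). The same truncation followed by mollification shows that
  \<open>u \<eta>\<close> lies in \<open>H\<^sup>1\<^sub>0\<close> (\<open>Ck_bdd_imp_H1_0\<close>). Uniqueness of weak derivatives, by the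
  fundamental lemma of the calculus of variations, identifies \<open>weak_laplacian\<close> with the classical
  Laplacian.
\<close>

section \<open>Partial derivatives and classes of differentiable functions\<close>

lemma partial_eqI:
  assumes "(f has_derivative D) (at x)"
  shows "partial i f x = D (axis i 1)"
  unfolding partial_def using frechet_derivative_at[OF assms] by simp

lemma has_derivative_partial:
  fixes f :: "real^'n::finite \<Rightarrow> real"
  assumes "f differentiable (at x)"
  shows "(f has_derivative (\<lambda>h. \<Sum>i\<in>UNIV. partial i f x * h $ i)) (at x)"
proof -
  let ?D = "frechet_derivative f (at x)"
  have D: "(f has_derivative ?D) (at x)"
    using assms frechet_derivative_works by blast
  then have lin: "linear ?D" by (rule has_derivative_linear)
  have "?D h = (\<Sum>i\<in>UNIV. partial i f x * h $ i)" for h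
  proof -
    have "?D h = ?D (\<Sum>i\<in>UNIV. h $ i *\<^sub>R axis i 1)"
      by (simp add: basis_expansion flip: scalar_mult_eq_scaleR)
    also have "\<dots> = (\<Sum>i\<in>UNIV. h $ i *\<^sub>R ?D (axis i 1))"
      by (simp add: linear_sum[OF lin] linear_scale[OF lin])
    finally show ?thesis by (simp add: partial_def mult.commute)
  qed
  then have "?D = (\<lambda>h. \<Sum>i\<in>UNIV. partial i f x * h $ i)" by blast
  with D show ?thesis by simp
qed

lemma partial_line_derivative:
  fixes f :: "real^'n::finite \<Rightarrow> real"
  assumes "f differentiable (at (x + t *\<^sub>R axis i 1))"
  shows "((\<lambda>t. f (x + t *\<^sub>R axis i 1)) has_real_derivative partial i f (x + t *\<^sub>R axis i 1)) (at t)"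
proof -
  let ?D = "frechet_derivative f (at (x + t *\<^sub>R axis i 1))"
  have D: "(f has_derivative ?D) (at (x + t *\<^sub>R axis i 1))"
    using assms frechet_derivative_works by blast
  have "((\<lambda>t. x + t *\<^sub>R axis i 1) has_derivative (\<lambda>h. h *\<^sub>R axis i 1)) (at t)"
    by (auto intro!: derivative_eq_intros)
  from has_derivative_compose[OF this D]
  have "((\<lambda>t. f (x + t *\<^sub>R axis i 1)) has_derivative (\<lambda>h. ?D (h *\<^sub>R axis i 1))) (at t)"
    by simp
  moreover have "(\<lambda>h. ?D (h *\<^sub>R axis i 1)) = (*) (partial i f (x + t *\<^sub>R axis i 1))"
    using has_derivative_linear[OF D] by (auto simp: linear_scale partial_def)
  ultimately show ?thesis by (simp add: has_field_derivative_def)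
qed

lemma partial_const [simp]: "partial i (\<lambda>x. c) = (\<lambda>x. 0)"
  by (rule ext, subst partial_eqI[of _ "\<lambda>h. 0"]) auto

lemma partial_add:
  assumes "f differentiable (at x)" "g differentiable (at x)"
  shows "partial i (\<lambda>x. f x + g x) x = partial i f x + partial i g x"
  using assms[unfolded frechet_derivative_works]
  by (subst partial_eqI[OF has_derivative_add]) (auto simp: partial_def)

lemma partial_mult:
  assumes "f differentiable (at x)" "g differentiable (at x)"
  shows "partial i (\<lambda>x. f x * g x) x = partial i f x * g x + f x * partial i g x"
  using assms[unfolded frechet_derivative_works]
  by (subst partial_eqI[OF has_derivative_mult]) (auto simp: partial_def)

lemma partial_cmult:
  assumes "f differentiable (at x)"
  shows "partial i (\<lambda>x. c * f x) x = c * partial i f x"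
  using partial_mult[of "\<lambda>x. c" x f i] assms by simp

lemma has_derivative_real_compose:
  assumes "f differentiable (at x)" "(G has_real_derivative G') (at (f x))"
  shows "((\<lambda>x. G (f x)) has_derivative (\<lambda>h. G' * frechet_derivative f (at x) h)) (at x)"
  using has_derivative_compose[OF assms(1)[unfolded frechet_derivative_works]
    assms(2)[unfolded has_field_derivative_def]] by simp

lemma partial_compose:
  assumes "f differentiable (at x)" "(G has_real_derivative G') (at (f x))"
  shows "partial i (\<lambda>x. G (f x)) x = G' * partial i f x"
  using partial_eqI[OF has_derivative_real_compose[OF assms]] by (simp add: partial_def)

lemma differentiable_compose_real:
  assumes "f differentiable (at x)" "(G has_real_derivative G') (at (f x))"
  shows "(\<lambda>x. G (f x)) differentiable (at x)"
  using has_derivative_real_compose[OF assms] by (auto simp: differentiable_def)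

lemma has_derivative_cong_open:
  assumes "open S" "x \<in> S" "\<And>y. y \<in> S \<Longrightarrow> f y = g y"
  shows "(f has_derivative D) (at x) \<longleftrightarrow> (g has_derivative D) (at x)"
  using has_derivative_transform_within_open[of f D x UNIV S g]
    has_derivative_transform_within_open[of g D x UNIV S f] assms by auto

lemma partial_cong_open:
  assumes "open S" "x \<in> S" "\<And>y. y \<in> S \<Longrightarrow> f y = g y"
  shows "partial i f x = partial i g x"
  unfolding partial_def frechet_derivative_def
  using has_derivative_cong_open[OF assms] by simp

lemma differentiable_cong_open:
  assumes "open S" "x \<in> S" "\<And>y. y \<in> S \<Longrightarrow> f y = g y"
  shows "f differentiable (at x) \<longleftrightarrow> g differentiable (at x)"
  unfolding differentiable_def using has_derivative_cong_open[OF assms] by simp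

lemma partials_cong_open:
  assumes "open S" "x \<in> S" "\<And>y. y \<in> S \<Longrightarrow> f y = g y"
  shows "partials is f x = partials is g x"
  using assms(2)
proof (induction "is" arbitrary: x)
  case (Cons i js)
  show ?case using partial_cong_open[OF assms(1) Cons(2), of "partials js f" "partials js g"] Cons(1)
    by simp
qed (use assms in simp)

lemma partials_snoc: "partials (is @ [i]) f = partials is (partial i f)"
  by (induction "is") auto

text \<open>
  The class \<open>C\<^sup>k(S)\<close> with derivatives bounded on each set of a family \<open>F\<close>. With
  \<open>F = {}\<close> it is \<open>C\<^sup>k(S)\<close> itself; with \<open>F\<close> the bounded subsets of \<open>S\<close> it
  replaces \<open>C\<^sup>k(closure S)\<close>, of which only the local boundedness up to the boundary
  matters.
\<close>

definition Ck_bdd :: "(real^'n::finite) set set \<Rightarrow> nat \<Rightarrow> (real^'n) set \<Rightarrow> (real^'n \<Rightarrow> real) \<Rightarrow> bool" where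
  "Ck_bdd F k S f \<longleftrightarrow>
     Ck_on k S f \<and> (\<forall>is. length is \<le> k \<longrightarrow> (\<forall>B\<in>F. bounded (partials is f ` B)))"

lemma Ck_bdd_empty [simp]: "Ck_bdd {} k S f = Ck_on k S f"
  by (simp add: Ck_bdd_def)

lemma Ck_bdd_0: "Ck_bdd F 0 S f \<longleftrightarrow> continuous_on S f \<and> (\<forall>B\<in>F. bounded (f ` B))"
  by (simp add: Ck_bdd_def Ck_on_def)

lemma all_lists_Suc:
  "(\<forall>is. length is \<le> Suc k \<longrightarrow> P is) \<longleftrightarrow> P [] \<and> (\<forall>i is. length is \<le> k \<longrightarrow> P (is @ [i]))"
proof safe
  fix "is" :: "'a list" assume *: "P []" "\<forall>i is. length is \<le> k \<longrightarrow> P (is @ [i])" "length is \<le> Suc k"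
  then show "P is" by (cases "is" rule: rev_cases) auto
qed auto

lemma all_lists_Suc_less:
  "(\<forall>is. length is < Suc k \<longrightarrow> P is) \<longleftrightarrow> P [] \<and> (\<forall>i is. length is < k \<longrightarrow> P (is @ [i]))"
proof safe
  fix "is" :: "'a list" assume *: "P []" "\<forall>i is. length is < k \<longrightarrow> P (is @ [i])" "length is < Suc k"
  then show "P is" by (cases "is" rule: rev_cases) auto
qed auto

lemma Ck_bdd_Suc:
  "Ck_bdd F (Suc k) S f \<longleftrightarrow>
     (\<forall>x\<in>S. f differentiable (at x)) \<and> Ck_bdd F 0 S f \<and> (\<forall>i. Ck_bdd F k S (partial i f))"
  unfolding Ck_bdd_def Ck_on_def all_lists_Suc all_lists_Suc_less partials_snoc by auto

lemma Ck_bdd_mono: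
  assumes "Ck_bdd F k S f" "j \<le> k"
  shows "Ck_bdd F j S f"
  using assms unfolding Ck_bdd_def Ck_on_def by auto

lemma Ck_bdd_imp_Ck_on: "Ck_bdd F k S f \<Longrightarrow> Ck_on k S f"
  by (simp add: Ck_bdd_def)

lemma Ck_bdd_subset:
  assumes "Ck_bdd F k S f" "T \<subseteq> S" "\<And>B. B \<in> G \<Longrightarrow> \<exists>A\<in>F. B \<subseteq> A"
  shows "Ck_bdd G k T f"
proof -
  have "bounded (partials is f ` B)" if "length is \<le> k" "B \<in> G" for "is" B
    using assms(3)[OF that(2)] assms(1) that(1) unfolding Ck_bdd_def
    by (meson bounded_subset image_mono)
  moreover have "Ck_on k T f"
    using assms(1,2) unfolding Ck_bdd_def Ck_on_def by (auto intro: continuous_on_subset)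
  ultimately show ?thesis by (simp add: Ck_bdd_def)
qed

lemma Ck_bdd_const: "Ck_bdd F k S (\<lambda>x. c)"
  by (induction k arbitrary: c) (auto simp: Ck_bdd_0 Ck_bdd_Suc image_constant_conv)

context
  fixes S :: "(real^'n::finite) set" and F :: "(real^'n) set set"
  assumes S: "open S" and F: "\<And>B. B \<in> F \<Longrightarrow> B \<subseteq> S"
begin

lemma Ck_bdd_cong:
  assumes "\<And>x. x \<in> S \<Longrightarrow> f x = g x"
  shows "Ck_bdd F k S f \<longleftrightarrow> Ck_bdd F k S g"
proof -
  have eq: "partials is f x = partials is g x" if "x \<in> S" for x "is"
    using partials_cong_open[OF S that assms] .
  have 1: "continuous_on S (partials is f) = continuous_on S (partials is g)" for "is"
    by (rule continuous_on_cong) (auto intro: eq)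
  have 2: "partials is f ` B = partials is g ` B" if "B \<in> F" for B "is"
    by (rule image_cong) (use F[OF that] in \<open>auto intro: eq\<close>)
  have 3: "(partials is f differentiable (at x)) = (partials is g differentiable (at x))" if "x \<in> S" for x "is"
    by (rule differentiable_cong_open[OF S that]) (auto intro: eq)
  show ?thesis unfolding Ck_bdd_def Ck_on_def using 1 2 3 by auto
qed

lemma Ck_bdd_add:
  assumes "Ck_bdd F k S f" "Ck_bdd F k S g"
  shows "Ck_bdd F k S (\<lambda>x. f x + g x)"
  using assms
proof (induction k arbitrary: f g)
  case 0
  then show ?case by (auto simp: Ck_bdd_0 intro!: continuous_intros bounded_plus_comp)
next
  case (Suc k)
  from Suc.prems have "Ck_bdd F k S (partial i (\<lambda>x. f x + g x))" for i
    by (subst Ck_bdd_cong[of _ "\<lambda>x. partial i f x + partial i g x"])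
      (auto simp: Ck_bdd_Suc partial_add intro!: Suc.IH)
  with Suc.prems show ?case
    by (auto simp: Ck_bdd_Suc Ck_bdd_0 intro!: continuous_intros bounded_plus_comp)
qed

lemma Ck_bdd_mult:
  assumes "Ck_bdd F k S f" "Ck_bdd F k S g"
  shows "Ck_bdd F k S (\<lambda>x. f x * g x)"
  using assms
proof -
  have b: "bounded ((\<lambda>x. f x * g x) ` B)" if "bounded (f ` B)" "bounded (g ` B)"
    for f g :: "real^'n \<Rightarrow> real" and B
  proof -
    obtain a b where "\<forall>x\<in>B. norm (f x) \<le> a" "\<forall>x\<in>B. norm (g x) \<le> b"
      using \<open>bounded (f ` B)\<close> \<open>bounded (g ` B)\<close> by (auto simp: bounded_iff)
    then have "\<forall>x\<in>B. norm (f x * g x) \<le> \<bar>a\<bar> * \<bar>b\<bar>"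
      by (auto simp: abs_mult intro!: mult_mono)
    then show ?thesis by (auto simp: bounded_iff)
  qed
  show ?thesis using assms
  proof (induction k arbitrary: f g)
    case 0
    then show ?case by (auto simp: Ck_bdd_0 intro!: continuous_intros b)
  next
    case (Suc k)
    have "Ck_bdd F k S f" "Ck_bdd F k S g" using Suc.prems Ck_bdd_mono by fastforce+
    with Suc.prems have "Ck_bdd F k S (partial i (\<lambda>x. f x * g x))" for i
      by (subst Ck_bdd_cong[of _ "\<lambda>x. partial i f x * g x + f x * partial i g x"])
        (auto simp: Ck_bdd_Suc partial_mult intro!: Ck_bdd_add Suc.IH)
    with Suc.prems show ?case
      by (auto simp: Ck_bdd_Suc Ck_bdd_0 intro!: continuous_intros b)
  qed
qed

lemma Ck_bdd_cmult: "Ck_bdd F k S f \<Longrightarrow> Ck_bdd F k S (\<lambda>x. c * f x)"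
  by (intro Ck_bdd_mult Ck_bdd_const)

lemma Ck_bdd_sum:
  assumes "\<And>j. j \<in> A \<Longrightarrow> Ck_bdd F k S (f j)"
  shows "Ck_bdd F k S (\<lambda>x. \<Sum>j\<in>A. f j x)"
  using assms by (induction A rule: infinite_finite_induct) (auto intro!: Ck_bdd_const Ck_bdd_add)

end

lemmas Ck_on_cong = Ck_bdd_cong[where F="{}", simplified]
lemmas Ck_on_add = Ck_bdd_add[where F="{}", simplified]
lemmas Ck_on_mult = Ck_bdd_mult[where F="{}", simplified]
lemmas Ck_on_const = Ck_bdd_const[where F="{}", simplified]
lemmas Ck_on_mono = Ck_bdd_mono[where F="{}", simplified]
lemmas Ck_on_0 = Ck_bdd_0[where F="{}", simplified]
lemmas Ck_on_Suc = Ck_bdd_Suc[where F="{}", simplified, unfolded Ck_on_0]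

lemma Ck_on_subset: "Ck_on k S f \<Longrightarrow> T \<subseteq> S \<Longrightarrow> Ck_on k T f"
  using Ck_bdd_subset[of "{}" k S f T "{}"] by simp

text \<open>
  The outer function comes with the sequence of its derivatives, so that the induction on \<open>k\<close> can
  pass to the shifted sequence.
\<close>

lemma Ck_on_compose:
  assumes S: "open S" and f: "Ck_on k S f"
    and G: "\<And>j x. j < k \<Longrightarrow> x \<in> S \<Longrightarrow> (G j has_real_derivative G (Suc j) (f x)) (at (f x))"
    and Gk: "continuous_on (f ` S) (G k)"
  shows "Ck_on k S (\<lambda>x. G 0 (f x))"
  using f G Gk
proof (induction k arbitrary: G)
  case 0
  then show ?case by (auto simp: Ck_on_0 intro: continuous_on_compose2[where f=f and s=S])
next
  case (Suc k)
  have d: "f differentiable (at x)" if "x \<in> S" for x using Suc.prems(1) that by (auto simp: Ck_on_Suc)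
  have 1: "Ck_on k S (\<lambda>x. G (Suc 0) (f x))"
    using Suc.IH[of "\<lambda>j. G (Suc j)"] Suc.prems Ck_on_mono[of "Suc k" S f k] by auto
  have "Ck_on k S (partial i (\<lambda>x. G 0 (f x)))" for i
    using Suc.prems(1) 1
    by (subst Ck_on_cong[OF S, of _ "\<lambda>x. G (Suc 0) (f x) * partial i f x"])
      (auto simp: Ck_on_Suc intro!: Ck_on_mult[OF S] partial_compose Suc.prems(2))
  moreover have "\<forall>x\<in>S. (\<lambda>x. G 0 (f x)) differentiable (at x)"
    using differentiable_compose_real[OF d Suc.prems(2)] by auto
  ultimately show ?case
    by (auto simp: Ck_on_Suc intro!: continuous_at_imp_continuous_on differentiable_imp_continuous_within)
qed

section \<open>A soft positive part and truncation\<close>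

text \<open>
  A convex \<open>C\<^sup>2\<close> substitute for the positive part. Its slope lies in \<open>[0, 1]\<close>, it is bounded
  by the square of its argument, so that \<open>L\<^sup>2\<close> bounds control it, and its second derivative decays
  like the inverse cube, which is what keeps the error of the barrier below small.
\<close>

definition soft :: "real \<Rightarrow> real" where "soft t = (max 0 t)^3 / (1 + max 0 t)^2"
definition soft' :: "real \<Rightarrow> real" where "soft' t = (max 0 t)^2 * (max 0 t + 3) / (1 + max 0 t)^3"
definition soft'' :: "real \<Rightarrow> real" where "soft'' t = 6 * max 0 t / (1 + max 0 t)^4"

lemma has_derivative_0_of_quadratic:
  fixes f :: "real \<Rightarrow> real"
  assumes "\<And>t. \<bar>f t\<bar> \<le> c * t^2"
  shows "(f has_real_derivative 0) (at 0)"
proof -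
  have f0: "f 0 = 0" using assms[of 0] by simp
  have "((\<lambda>h. f h / h) \<longlongrightarrow> 0) (at 0)"
  proof (rule Lim_null_comparison)
    show "\<forall>\<^sub>F h in at 0. norm (f h / h) \<le> c * \<bar>h\<bar>"
    proof (rule eventually_at_topological[THEN iffD2], intro exI[of _ UNIV] conjI ballI impI)
      fix h :: real assume "h \<noteq> 0"
      then show "norm (f h / h) \<le> c * \<bar>h\<bar>"
        using assms[of h] by (auto simp: abs_if field_simps power2_eq_square split: if_splits)
    qed auto
    show "((\<lambda>h. c * \<bar>h\<bar>) \<longlongrightarrow> 0) (at 0)" by (auto intro!: tendsto_eq_intros)
  qed
  then show ?thesis by (simp add: DERIV_def f0)
qed

lemma soft_nonpos [simp]: "t \<le> 0 \<Longrightarrow> soft t = 0" "t \<le> 0 \<Longrightarrow> soft' t = 0" "t \<le> 0 \<Longrightarrow> soft'' t = 0"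
  by (auto simp: soft_def soft'_def soft''_def max_def)

lemma soft_nonneg: "0 \<le> soft t" "0 \<le> soft' t" "0 \<le> soft'' t"
  by (auto simp: soft_def soft'_def soft''_def)

lemma soft_pos: "0 < t \<Longrightarrow> 0 < soft t"
  by (auto simp: soft_def)

lemma soft_le: "soft t \<le> max 0 t"
  and soft_le_sq: "soft t \<le> t^2"
  and soft_ge: "t - 2 \<le> soft t"
proof -
  define m where "m = max 0 t"
  have m: "0 \<le> m" by (simp add: m_def)
  have e: "soft t = m^3 / (1+m)^2" by (simp add: soft_def m_def)
  have "m^3 \<le> m * (1+m)^2"
    using m by (simp add: power2_eq_square power3_eq_cube algebra_simps)
  then show "soft t \<le> max 0 t" using m e by (simp add: divide_le_eq flip: m_def)
  have "m^3 \<le> m^2 * (1+m)^2"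
    using m by (simp add: power2_eq_square power3_eq_cube algebra_simps)
  then have "soft t \<le> m^2" using m e by (simp add: divide_le_eq)
  also have "m^2 \<le> t^2" by (auto simp: m_def max_def)
  finally show "soft t \<le> t^2" .
  have "(m - 2) * (1+m)^2 \<le> m^3"
    using m by (simp add: power2_eq_square power3_eq_cube algebra_simps)
  then have "m - 2 \<le> soft t" using m e by (simp add: le_divide_eq)
  then show "t - 2 \<le> soft t" by (simp add: m_def)
qed

lemma soft'_le_1: "soft' t \<le> 1"
  and soft'_ge: "0 \<le> t \<Longrightarrow> 1 - 3 / (1 + t) \<le> soft' t"
  and soft'_le_sq: "soft' t \<le> 3 * t^2"
proof -
  define m where "m = max 0 t"
  have m: "0 \<le> m" by (simp add: m_def)
  have e: "soft' t = m^2 * (m+3) / (1+m)^3" by (simp add: soft'_def m_def)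
  have "m^2 * (m+3) \<le> (1+m)^3"
    using m by (simp add: power2_eq_square power3_eq_cube algebra_simps)
  then show "soft' t \<le> 1" using m e by (simp add: divide_le_eq)
  have "m^2 * (m+3) \<le> 3 * m^2 * (1+m)^3"
    using m by (simp add: power2_eq_square power3_eq_cube algebra_simps)
  then have "soft' t \<le> 3 * m^2" using m e by (simp add: divide_le_eq)
  also have "3 * m^2 \<le> 3 * t^2" by (auto simp: m_def max_def)
  finally show "soft' t \<le> 3 * t^2" .
  assume "0 \<le> t"
  then have "m = t" by (simp add: m_def)
  have "(1 - 3 / (1 + m)) = (m - 2) * (1+m)^2 / (1+m)^3"
    using m by (simp add: divide_simps power2_eq_square power3_eq_cube) 
  also have "\<dots> \<le> m^2 * (m+3) / (1+m)^3"
    using m by (intro divide_right_mono) (auto simp: power2_eq_square power3_eq_cube algebra_simps)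
  finally show "1 - 3 / (1 + t) \<le> soft' t" using e \<open>m = t\<close> by simp
qed

lemma soft''_le: "0 \<le> t \<Longrightarrow> soft'' t \<le> 6 / (1 + t)^3"
  by (simp add: soft''_def divide_simps) (simp add: power_def numeral_eq_Suc algebra_simps)

lemma soft_deriv: "(soft has_real_derivative soft' t) (at t)"
proof (cases t "0::real" rule: linorder_cases)
  case less
  have "((\<lambda>t. 0) has_real_derivative soft' t) (at t)" using less by simp
  then show ?thesis
    by (rule has_field_derivative_transform_within_open[of _ _ _ "{..<0}"]) (use less in auto)
next
  case equal
  have "(soft has_real_derivative 0) (at 0)"
    by (rule has_derivative_0_of_quadratic[of _ 1]) (use soft_le_sq soft_nonneg in auto)
  with equal show ?thesis by simp
next
  case greater
  have "((\<lambda>t. t^3 / (1+t)^2) has_real_derivative soft' t) (at t)"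
    using greater
    by (auto intro!: derivative_eq_intros simp: soft'_def divide_simps)
      (simp add: power_def numeral_eq_Suc algebra_simps)
  then show ?thesis
    by (rule has_field_derivative_transform_within_open[of _ _ _ "{0<..}"])
      (use greater in \<open>auto simp: soft_def\<close>)
qed

lemma soft'_deriv: "(soft' has_real_derivative soft'' t) (at t)"
proof (cases t "0::real" rule: linorder_cases)
  case less
  have "((\<lambda>t. 0) has_real_derivative soft'' t) (at t)" using less by simp
  then show ?thesis
    by (rule has_field_derivative_transform_within_open[of _ _ _ "{..<0}"]) (use less in auto)
next
  case equal
  have "(soft' has_real_derivative 0) (at 0)"
    by (rule has_derivative_0_of_quadratic[of _ 3]) (use soft'_le_sq soft_nonneg in auto)
  with equal show ?thesis by simp
next
  case greater
  have "((\<lambda>t. t^2 * (t+3) / (1+t)^3) has_real_derivative soft'' t) (at t)"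
    using greater
    by (auto intro!: derivative_eq_intros simp: soft''_def divide_simps)
      (simp add: power_def numeral_eq_Suc algebra_simps)
  then show ?thesis
    by (rule has_field_derivative_transform_within_open[of _ _ _ "{0<..}"])
      (use greater in \<open>auto simp: soft'_def\<close>)
qed

lemma continuous_soft'': "continuous_on A soft''"
  unfolding soft''_def by (intro continuous_intros) (auto simp: add_nonneg_eq_0_iff)

text \<open>
  An odd truncation of the identity that vanishes on \<open>[- e, e]\<close>: applied to a function tending to 0
  at the frontier of \<open>S\<close> it gives a function vanishing near the frontier. As \<open>e\<close> tends to 0 it
  tends to the identity, with slopes in \<open>[0, 1]\<close> tending to 1 except at 0.
\<close>

definition trunc :: "real \<Rightarrow> real \<Rightarrow> real" where
  "trunc e t = e * (soft (t / e - 1) - soft (- t / e - 1))"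

definition trunc' :: "real \<Rightarrow> real \<Rightarrow> real" where
  "trunc' e t = soft' (t / e - 1) + soft' (- t / e - 1)"

lemma trunc_deriv: "e > 0 \<Longrightarrow> (trunc e has_real_derivative trunc' e t) (at t)"
  unfolding trunc_def trunc'_def
  by (auto intro!: derivative_eq_intros DERIV_chain2[OF soft_deriv] simp: field_simps)

lemma continuous_trunc': "e > 0 \<Longrightarrow> continuous_on A (trunc' e)"
  unfolding trunc'_def
  by (intro continuous_intros continuous_on_compose2[of UNIV soft' A]
     DERIV_continuous_on[of UNIV soft' soft'']) (auto intro: has_field_derivative_at_within soft'_deriv)

lemma trunc_zero: "e > 0 \<Longrightarrow> \<bar>t\<bar> \<le> e \<Longrightarrow> trunc e t = 0" 
  and trunc'_zero: "e > 0 \<Longrightarrow> \<bar>t\<bar> \<le> e \<Longrightarrow> trunc' e t = 0"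
  by (auto simp: trunc_def trunc'_def divide_simps intro!: soft_nonpos)

lemma trunc_near:
  assumes e: "e > 0"
  shows "\<bar>trunc e t - t\<bar> \<le> 3 * e"
proof -
  have 1: "0 \<le> soft (s / e - 1)" "s / e - 3 \<le> soft (s / e - 1)" "soft (s/e - 1) \<le> max 0 (s / e - 1)" for s
    using soft_ge[of "s/e - 1"] soft_nonneg soft_le by auto
  have e3: "e * (s / e - 3) = s - 3 * e" for s using e by (simp add: field_simps)
  have em: "e * max 0 (s / e - 1) = max 0 (s - e)" for s
    using e by (auto simp: max_def field_simps)
  have 2: "0 \<le> e * soft (s / e - 1)" "s - 3 * e \<le> e * soft (s / e - 1)" "e * soft (s/e - 1) \<le> max 0 (s - e)" for s
    using mult_left_mono[OF 1(2)[of s], of e] mult_left_mono[OF 1(3)[of s], of e] 1(1)[of s] e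
    by (auto simp: e3 em)
  show ?thesis using 2[of t] 2[of "-t"] e
    by (simp add: trunc_def right_diff_distrib max_def split: if_splits)
qed

lemma trunc'_bounds:
  assumes "e > 0"
  shows "0 \<le> trunc' e t" "trunc' e t \<le> 1"
proof -
  have "t / e - 1 \<le> 0 \<or> - t / e - 1 \<le> 0" using assms by (auto simp: divide_simps)
  then show "trunc' e t \<le> 1" unfolding trunc'_def
    using soft'_le_1 by (elim disjE) simp_all
qed (simp add: trunc'_def soft_nonneg)

lemma trunc_abs_le:
  assumes e: "e > 0"
  shows "\<bar>trunc e t\<bar> \<le> \<bar>t\<bar>"
proof -
  have em: "e * max 0 (s / e - 1) = max 0 (s - e)" for s
    using e by (auto simp: max_def field_simps)
  have *: "0 \<le> e * soft (s / e - 1)" "e * soft (s / e - 1) \<le> max 0 (s - e)" for s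
    using mult_left_mono[OF soft_le[of "s/e - 1"], of e] soft_nonneg[of "s/e-1"] e
    by (auto simp: em)
  show ?thesis using *[of t] *[of "-t"] e
    by (simp add: trunc_def right_diff_distrib max_def split: if_splits)
qed

lemma trunc_tendsto: "(\<lambda>n. trunc (inverse (real (Suc n))) t) \<longlonglongrightarrow> t"
proof -
  have "(\<lambda>n. trunc (inverse (real (Suc n))) t - t) \<longlonglongrightarrow> 0"
  proof (rule Lim_null_comparison)
    show "\<forall>\<^sub>F n in sequentially. norm (trunc (inverse (real (Suc n))) t - t) \<le> 3 * inverse (real (Suc n))"
      using trunc_near[of "inverse (real (Suc _))"] by (auto simp: real_norm_def simp del: of_nat_Suc)
    show "(\<lambda>n. 3 * inverse (real (Suc n))) \<longlonglongrightarrow> 0"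
      using tendsto_mult_right_zero[OF LIMSEQ_inverse_real_of_nat] by blast
  qed
  then show ?thesis by (simp add: LIM_zero_iff)
qed

lemma soft'_tendsto: "(soft' \<longlongrightarrow> 1) at_top"
proof (rule tendsto_sandwich)
  show "\<forall>\<^sub>F t in at_top. 1 - 3 / (1 + t) \<le> soft' t"
    by (rule eventually_mono[OF eventually_ge_at_top[of 0]]) (rule soft'_ge)
  show "\<forall>\<^sub>F t in at_top. soft' t \<le> 1" using soft'_le_1 by simp
  have "((\<lambda>t::real. 3 / (1 + t)) \<longlongrightarrow> 0) at_top"
    by (intro tendsto_divide_0[OF tendsto_const] filterlim_at_top_imp_at_infinity
        filterlim_tendsto_add_at_top[OF tendsto_const filterlim_ident])
  from tendsto_diff[OF tendsto_const this] show "((\<lambda>t::real. 1 - 3 / (1 + t)) \<longlongrightarrow> 1) at_top" by simp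
qed auto

lemma trunc'_tendsto: "(\<lambda>n. trunc' (inverse (real (Suc n))) t) \<longlonglongrightarrow> (if t = 0 then 0 else 1)"
proof -
  have pos: "(\<lambda>n. trunc' (inverse (real (Suc n))) t) \<longlonglongrightarrow> 1" if "t > 0" for t
  proof -
    have 1: "filterlim (\<lambda>n. t * real (Suc n) - 1) at_top sequentially"
      using filterlim_tendsto_add_at_top[OF tendsto_const[of "-1"]
          filterlim_tendsto_pos_mult_at_top[OF tendsto_const[of t] that
            filterlim_compose[OF filterlim_real_sequentially filterlim_Suc]]]
      by simp
    have "trunc' (inverse (real (Suc n))) t = soft' (t * real (Suc n) - 1)" for n
    proof -
      have "0 \<le> t * real (Suc n)" using that by simp
      then have "soft' (- (t * real (Suc n)) - 1) = 0" by (intro soft_nonpos) linarith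
      then show ?thesis by (simp add: trunc'_def divide_inverse del: of_nat_Suc)
    qed
    then show ?thesis using filterlim_compose[OF soft'_tendsto 1] by simp
  qed
  have sym: "trunc' e (- t) = trunc' e t" for e by (simp add: trunc'_def)
  consider "t > 0" | "t = 0" | "- t > 0" by linarith
  then show ?thesis
  proof cases
    case 2 then show ?thesis by (simp add: trunc'_zero)
  next
    case 3 then show ?thesis using pos[OF 3] by (simp add: sym)
  qed (use pos in auto)
qed

section \<open>Integration by parts\<close>

lemma open_sets_lebesgue: "open S \<Longrightarrow> S \<in> sets lebesgue"
  by (intro sets_completionI_sets) simp

lemma integrable_indicator_cball:
  fixes S :: "(real^'n::finite) set"
  assumes S: "S \<in> sets lebesgue"
  shows "integrable (lebesgue_on S) (\<lambda>x. c * indicat_real (cball a r) x)"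
proof -
  have "cball a r \<inter> S \<in> lmeasurable"
    using S by (intro fmeasurable_Int_fmeasurable lmeasurable_cball)
  then have "integrable lebesgue (indicat_real (cball a r \<inter> S))"
    by (simp add: lmeasurable_iff_integrable)
  moreover have "indicat_real (cball a r \<inter> S) = (\<lambda>x. indicat_real S x *\<^sub>R indicator (cball a r) x)"
    by (auto simp: indicator_def fun_eq_iff)
  ultimately have "integrable lebesgue (\<lambda>x. indicat_real S x *\<^sub>R indicat_real (cball a r) x)"
    by simp
  then have "integrable (lebesgue_on S) (indicat_real (cball a r))"
    using S by (subst integrable_restrict_space) auto
  then show ?thesis by simp
qed

lemma integrable_bounded_support:
  fixes f :: "real^'n::finite \<Rightarrow> real"
  assumes S: "S \<in> sets lebesgue" and f: "f \<in> borel_measurable (lebesgue_on S)"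
    and B: "bounded B" "\<And>x. x \<in> S \<Longrightarrow> x \<notin> B \<Longrightarrow> f x = 0"
    and c: "\<And>x. x \<in> S \<Longrightarrow> \<bar>f x\<bar> \<le> c"
  shows "integrable (lebesgue_on S) f"
proof -
  obtain r where r: "B \<subseteq> cball 0 r" using B(1) bounded_subset_ballD[of B 0] ball_subset_cball by blast
  show ?thesis
  proof (rule Bochner_Integration.integrable_bound[OF integrable_indicator_cball[OF S, of c 0 r] f])
    show "AE x in lebesgue_on S. norm (f x) \<le> norm (c * indicat_real (cball 0 r) x)"
    proof (intro AE_I2)
      fix x assume "x \<in> space (lebesgue_on S)"
      then have x: "x \<in> S" by simp
      show "norm (f x) \<le> norm (c * indicat_real (cball 0 r) x)"
        using B(2)[OF x] c[OF x] r by (cases "x \<in> B") auto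
    qed
  qed
qed

lemma integrable_continuous_bounded_support:
  fixes f :: "real^'n::finite \<Rightarrow> real"
  assumes S: "open S" and f: "continuous_on S f"
    and B: "bounded B" "\<And>x. x \<in> S \<Longrightarrow> x \<notin> B \<Longrightarrow> f x = 0"
    and c: "bounded (f ` (S \<inter> B))"
  shows "integrable (lebesgue_on S) f"
proof -
  obtain c where "\<forall>x\<in>S\<inter>B. \<bar>f x\<bar> \<le> c" using c by (auto simp: bounded_iff)
  then have c: "\<bar>f x\<bar> \<le> max 0 c" if "x \<in> S" for x using B(2)[OF that] that by force
  note S' = open_sets_lebesgue[OF S]
  show ?thesis
    by (rule integrable_bounded_support[OF S' continuous_imp_measurable_on_sets_lebesgue[OF f S'] B c])
qed

text \<open>
  Translation invariance makes the integral of each difference quotient vanish; the quotients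
  are bounded by the mean value theorem.
\<close>

lemma integral_partial_compact_support_UNIV:
  fixes h :: "real^'n::finite \<Rightarrow> real"
  assumes d: "\<And>x. h differentiable (at x)" and c: "continuous_on UNIV (partial i h)"
    and B: "bounded B" "\<And>x. x \<notin> B \<Longrightarrow> h x = 0"
  shows "integral\<^sup>L lebesgue (partial i h) = 0"
proof -
  obtain r where r: "B \<subseteq> cball 0 r" "0 < r"
    using B(1) bounded_subset_ballD[of B 0] ball_subset_cball by blast
  have hc: "continuous_on UNIV h"
    using d by (auto intro!: continuous_at_imp_continuous_on differentiable_imp_continuous_within)
  have p0: "partial i h x = 0" if "x \<notin> cball 0 r" for x
  proof -
    have "h y = 0" if "y \<in> - cball 0 r" for y using that r(1) B(2) by blast
    from partial_cong_open[of "- cball 0 r" x h "\<lambda>x. 0" i, OF _ _ this] that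
    show ?thesis by (simp add: open_Compl)
  qed
  have "bounded (partial i h ` cball 0 (r + 1))"
    by (intro compact_imp_bounded compact_continuous_image continuous_on_subset[OF c]) auto
  then obtain M where "\<forall>x\<in>cball 0 (r+1). \<bar>partial i h x\<bar> \<le> M" by (auto simp: bounded_iff)
  then have M: "\<bar>partial i h x\<bar> \<le> max 0 M" for x
  proof (cases "x \<in> cball 0 r")
    case True
    then have "x \<in> cball 0 (r + 1)" by simp
    with \<open>\<forall>x\<in>cball 0 (r+1). \<bar>partial i h x\<bar> \<le> M\<close> have "\<bar>partial i h x\<bar> \<le> M" by blast
    then show ?thesis by simp
  qed (simp add: p0)
  define s where "s n = inverse (real (Suc n))" for n
  have s: "0 < s n" "s n \<le> 1" for n by (auto simp: s_def field_simps)
  define e :: "real^'n" where "e = axis i 1"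
  have e1: "norm e = 1" by (simp add: e_def)
  define q where "q n x = (h (x + s n *\<^sub>R e) - h x) / s n" for n x
  have hb: "h \<in> borel_measurable borel" using hc by (rule borel_measurable_continuous_onI)
  have hi: "integrable lborel h"
  proof -
    have "integrable lebesgue h"
      using integrable_continuous_bounded_support[of UNIV h B] hc B
      by (auto simp: lebesgue_on_UNIV_eq intro!: bounded_subset[OF compact_imp_bounded[OF compact_continuous_image[OF continuous_on_subset[OF hc] compact_cball[of 0 r]]]] image_mono r)
    then show ?thesis using hb by (simp add: integrable_completion)
  qed
  have ti: "integrable lborel (\<lambda>x. h (t + x))" "integral\<^sup>L lborel (\<lambda>x. h (t + x)) = integral\<^sup>L lborel h" for t
    using integrable_distr_eq[of "(+) t" lborel borel h] integral_distr[of "(+) t" lborel borel h] hb hi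
    by (auto simp: lborel_distr_plus)
  have q0: "integral\<^sup>L lborel (q n) = 0" for n
    unfolding q_def using ti[of "s n *\<^sub>R e"] hi by (simp add: add.commute)
  have qb: "norm (q n x) \<le> max 0 M * indicator (cball 0 (r + 1)) x" for n x
  proof (cases "x \<in> cball 0 (r + 1)")
    case True
    have "\<exists>z. 0 < z \<and> z < s n \<and> h (x + s n *\<^sub>R e) - h (x + 0 *\<^sub>R e) = (s n - 0) * partial i h (x + z *\<^sub>R e)"
      by (rule MVT2[OF s(1)]) (auto simp: e_def intro!: partial_line_derivative d)
    then obtain z where "h (x + s n *\<^sub>R e) - h x = s n * partial i h (x + z *\<^sub>R e)" by auto
    then have "q n x = partial i h (x + z *\<^sub>R e)" using s(1)[of n] by (simp add: q_def)
    then show ?thesis using True M by simp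
  next
    case False
    have "norm x \<le> norm (x + s n *\<^sub>R e) + s n"
      using norm_triangle_ineq4[of "x + s n *\<^sub>R e" "s n *\<^sub>R e"] e1 s(1)[of n] by simp
    then have "x \<notin> B" "x + s n *\<^sub>R e \<notin> B"
      using False r(1) s(2)[of n] by (auto dest!: subsetD[OF r(1)])
    then show ?thesis using False by (simp add: q_def B(2))
  qed
  have ql: "(\<lambda>n. q n x) \<longlonglongrightarrow> partial i h x" for x
  proof -
    have "((\<lambda>t. h (x + t *\<^sub>R e)) has_real_derivative partial i h (x + 0 *\<^sub>R e)) (at 0)"
      unfolding e_def by (rule partial_line_derivative) (simp add: d)
    then have "((\<lambda>t. (h (x + t *\<^sub>R e) - h x) / t) \<longlongrightarrow> partial i h x) (at 0)" by (simp add: DERIV_def)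
    moreover have "filterlim s (at 0) sequentially"
      unfolding filterlim_at s_def using LIMSEQ_inverse_real_of_nat by (auto simp: eventually_sequentially)
    ultimately show ?thesis unfolding q_def by (rule filterlim_compose)
  qed
  have "(\<lambda>n. integral\<^sup>L lborel (q n)) \<longlonglongrightarrow> integral\<^sup>L lborel (partial i h)"
  proof (rule integral_dominated_convergence[where w = "\<lambda>x. max 0 M * indicator (cball 0 (r + 1)) x"])
    show "partial i h \<in> borel_measurable lborel"
      using borel_measurable_continuous_onI[OF c] by simp
    show "q n \<in> borel_measurable lborel" for n
      unfolding q_def using hb by measurable
    show "integrable lborel (\<lambda>x. max 0 M * indicat_real (cball (0::real^'n) (r + 1)) x)"
      using emeasure_lborel_cball_finite[of "0::real^'n" "r + 1"]
      by (intro integrable_mult_right impI integrable_real_indicator) auto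
  qed (use ql qb in auto)
  then have "integral\<^sup>L lborel (partial i h) = 0" using q0 by (simp add: LIMSEQ_const_iff)
  then show ?thesis using borel_measurable_continuous_onI[OF c] by (simp add: integral_completion)
qed

text \<open>
  The open sets \<open>S\<close> and \<open>- C\<close> cover the space, and on each of them the extension is
  \<open>C\<^sup>1\<close>.
\<close>

lemma zero_extension:
  fixes h :: "real^'n::finite \<Rightarrow> real"
  assumes S: "open S" and h: "Ck_on 1 S h"
    and C: "compact C" "C \<subseteq> S" "\<forall>x\<in>S - C. h x = 0"
  defines "k \<equiv> (\<lambda>x. if x \<in> S then h x else 0)"
  shows "k differentiable (at x)" "partial i k = (\<lambda>x. if x \<in> S then partial i h x else 0)"
    "continuous_on UNIV (partial i k)"
proof -
  have h': "\<And>x. x \<in> S \<Longrightarrow> h differentiable (at x)" "continuous_on S (partial i h)" for i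
    using h unfolding One_nat_def Ck_on_Suc Ck_on_0 by blast+
  have oC: "open (- C)" using C(1) by (simp add: compact_imp_closed open_Compl)
  have kS: "k x = h x" if "x \<in> S" for x using that by (simp add: k_def)
  have kC: "k x = 0" if "x \<in> - C" for x using that C(3) by (simp add: k_def)
  show "k differentiable (at x)"
  proof (cases "x \<in> S")
    case True
    from differentiable_cong_open[OF S True kS] h'(1)[OF True] show ?thesis by simp
  next
    case False
    then have "x \<in> - C" using C(2) by auto
    from differentiable_cong_open[OF oC this kC] show ?thesis by simp
  qed
  have pS: "partial i k x = partial i h x" if "x \<in> S" for x i
    by (rule partial_cong_open[OF S that kS])
  have pC: "partial i k x = 0" if "x \<in> - C" for x i
    using partial_cong_open[OF oC that kC] by simp
  show "partial i k = (\<lambda>x. if x \<in> S then partial i h x else 0)"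
    using pS pC C(2) by (force simp: fun_eq_iff)
  have "continuous_on (S \<union> - C) (partial i k)"
  proof (rule continuous_on_open_Un[OF S oC])
    show "continuous_on S (partial i k)" by (rule continuous_on_eq[OF h'(2)]) (simp add: pS)
    show "continuous_on (- C) (partial i k)" by (rule continuous_on_eq[OF continuous_on_const[of _ 0]]) (simp add: pC)
  qed
  moreover have "S \<union> - C = UNIV" using C(2) by auto
  ultimately show "continuous_on UNIV (partial i k)" by simp
qed

lemma integral_partial_compact_support:
  fixes h :: "real^'n::finite \<Rightarrow> real"
  assumes S: "open S" and h: "Ck_on 1 S h"
    and C: "compact C" "C \<subseteq> S" "\<And>x. x \<in> S \<Longrightarrow> x \<notin> C \<Longrightarrow> h x = 0"
  shows "integral\<^sup>L (lebesgue_on S) (partial i h) = 0"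
proof -
  have C0: "\<forall>x\<in>S - C. h x = 0" using C(3) by blast
  note k = zero_extension[OF S h C(1,2) C0]
  have "integral\<^sup>L lebesgue (partial i (\<lambda>x. if x \<in> S then h x else 0)) = 0"
    by (rule integral_partial_compact_support_UNIV[OF k(1) k(3) compact_imp_bounded[OF C(1)]]) (auto intro: C(3))
  then show ?thesis
    unfolding k(2) using Lebesgue_Measure.integral_restrict_UNIV[of S "partial i h"] open_sets_lebesgue[OF S] by simp
qed

definition vanishes_on_frontier :: "(real^'n::finite) set \<Rightarrow> (real^'n \<Rightarrow> real) \<Rightarrow> bool" where
  "vanishes_on_frontier S f \<longleftrightarrow> (\<forall>z\<in>frontier S. (f \<longlongrightarrow> 0) (at z within S))"

text \<open>
  Closedness is the point: the set has no limit point on the frontier, where \<open>f\<close> tends to 0.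
\<close>

lemma compact_superlevel:
  assumes S: "open S" and f: "continuous_on S f" "vanishes_on_frontier S f" and e: "0 < e"
  shows "compact {x \<in> S \<inter> cball 0 r. e \<le> \<bar>f x\<bar>}" (is "compact ?C")
proof -
  have "closed ?C"
    unfolding closed_limpt
  proof (intro allI impI)
    fix z assume z: "z islimpt ?C"
    then have "z islimpt cball 0 r" by (rule islimpt_subset) auto
    then have zr: "z \<in> cball 0 r" using closed_cball closed_limpt by blast
    have nt: "at z within ?C \<noteq> bot" using z by (simp add: trivial_limit_within)
    have "z islimpt S" using z by (rule islimpt_subset) auto
    then have zc: "z \<in> closure S" by (simp add: closure_def)
    have ev: "\<forall>\<^sub>F x in at z within ?C. e \<le> \<bar>f x\<bar>" by (simp add: eventually_at_filter)
    show "z \<in> ?C"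
    proof (cases "z \<in> S")
      case True
      then have "(f \<longlongrightarrow> f z) (at z within S)" using f(1) by (simp add: continuous_on)
      then have "(f \<longlongrightarrow> f z) (at z within ?C)" by (rule tendsto_within_subset) auto
      then have "((\<lambda>x. \<bar>f x\<bar>) \<longlongrightarrow> \<bar>f z\<bar>) (at z within ?C)" by (rule tendsto_rabs)
      from tendsto_lowerbound[OF this ev nt] show ?thesis using True zr by auto
    next
      case False
      then have "z \<in> frontier S" using zc S by (simp add: frontier_def interior_open)
      then have "(f \<longlongrightarrow> 0) (at z within S)" using f(2) by (simp add: vanishes_on_frontier_def)
      then have "(f \<longlongrightarrow> 0) (at z within ?C)" by (rule tendsto_within_subset) auto
      then have "((\<lambda>x. \<bar>f x\<bar>) \<longlongrightarrow> \<bar>0\<bar>) (at z within ?C)" by (rule tendsto_rabs)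
      from tendsto_lowerbound[OF this ev nt] show ?thesis using e by simp
    qed
  qed
  moreover have "bounded ?C" by (rule bounded_subset[OF bounded_cball[of 0 r]]) auto
  ultimately show ?thesis by (simp add: compact_eq_bounded_closed)
qed

definition bounded_subsets :: "(real^'n::finite) set \<Rightarrow> (real^'n) set set" where
  "bounded_subsets S = {B. B \<subseteq> S \<and> bounded B}"

abbreviation Ck_loc :: "nat \<Rightarrow> (real^'n::finite) set \<Rightarrow> (real^'n \<Rightarrow> real) \<Rightarrow> bool" where
  "Ck_loc k S f \<equiv> Ck_bdd (bounded_subsets S) k S f"

lemma Ck_bddD:
  assumes "Ck_loc (Suc k) S f"
  shows "\<And>x. x \<in> S \<Longrightarrow> f differentiable (at x)" "continuous_on S f" "continuous_on S (partial i f)"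
    "bounded B \<Longrightarrow> bounded (f ` (S \<inter> B))" "bounded B \<Longrightarrow> bounded (partial i f ` (S \<inter> B))"
  using assms Ck_bdd_mono[of _ k S "partial i f" 0]
  by (auto simp: Ck_bdd_Suc Ck_bdd_0 bounded_subsets_def)

text \<open>
  By the last assumption \<open>trunc e f * g\<close> has compact support in \<open>S\<close>, so the integral of its partial
  derivative vanishes; then \<open>e\<close> tends to 0. The slope of \<open>trunc e\<close> becomes the indicator of the
  set where \<open>f\<close> is not 0.
\<close>

lemma integration_by_parts_nonzero:
  fixes f g :: "real^'n::finite \<Rightarrow> real"
  assumes S: "open S" and f: "Ck_loc 1 S f" and g: "Ck_loc 1 S g"
    and B: "compact B" "\<And>x. x \<in> S \<Longrightarrow> x \<notin> B \<Longrightarrow> g x = 0"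
    and C: "\<And>e. 0 < e \<Longrightarrow> \<exists>C. compact C \<and> C \<subseteq> S \<and> (\<forall>x\<in>S - C. \<bar>f x\<bar> \<le> e \<or> g x = 0)"
  shows "integral\<^sup>L (lebesgue_on S) (\<lambda>x. (if f x = 0 then 0 else 1) * partial i f x * g x + f x * partial i g x) = 0"
proof -
  note fD = Ck_bddD[OF f[unfolded One_nat_def]] and gD = Ck_bddD[OF g[unfolded One_nat_def]]
  note bB = compact_imp_bounded[OF B(1)]
  obtain r where r: "B \<subseteq> cball 0 r" using bB bounded_subset_ballD[of B 0] ball_subset_cball by blast
  have S': "S \<in> sets lebesgue" using S by (rule open_sets_lebesgue)
  have gB: "partial i g x = 0" if "x \<in> S" "x \<notin> B" for x
  proof -
    have "open (S - B)" using S B(1) by (simp add: compact_imp_closed open_Diff)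
    from partial_cong_open[OF this, of x g "\<lambda>_. 0"] that B(2) show ?thesis by auto
  qed
  define e where "e n = inverse (real (Suc n))" for n
  have e: "0 < e n" for n by (simp add: e_def)
  define q where "q n x = trunc' (e n) (f x) * partial i f x * g x + trunc (e n) (f x) * partial i g x" for n x
  have q0: "integral\<^sup>L (lebesgue_on S) (q n) = 0" for n
  proof -
    define h where "h x = trunc (e n) (f x) * g x" for x
    have t1: "(trunc (e n) has_real_derivative trunc' (e n) t) (at t)" for t using trunc_deriv[OF e] .
    have "Ck_on 1 S (\<lambda>x. (case 0 of 0 \<Rightarrow> trunc (e n) | Suc _ \<Rightarrow> trunc' (e n)) (f x))"
      by (rule Ck_on_compose[OF S Ck_bdd_imp_Ck_on[OF f], of "\<lambda>j. (case j of 0 \<Rightarrow> trunc (e n) | Suc _ \<Rightarrow> trunc' (e n))"])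
        (auto intro: t1 continuous_trunc'[OF e])
    then have "Ck_on 1 S h"
      unfolding h_def by (intro Ck_on_mult[OF S] Ck_bdd_imp_Ck_on[OF g]) simp
    moreover obtain C where "compact C" "C \<subseteq> S" "\<forall>x\<in>S - C. \<bar>f x\<bar> \<le> e n \<or> g x = 0"
      using C[OF e] by blast
    ultimately have "integral\<^sup>L (lebesgue_on S) (partial i h) = 0"
      using trunc_zero[OF e, of "f _" n]
      by (intro integral_partial_compact_support[OF S, of h C]) (auto simp: h_def)
    moreover have "partial i h x = q n x" if "x \<in> S" for x
      unfolding h_def q_def
      using that by (subst partial_mult) (auto intro!: differentiable_compose_real[OF _ t1] fD gD simp: partial_compose[OF _ t1] fD)
    ultimately show ?thesis
      using Bochner_Integration.integral_cong[of "lebesgue_on S" "lebesgue_on S" "partial i h" "q n"] by simp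
  qed
  obtain c where c: "\<And>x. x \<in> S \<inter> B \<Longrightarrow> \<bar>f x\<bar> \<le> c" "\<And>x. x \<in> S \<inter> B \<Longrightarrow> \<bar>partial i f x\<bar> \<le> c"
     "\<And>x. x \<in> S \<inter> B \<Longrightarrow> \<bar>g x\<bar> \<le> c" "\<And>x. x \<in> S \<inter> B \<Longrightarrow> \<bar>partial i g x\<bar> \<le> c"
  proof -
    have "bounded (f ` (S \<inter> B) \<union> partial i f ` (S \<inter> B) \<union> g ` (S \<inter> B) \<union> partial i g ` (S \<inter> B))"
      unfolding bounded_Un using fD(4)[OF bB] fD(5)[OF bB] gD(4)[OF bB] gD(5)[OF bB] by blast
    then obtain c where "\<forall>y\<in>f ` (S \<inter> B) \<union> partial i f ` (S \<inter> B) \<union> g ` (S \<inter> B) \<union> partial i g ` (S \<inter> B). \<bar>y\<bar> \<le> c"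
      unfolding bounded_iff real_norm_def by blast
    then show ?thesis by (intro that[of c]) blast+
  qed
  define L where "L x = (if f x = 0 then 0 else 1) * partial i f x * g x + f x * partial i g x" for x
  have qb: "\<bar>q n x\<bar> \<le> 2 * c^2 * indicator (cball 0 r) x" if "x \<in> S" for n x
  proof (cases "x \<in> B")
    case True
    have a: "\<bar>trunc' (e n) (f x)\<bar> \<le> 1" using trunc'_bounds[OF e, of n "f x"] by simp
    have b: "\<bar>trunc (e n) (f x)\<bar> \<le> c"
      using trunc_abs_le[OF e, of n "f x"] c(1)[of x] True that by simp
    have "\<bar>q n x\<bar> \<le> 1 * c * c + c * c"
      unfolding q_def
      by (rule abs_triangle_ineq[THEN order_trans], unfold abs_mult, intro add_mono mult_mono a b c)
        (use True that a b c(2)[of x] in auto)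
    then show ?thesis using True r by (auto simp: power2_eq_square)
  qed (use that B gB in \<open>simp add: q_def\<close>)
  have qm: "q n \<in> borel_measurable (lebesgue_on S)" for n
  proof (rule continuous_imp_measurable_on_sets_lebesgue[OF _ S'])
    have "continuous_on S (\<lambda>x. trunc (e n) (f x))"
      by (rule continuous_on_compose2[OF DERIV_continuous_on[of UNIV "trunc (e n)" "trunc' (e n)"] fD(2)])
        (auto intro: has_field_derivative_at_within trunc_deriv[OF e])
    moreover have "continuous_on S (\<lambda>x. trunc' (e n) (f x))"
      by (rule continuous_on_compose2[OF continuous_trunc'[OF e] fD(2)]) auto
    ultimately show "continuous_on S (q n)" unfolding q_def by (intro continuous_intros fD gD)
  qed
  have ql: "(\<lambda>n. q n x) \<longlonglongrightarrow> L x" for x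
    unfolding q_def L_def e_def by (intro tendsto_intros trunc_tendsto trunc'_tendsto)
  have Lm: "L \<in> borel_measurable (lebesgue_on S)"
    by (rule borel_measurable_LIMSEQ_metric[OF qm]) (use ql in auto)
  have "(\<lambda>n. integral\<^sup>L (lebesgue_on S) (q n)) \<longlonglongrightarrow> integral\<^sup>L (lebesgue_on S) L"
  proof (rule integral_dominated_convergence[OF Lm qm, where w = "\<lambda>x. 2 * c^2 * indicator (cball 0 r) x"])
    show "integrable (lebesgue_on S) (\<lambda>x. 2 * c^2 * indicat_real (cball 0 r) x)"
      by (rule integrable_indicator_cball[OF S'])
  qed (use ql qb in \<open>auto intro!: AE_I2\<close>)
  then show ?thesis unfolding L_def using q0 by (simp add: LIMSEQ_const_iff)
qed

section \<open>Smooth bump_kernels and mollification\<close>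

text \<open>
  The case \<open>k = 0\<close> is the usual smooth function that is flat at 0. The powers in the denominator make
  the linear span of the family closed under differentiation.
\<close>

definition flat :: "nat \<Rightarrow> real \<Rightarrow> real" where
  "flat k t = (if t > 0 then exp (- 1 / t) / t ^ k else 0)"

lemma flat_deriv: "(flat k has_real_derivative flat (k + 2) t - k * flat (k + 1) t) (at t)"
proof (cases t "0::real" rule: linorder_cases)
  case less
  have "((\<lambda>t. 0) has_real_derivative flat (k + 2) t - k * flat (k + 1) t) (at t)"
    using less by (simp add: flat_def)
  then show ?thesis
    by (rule has_field_derivative_transform_within_open[of _ _ _ "{..<0}"])
      (use less in \<open>auto simp: flat_def\<close>)
next
  case equal
  have "((\<lambda>h. flat (k + 1) h) \<longlongrightarrow> 0) (at 0)"
  proof -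
    have "((\<lambda>t. exp (- 1 / t) / t ^ (k + 1)) \<longlongrightarrow> 0) (at_right (0::real))"
    proof -
      have "((\<lambda>t. (inverse t) ^ (k+1) / exp (inverse t)) \<longlongrightarrow> (0::real)) (at_right (0::real))"
        by (rule filterlim_compose[OF tendsto_power_div_exp_0 filterlim_inverse_at_top_right])
      moreover have "(inverse t) ^ (k+1) / exp (inverse t) = exp (- 1 / t) / t ^ (k + 1)" for t :: real
        by (simp add: exp_minus divide_inverse power_inverse mult.commute)
      ultimately show ?thesis by simp
    qed
    then have "(flat (k + 1) \<longlongrightarrow> 0) (at_right (0::real))"
      by (rule tendsto_cong[THEN iffD1, rotated])
        (auto simp: flat_def eventually_at_filter)
    moreover have "(flat (k + 1) \<longlongrightarrow> 0) (at_left (0::real))"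
      by (rule tendsto_eventually) (auto simp: flat_def eventually_at_filter)
    ultimately show ?thesis by (simp add: filterlim_at_split)
  qed
  moreover have "flat k h / h = flat (k + 1) h" if "h \<noteq> 0" for h using that by (simp add: flat_def)
  ultimately have "((\<lambda>h. flat k h / h) \<longlongrightarrow> 0) (at 0)"
    by (subst tendsto_cong[where g="flat (k+1)"]) (auto simp: eventually_at_filter)
  then show ?thesis using equal by (simp add: DERIV_def flat_def)
next
  case greater
  have "((\<lambda>t. exp (- 1 / t) / t ^ k) has_real_derivative flat (k + 2) t - k * flat (k + 1) t) (at t)"
    using greater
  proof -
    have "real k * t ^ (k - Suc 0) = real k * t ^ k / t" using greater by (cases k) auto
    then show ?thesis using greater
      by (auto intro!: derivative_eq_intros simp: flat_def divide_simps power2_eq_square)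
        (simp add: algebra_simps)
  qed
  then show ?thesis
    by (rule has_field_derivative_transform_within_open[of _ _ _ "{0<..}"])
      (use greater in \<open>auto simp: flat_def\<close>)
qed

text \<open>
  A class of expressions closed under partial derivatives and consisting of differentiable functions;
  by coinduction its members are smooth.
\<close>

inductive smooth_term :: "(real^'n::finite \<Rightarrow> real) \<Rightarrow> bool" where
  "smooth_term (\<lambda>x. c)"
| "smooth_term (\<lambda>x. x $ i)"
| "smooth_term f \<Longrightarrow> smooth_term g \<Longrightarrow> smooth_term (\<lambda>x. f x + g x)"
| "smooth_term f \<Longrightarrow> smooth_term g \<Longrightarrow> smooth_term (\<lambda>x. f x * g x)"
| "smooth_term f \<Longrightarrow> smooth_term (\<lambda>x. flat k (f x))"

lemma partial_coord: "partial i (\<lambda>x. x $ j) = (\<lambda>x. if i = j then 1 else 0)"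
  by (rule ext, subst partial_eqI[OF bounded_linear.has_derivative[OF bounded_linear_vec_nth has_derivative_ident]])
    (auto simp: axis_def)

lemma smooth_term_partial:
  "smooth_term f \<Longrightarrow> (\<forall>x. f differentiable (at x)) \<and> (\<forall>i. smooth_term (partial i f))"
proof (induction rule: smooth_term.induct)
  case (2 j)
  have "(\<lambda>x. x $ j) differentiable (at x)" for x :: "real^'a"
    using bounded_linear_imp_differentiable[OF bounded_linear_vec_nth] .
  then show ?case by (auto simp: partial_coord intro: smooth_term.intros)
next
  case (3 f g)
  then have "partial i (\<lambda>x. f x + g x) = (\<lambda>x. partial i f x + partial i g x)" for i
    by (auto simp: partial_add)
  with 3 show ?case by (auto intro: smooth_term.intros)
next
  case (4 f g)
  then have "partial i (\<lambda>x. f x * g x) = (\<lambda>x. partial i f x * g x + f x * partial i g x)" for i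
    by (auto simp: partial_mult)
  moreover have "smooth_term (\<lambda>x. partial i f x * g x + f x * partial i g x)" for i
    using 4 by (intro smooth_term.intros) auto
  ultimately show ?case using 4 by auto
next
  case (5 f k)
  then have "partial i (\<lambda>x. flat k (f x)) =
      (\<lambda>x. (flat (k + 2) (f x) + (- real k) * flat (k + 1) (f x)) * partial i f x)" for i
    by (auto simp: partial_compose[OF _ flat_deriv])
  moreover have "smooth_term (\<lambda>x. (flat (k + 2) (f x) + (- real k) * flat (k + 1) (f x)) * partial i f x)" for i
    using 5 by (intro smooth_term.intros) auto
  ultimately show ?case
    using 5 by (auto intro: differentiable_compose_real[OF _ flat_deriv])
qed (auto intro: smooth_term.intros)

lemma smooth_on_UNIV_coinduct:
  assumes "P f" and P: "\<And>f. P f \<Longrightarrow> (\<forall>x. f differentiable (at x)) \<and> (\<forall>i. P (partial i f))"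
  shows "smooth_on UNIV f"
proof -
  have "Ck_on k UNIV f" for k
    using \<open>P f\<close>
  proof (induction k arbitrary: f)
    case 0
    with P show ?case
      by (auto simp: Ck_on_0 intro!: continuous_at_imp_continuous_on differentiable_imp_continuous_within)
  next
    case (Suc k)
    with P show ?case
      by (auto simp: Ck_on_Suc intro!: continuous_at_imp_continuous_on differentiable_imp_continuous_within)
  qed
  then show ?thesis by (simp add: smooth_on_def)
qed

lemma smooth_term_smooth: "smooth_term f \<Longrightarrow> smooth_on UNIV f"
  using smooth_on_UNIV_coinduct[of smooth_term f] smooth_term_partial by blast

lemma smooth_onD:
  assumes "smooth_on S f"
  shows "x \<in> S \<Longrightarrow> f differentiable (at x)" "continuous_on S f" "smooth_on S (partial i f)" "Ck_on k S f"
  using assms unfolding smooth_on_def Ck_on_Suc[symmetric]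
  using Ck_on_Suc[of _ S f] by (auto simp: Ck_on_Suc)

definition bump_kernel :: "real \<Rightarrow> real^'n::finite \<Rightarrow> real" where
  "bump_kernel d x = flat 0 (d\<^sup>2 - x \<bullet> x)"

lemma smooth_term_inner_self: "smooth_term (\<lambda>x::real^'n::finite. x \<bullet> x)"
proof -
  have "smooth_term (\<lambda>x::real^'n. \<Sum>i\<in>A. x $ i * x $ i)" for A
    by (induction A rule: infinite_finite_induct) (auto intro!: smooth_term.intros)
  then show ?thesis by (simp add: inner_vec_def)
qed

lemma bump_kernel_smooth: "smooth_on UNIV (bump_kernel d :: real^'n::finite \<Rightarrow> real)"
proof -
  have "smooth_term (\<lambda>x::real^'n. flat 0 (d\<^sup>2 + (-1) * (x \<bullet> x)))"
    by (intro smooth_term.intros smooth_term_inner_self)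
  then show ?thesis
    by (intro smooth_term_smooth) (simp add: bump_kernel_def[abs_def])
qed

lemma bump_kernel_nonneg: "0 \<le> bump_kernel d x" by (simp add: bump_kernel_def flat_def)

lemma bump_kernel_zero:
  assumes "d > 0" "d \<le> norm x"
  shows "bump_kernel d x = 0"
proof -
  have "d\<^sup>2 \<le> x \<bullet> x" using assms power_mono[of d "norm x" 2] by (simp add: power2_norm_eq_inner)
  then show ?thesis by (simp add: bump_kernel_def flat_def)
qed

lemma bump_kernel_integrable:
  assumes "d > 0" shows "integrable lebesgue (bump_kernel d :: real^'n::finite \<Rightarrow> real)"
proof -
  have c: "continuous_on UNIV (bump_kernel d :: real^'n \<Rightarrow> real)"
    using smooth_onD(2)[OF bump_kernel_smooth] .
  have "integrable (lebesgue_on UNIV) (bump_kernel d :: real^'n \<Rightarrow> real)"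
  proof (rule integrable_continuous_bounded_support[OF open_UNIV c, of "cball 0 d"])
    show "bounded (bump_kernel d ` (UNIV \<inter> cball (0::real^'n) d))"
      by (intro compact_imp_bounded compact_continuous_image continuous_on_subset[OF c]) auto
  qed (use assms in \<open>auto intro!: bump_kernel_zero\<close>)
  then show ?thesis by (simp add: lebesgue_on_UNIV_eq)
qed

lemma bump_kernel_mass_pos:
  assumes "d > 0" shows "0 < integral\<^sup>L lebesgue (bump_kernel d :: real^'n::finite \<Rightarrow> real)"
proof -
  have "\<not> (AE x in lebesgue. bump_kernel d (x::real^'n) = 0)"
  proof
    assume "AE x in lebesgue. bump_kernel d (x::real^'n) = 0"
    then obtain N where "{x. bump_kernel d (x::real^'n) \<noteq> 0} \<subseteq> N" "N \<in> null_sets lebesgue"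
      by (auto simp: eventually_ae_filter)
    then have n: "negligible {x. bump_kernel d (x::real^'n) \<noteq> 0}"
      using negligible_iff_null_sets negligible_subset by blast
    have "ball 0 d \<subseteq> {x. bump_kernel d (x::real^'n) \<noteq> 0}"
    proof
      fix x :: "real^'n" assume "x \<in> ball 0 d"
      then have "x \<bullet> x < d\<^sup>2" using power_strict_mono[of "norm x" d 2] by (simp add: power2_norm_eq_inner)
      then show "x \<in> {x. bump_kernel d x \<noteq> 0}" by (simp add: bump_kernel_def flat_def)
    qed
    with n have "negligible (ball (0::real^'n) d)" using negligible_subset by blast
    then show False using assms open_not_negligible[of "ball (0::real^'n) d"] by simp
  qed
  then have "integral\<^sup>L lebesgue (bump_kernel d :: real^'n \<Rightarrow> real) \<noteq> 0"
    using integral_nonneg_eq_0_iff_AE[OF bump_kernel_integrable[OF assms]] bump_kernel_nonneg by auto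
  moreover have "0 \<le> integral\<^sup>L lebesgue (bump_kernel d :: real^'n \<Rightarrow> real)"
    by (intro Bochner_Integration.integral_nonneg bump_kernel_nonneg)
  ultimately show ?thesis by simp
qed

text \<open>
  Differentiation under the integral sign; all derivatives fall on the kernel.
\<close>

lemma convolution_derivative:
  fixes f \<kappa> :: "real^'n::finite \<Rightarrow> real"
  assumes f: "continuous_on (cbox a b) f" and k: "smooth_on UNIV \<kappa>"
  shows "(\<lambda>x. integral (cbox a b) (\<lambda>y. f y * \<kappa> (x - y))) differentiable (at x)"
    and "partial i (\<lambda>x. integral (cbox a b) (\<lambda>y. f y * \<kappa> (x - y))) x =
      integral (cbox a b) (\<lambda>y. f y * partial i \<kappa> (x - y))"
proof -
  define D where "D x t = (\<Sum>i\<in>UNIV. (f t * partial i \<kappa> (x - t)) *\<^sub>R blinfun_inner_left (axis i 1 :: real^'n))" for x t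
  have pc: "continuous_on UNIV (partial i \<kappa>)" for i using smooth_onD(2)[OF smooth_onD(3)[OF k]] .
  have kc: "continuous_on UNIV \<kappa>" using smooth_onD(2)[OF k] .
  have c: "continuous_on (UNIV \<times> cbox a b) (\<lambda>(x, t). D x t)"
    unfolding D_def split_def
    by (intro continuous_intros continuous_on_compose2[OF f] continuous_on_compose2[OF pc]) auto
  have ci: "continuous_on (cbox a b) (D x)" for x
  proof -
    have "continuous_on (cbox a b) (\<lambda>t. (x, t))" by (intro continuous_intros)
    from continuous_on_compose2[OF c this] show ?thesis by auto
  qed
  have "((\<lambda>x. integral (cbox a b) (\<lambda>y. f y * \<kappa> (x - y))) has_derivative integral (cbox a b) (D x)) (at x within UNIV)" for x
  proof (rule leibniz_rule[OF _ _ c])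
    fix x t :: "real^'n" 
    have "(\<kappa> has_derivative (\<lambda>h. \<Sum>i\<in>UNIV. partial i \<kappa> (x - t) * h $ i)) (at (x - t))"
      using has_derivative_partial smooth_onD(1)[OF k] by blast
    then have "((\<lambda>x. \<kappa> (x - t)) has_derivative (\<lambda>h. \<Sum>i\<in>UNIV. partial i \<kappa> (x - t) * h $ i)) (at x)"
      by (rule has_derivative_compose[rotated]) (auto intro!: derivative_eq_intros)
    then have "((\<lambda>x. f t * \<kappa> (x - t)) has_derivative (\<lambda>h. f t * (\<Sum>i\<in>UNIV. partial i \<kappa> (x - t) * h $ i))) (at x)"
      by (rule has_derivative_mult_right)
    moreover have "blinfun_apply (D x t) = (\<lambda>h. f t * (\<Sum>i\<in>UNIV. partial i \<kappa> (x - t) * h $ i))"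
      by (auto simp: D_def blinfun.sum_left blinfun.scaleR_left inner_axis sum_distrib_left mult.assoc inner_commute)
    ultimately show "((\<lambda>x. f t * \<kappa> (x - t)) has_derivative blinfun_apply (D x t)) (at x within UNIV)" by simp
  next
    fix x show "(\<lambda>y. f y * \<kappa> (x - y)) integrable_on cbox a b"
      by (intro integrable_continuous continuous_intros f continuous_on_compose2[OF kc]) auto
  qed auto
  then have d: "((\<lambda>x. integral (cbox a b) (\<lambda>y. f y * \<kappa> (x - y))) has_derivative integral (cbox a b) (D x)) (at x)" for x
    by simp
  then show "(\<lambda>x. integral (cbox a b) (\<lambda>y. f y * \<kappa> (x - y))) differentiable (at x)" by (auto simp: differentiable_def)
  have "blinfun_apply (integral (cbox a b) (D x)) (axis i 1) = integral (cbox a b) (\<lambda>t. blinfun_apply (D x t) (axis i 1))"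
    by (rule blinfun_apply_integral) (rule integrable_continuous[OF ci])
  also have "(\<lambda>t. blinfun_apply (D x t) (axis i 1)) = (\<lambda>t. f t * partial i \<kappa> (x - t))"
    by (auto simp: D_def blinfun.sum_left blinfun.scaleR_left inner_axis_axis if_distrib sum.delta cong: if_cong)
  finally show "partial i (\<lambda>x. integral (cbox a b) (\<lambda>y. f y * \<kappa> (x - y))) x =
      integral (cbox a b) (\<lambda>y. f y * partial i \<kappa> (x - y))"
    using partial_eqI[OF d] by simp
qed

lemma convolution_smooth:
  fixes f \<kappa> :: "real^'n::finite \<Rightarrow> real"
  assumes f: "continuous_on (cbox a b) f" and k: "smooth_on UNIV \<kappa>"
  shows "smooth_on UNIV (\<lambda>x. integral (cbox a b) (\<lambda>y. f y * \<kappa> (x - y)))"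
proof (rule smooth_on_UNIV_coinduct[where P = "\<lambda>g. \<exists>\<kappa>. smooth_on UNIV \<kappa> \<and> g = (\<lambda>x. integral (cbox a b) (\<lambda>y. f y * \<kappa> (x - y)))"])
  fix g assume "\<exists>\<kappa>. smooth_on UNIV \<kappa> \<and> g = (\<lambda>x. integral (cbox a b) (\<lambda>y. f y * \<kappa> (x - y)))"
  then obtain \<kappa> where k: "smooth_on UNIV \<kappa>" and g: "g = (\<lambda>x. integral (cbox a b) (\<lambda>y. f y * \<kappa> (x - y)))" by blast
  have "partial i g = (\<lambda>x. integral (cbox a b) (\<lambda>y. f y * partial i \<kappa> (x - y)))" for i
    unfolding g using convolution_derivative(2)[OF f k] by blast
  then show "(\<forall>x. g differentiable (at x)) \<and>
    (\<forall>i. \<exists>\<kappa>. smooth_on UNIV \<kappa> \<and> partial i g = (\<lambda>x. integral (cbox a b) (\<lambda>y. f y * \<kappa> (x - y))))"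
    using convolution_derivative(1)[OF f k] smooth_onD(3)[OF k] g by blast
qed (use k in blast)

definition mollify :: "real \<Rightarrow> (real^'n::finite \<Rightarrow> real) \<Rightarrow> real^'n \<Rightarrow> real" where
  "mollify d f x = (LINT y|lebesgue. f y * bump_kernel d (x - y)) / integral\<^sup>L lebesgue (bump_kernel d :: real^'n \<Rightarrow> real)"

lemma integral_lebesgue_shift:
  fixes g :: "real^'n::finite \<Rightarrow> real"
  assumes "continuous_on UNIV g"
  shows "(LINT y|lebesgue. g (t + y)) = integral\<^sup>L lebesgue g"
    and "integrable lebesgue g \<Longrightarrow> integrable lebesgue (\<lambda>y. g (t + y))"
proof -
  have g: "g \<in> borel_measurable borel" using assms by (rule borel_measurable_continuous_onI)
  then have g': "(\<lambda>y. g (t + y)) \<in> borel_measurable borel" by measurable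
  show "(LINT y|lebesgue. g (t + y)) = integral\<^sup>L lebesgue g"
    using integral_distr[of "(+) t" lborel borel g] g g' by (simp add: lborel_distr_plus integral_completion)
  assume "integrable lebesgue g"
  then show "integrable lebesgue (\<lambda>y. g (t + y))"
    using integrable_distr_eq[of "(+) t" lborel borel g] g g' by (simp add: lborel_distr_plus integrable_completion)
qed

context
  fixes f :: "real^'n::finite \<Rightarrow> real" and K :: "(real^'n) set" and d :: real
  assumes f: "continuous_on UNIV f" and K: "compact K" "\<And>x. x \<notin> K \<Longrightarrow> f x = 0" and d: "0 < d"
begin

lemma compact_support_mult_integrable:
  assumes "continuous_on UNIV g"
  shows "integrable lebesgue (\<lambda>y. f y * g y)"
proof -
  have c: "continuous_on UNIV (\<lambda>y. f y * g y)" by (intro continuous_intros f assms)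
  have "integrable (lebesgue_on UNIV) (\<lambda>y. f y * g y)"
    by (rule integrable_continuous_bounded_support[OF open_UNIV c compact_imp_bounded[OF K(1)]])
      (auto simp: K(2) intro!: compact_imp_bounded compact_continuous_image continuous_on_subset[OF c] K(1))
  then show ?thesis by (simp add: lebesgue_on_UNIV_eq)
qed

lemma continuous_bump_kernel_shift: "continuous_on UNIV (\<lambda>y::real^'n. bump_kernel d (x - y))"
  by (rule continuous_on_compose2[OF smooth_onD(2)[OF bump_kernel_smooth]]) (auto intro!: continuous_intros)

lemma mollify_smooth: "smooth_on UNIV (mollify d f)"
  and mollify_partial_kernel: "partial i (mollify d f) x =
     (LINT y|lebesgue. f y * partial i (bump_kernel d) (x - y)) / integral\<^sup>L lebesgue (bump_kernel d :: real^'n \<Rightarrow> real)"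
proof -
  let ?m = "integral\<^sup>L lebesgue (bump_kernel d :: real^'n \<Rightarrow> real)"
  obtain a b where ab: "K \<subseteq> cbox a b"
    using bounded_subset_cbox_symmetric[OF compact_imp_bounded[OF K(1)]] by blast
  have eq: "(LINT y|lebesgue. f y * g (x - y)) = integral (cbox a b) (\<lambda>y. f y * g (x - y))"
    if "continuous_on UNIV g" for g x
  proof -
    have "continuous_on UNIV (\<lambda>y. g (x - y))"
      by (rule continuous_on_compose2[OF that]) (auto intro!: continuous_intros)
    from compact_support_mult_integrable[OF this]
    have "(LINT y|lebesgue. f y * g (x - y)) = integral UNIV (\<lambda>y. f y * g (x - y))"
      using lebesgue_integral_eq_integral[of UNIV] by (simp add: lebesgue_on_UNIV_eq)
    also have "\<dots> = integral UNIV (\<lambda>y. if y \<in> cbox a b then f y * g (x - y) else 0)"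
      by (rule arg_cong[where f="integral UNIV"]) (use ab K(2) in force)
    finally show ?thesis by (simp add: Henstock_Kurzweil_Integration.integral_restrict_UNIV)
  qed
  have k: "smooth_on UNIV (bump_kernel d :: real^'n \<Rightarrow> real)" by (rule bump_kernel_smooth)
  have fc: "continuous_on (cbox a b) f" using f continuous_on_subset by blast
  define F where "F x = integral (cbox a b) (\<lambda>y. f y * bump_kernel d (x - y))" for x
  have F: "smooth_on UNIV F" unfolding F_def by (rule convolution_smooth[OF fc k])
  have m: "mollify d f = (\<lambda>x. (1 / ?m) * F x)"
    unfolding mollify_def F_def eq[OF smooth_onD(2)[OF k]] by auto
  show "smooth_on UNIV (mollify d f)"
    unfolding m smooth_on_def using F[unfolded smooth_on_def] by (intro allI Ck_on_mult[OF open_UNIV Ck_on_const]) auto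
  show "partial i (mollify d f) x =
     (LINT y|lebesgue. f y * partial i (bump_kernel d) (x - y)) / ?m"
    unfolding m using partial_cmult[OF smooth_onD(1)[OF F], of x i "1 / ?m"] convolution_derivative(2)[OF fc k, of i x]
    by (simp add: eq[OF smooth_onD(2)[OF smooth_onD(3)[OF k]]] F_def[abs_def])
qed

text \<open>
  The derivative falls on the kernel; an integration by parts moves it to \<open>f\<close>.
\<close>

lemma mollify_partial:
  assumes "\<And>x. f differentiable (at x)" "continuous_on UNIV (partial i f)"
  shows "partial i (mollify d f) = mollify d (partial i f)"
proof
  fix x
  let ?k = "bump_kernel d :: real^'n \<Rightarrow> real"
  have k: "smooth_on UNIV ?k" by (rule bump_kernel_smooth)
  have pc: "continuous_on UNIV (\<lambda>y. partial i ?k (x - y))"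
    by (rule continuous_on_compose2[OF smooth_onD(2)[OF smooth_onD(3)[OF k]]]) (auto intro!: continuous_intros)
  have kd: "((\<lambda>y. ?k (x - y)) has_derivative (\<lambda>h. - (\<Sum>i\<in>UNIV. partial i ?k (x - y) * h $ i))) (at y)" for y
    by (rule has_derivative_compose[OF _ has_derivative_partial[OF smooth_onD(1)[OF k]], THEN has_derivative_eq_rhs])
      (auto intro!: derivative_eq_intros simp: sum_negf)
  have kd1: "(\<lambda>y. ?k (x - y)) differentiable (at y)" for y using kd by (auto simp: differentiable_def)
  have kp: "partial i (\<lambda>y. ?k (x - y)) y = - partial i ?k (x - y)" for y
    using partial_eqI[OF kd] by (simp add: axis_def if_distrib sum.delta cong: if_cong)
  have p: "partial i (\<lambda>y. f y * ?k (x - y)) = (\<lambda>y. partial i f y * ?k (x - y) - f y * partial i ?k (x - y))"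
    using assms(1) kd1 by (auto simp: partial_mult kp)
  have "integral\<^sup>L lebesgue (partial i (\<lambda>y. f y * ?k (x - y))) = 0"
  proof (rule integral_partial_compact_support_UNIV[where B=K])
    show "continuous_on UNIV (partial i (\<lambda>y. f y * ?k (x - y)))"
      unfolding p by (intro continuous_intros assms f pc continuous_bump_kernel_shift)
    show "(\<lambda>y. f y * ?k (x - y)) differentiable (at y)" for y
      by (intro differentiable_mult assms kd1)
  qed (auto simp: K compact_imp_bounded)
  moreover have "integrable lebesgue (\<lambda>y. partial i f y * ?k (x - y))"
  proof -
    have z: "partial i f y = 0" if "y \<notin> K" for y
      using partial_cong_open[of "- K" y f "\<lambda>_. 0"] that K by (auto simp: compact_imp_closed open_Compl)
    have c: "continuous_on UNIV (\<lambda>y. partial i f y * ?k (x - y))"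
      by (intro continuous_intros assms continuous_bump_kernel_shift)
    have "integrable (lebesgue_on UNIV) (\<lambda>y. partial i f y * ?k (x - y))"
      by (rule integrable_continuous_bounded_support[OF open_UNIV c compact_imp_bounded[OF K(1)]])
        (auto simp: z intro!: compact_imp_bounded compact_continuous_image continuous_on_subset[OF c] K(1))
    then show ?thesis by (simp add: lebesgue_on_UNIV_eq)
  qed
  ultimately have "(LINT y|lebesgue. partial i f y * ?k (x - y)) = (LINT y|lebesgue. f y * partial i ?k (x - y))"
    unfolding p using compact_support_mult_integrable[OF pc] by simp
  then show "partial i (mollify d f) x = mollify d (partial i f) x"
    unfolding mollify_partial_kernel by (simp add: mollify_def)
qed

lemma mollify_zero:
  assumes "\<And>y. y \<in> K \<Longrightarrow> d \<le> dist x y"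
  shows "mollify d f x = 0"
proof -
  have "f y * bump_kernel d (x - y) = 0" for y
    using K(2)[of y] bump_kernel_zero[OF d, of "x - y"] assms[of y] by (cases "y \<in> K") (auto simp: dist_norm)
  then have "(\<lambda>y. f y * bump_kernel d (x - y)) = (\<lambda>y. 0)" by blast
  then show ?thesis by (simp add: mollify_def)
qed

lemma mollify_near:
  assumes e: "\<And>y. dist x y \<le> d \<Longrightarrow> \<bar>f y - f x\<bar> \<le> e"
  shows "\<bar>mollify d f x - f x\<bar> \<le> e"
proof -
  let ?k = "bump_kernel d :: real^'n \<Rightarrow> real" and ?m = "integral\<^sup>L lebesgue (bump_kernel d :: real^'n \<Rightarrow> real)"
  have m: "0 < ?m" using bump_kernel_mass_pos[OF d] .
  have sym: "?k (x - y) = ?k (- x + y)" for y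
    by (simp add: bump_kernel_def inner_diff inner_commute algebra_simps)
  have kc: "continuous_on UNIV ?k" using smooth_onD(2)[OF bump_kernel_smooth] .
  have ki: "integrable lebesgue (\<lambda>y. ?k (x - y))" and km: "(LINT y|lebesgue. ?k (x - y)) = ?m"
    unfolding sym using integral_lebesgue_shift[OF kc, of "-x"] bump_kernel_integrable[OF d] by auto
  have fi: "integrable lebesgue (\<lambda>y. f y * ?k (x - y))"
    by (rule compact_support_mult_integrable[OF continuous_bump_kernel_shift])
  have "\<bar>(LINT y|lebesgue. (f y - f x) * ?k (x - y))\<bar> \<le> (LINT y|lebesgue. e * ?k (x - y))"
  proof (rule integral_abs_bound[THEN order_trans], rule integral_mono)
    show "integrable lebesgue (\<lambda>y. e * ?k (x - y))" using ki by simp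
    show "integrable lebesgue (\<lambda>y. \<bar>(f y - f x) * ?k (x - y)\<bar>)"
      using fi ki by (simp add: left_diff_distrib)
    show "\<bar>(f y - f x) * ?k (x - y)\<bar> \<le> e * ?k (x - y)" for y
    proof (cases "dist x y \<le> d")
      case True
      then show ?thesis using e[of y] bump_kernel_nonneg[of d "x - y"]
        by (auto simp: abs_mult intro: mult_right_mono)
    next
      case False
      then show ?thesis using bump_kernel_zero[OF d, of "x - y"] by (simp add: dist_norm)
    qed
  qed
  also have "(LINT y|lebesgue. e * ?k (x - y)) = e * ?m" using km by simp
  also have "(LINT y|lebesgue. (f y - f x) * ?k (x - y)) = (LINT y|lebesgue. f y * ?k (x - y)) - f x * ?m"
    using fi ki km by (simp add: left_diff_distrib)
  finally have "\<bar>(LINT y|lebesgue. f y * ?k (x - y)) - f x * ?m\<bar> \<le> e * ?m" .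
  moreover have "mollify d f x - f x = ((LINT y|lebesgue. f y * ?k (x - y)) - f x * ?m) / ?m"
    using m by (simp add: mollify_def field_simps)
  ultimately show ?thesis using m by (simp add: abs_div divide_le_eq)
qed

end

lemma uniform_oscillation:
  fixes f :: "real^'n::finite \<Rightarrow> real"
  assumes f: "continuous_on UNIV f" and K: "compact K" "\<And>x. x \<notin> K \<Longrightarrow> f x = 0" and e: "0 < e"
  shows "\<exists>d>0. \<forall>x y. dist x y \<le> d \<longrightarrow> \<bar>f y - f x\<bar> \<le> e"
proof -
  define K' where "K' = {x + y |x y. x \<in> K \<and> y \<in> cball (0::real^'n) 1}"
  have K': "compact K'" unfolding K'_def by (intro compact_sums K(1) compact_cball)
  have "uniformly_continuous_on K' f"
    by (intro compact_uniformly_continuous continuous_on_subset[OF f] K') auto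
  then obtain d where d: "d > 0" "\<And>x y. x \<in> K' \<Longrightarrow> y \<in> K' \<Longrightarrow> dist y x < d \<Longrightarrow> dist (f y) (f x) < e"
    using e unfolding uniformly_continuous_on_def by metis
  have KK': "y \<in> K'" if "x \<in> K" "dist x y \<le> 1" for x y
    unfolding K'_def mem_Collect_eq
    by (rule exI[of _ x], rule exI[of _ "y - x"]) (use that in \<open>simp add: dist_norm norm_minus_commute\<close>)
  have "\<bar>f y - f x\<bar> \<le> e" if xy: "dist x y \<le> min 1 (d / 2)" for x y
  proof (cases "x \<in> K \<or> y \<in> K")
    case True
    then have "x \<in> K' \<and> y \<in> K'" using KK'[of x y] KK'[of y x] KK'[of x x] KK'[of y y] xy by (auto simp: dist_commute)
    moreover have "dist y x < d" using xy d(1) by (simp add: dist_commute)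
    ultimately show ?thesis using d(2)[of x y] by (auto simp: dist_real_def)
  qed (use K(2) e in auto)
  then show ?thesis using d(1) by (intro exI[of _ "min 1 (d/2)"]) auto
qed

text \<open>
  Mollification. The supports stay in one compact subset of \<open>S\<close>, over which a locally integrable
  function can be integrated. Approximation of the derivatives is a separate clause: the fundamental lemma
  starts from functions \<open>f\<close> that are merely continuous, the membership in \<open>H\<^sup>1\<^sub>0\<close> from
  \<open>C\<^sup>1\<close> functions.
\<close>

lemma test_function_approximation:
  fixes f :: "real^'n::finite \<Rightarrow> real"
  assumes S: "open S" and K: "compact K" "K \<subseteq> S" and f: "continuous_on UNIV f" "\<And>x. x \<notin> K \<Longrightarrow> f x = 0"
  obtains K' where "compact K'" "K' \<subseteq> S" "K \<subseteq> K'"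
    "\<And>e. 0 < e \<Longrightarrow> \<exists>\<psi>. test_function S \<psi> \<and> (\<forall>x. x \<notin> K' \<longrightarrow> \<psi> x = 0) \<and> (\<forall>x. \<bar>\<psi> x - f x\<bar> \<le> e) \<and>
      ((\<forall>x. f differentiable (at x)) \<and> (\<forall>i. continuous_on UNIV (partial i f)) \<longrightarrow>
        (\<forall>i x. \<bar>partial i \<psi> x - partial i f x\<bar> \<le> e))"
proof -
  obtain r where r: "r > 0" "(\<Union>x\<in>K. cball x r) \<subseteq> S"
    using compact_subset_open_imp_cball_epsilon_subset[OF K(1) S K(2)] by blast
  define K' where "K' = {x + y |x y. x \<in> K \<and> y \<in> cball (0::real^'n) r}"
  have K'eq: "K' = (\<Union>x\<in>K. cball x r)"
  proof (intro set_eqI iffI)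
    fix z assume "z \<in> K'"
    then obtain x y where "z = x + y" "x \<in> K" "norm y \<le> r" by (auto simp: K'_def)
    then show "z \<in> (\<Union>x\<in>K. cball x r)" by (intro UN_I[of x]) (auto simp: dist_norm)
  next
    fix z assume "z \<in> (\<Union>x\<in>K. cball x r)"
    then obtain x where "x \<in> K" "dist x z \<le> r" by auto
    then show "z \<in> K'" unfolding K'_def mem_Collect_eq
      by (intro exI[of _ x] exI[of _ "z - x"]) (simp add: dist_norm norm_minus_commute)
  qed
  have K': "compact K'" unfolding K'_def by (intro compact_sums K(1) compact_cball)
  show ?thesis
  proof (rule that[OF K'])
    show "K' \<subseteq> S" using r K'eq by simp
    show "K \<subseteq> K'" using r(1) K'eq by auto
    fix e :: real assume e: "0 < e"
    show "\<exists>\<psi>. test_function S \<psi> \<and> (\<forall>x. x \<notin> K' \<longrightarrow> \<psi> x = 0) \<and> (\<forall>x. \<bar>\<psi> x - f x\<bar> \<le> e) \<and>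
      ((\<forall>x. f differentiable (at x)) \<and> (\<forall>i. continuous_on UNIV (partial i f)) \<longrightarrow>
        (\<forall>i x. \<bar>partial i \<psi> x - partial i f x\<bar> \<le> e))"
    proof -
      let ?C1 = "(\<forall>x. f differentiable (at x)) \<and> (\<forall>i. continuous_on UNIV (partial i f))"
      have pz: "partial i f y = 0" if "y \<notin> K" for y i
        using partial_cong_open[of "- K" y f "\<lambda>_. 0"] that K f(2) by (auto simp: compact_imp_closed open_Compl)
      have "\<exists>d>0. \<forall>x y. dist x y \<le> d \<longrightarrow> ?C1 \<longrightarrow> \<bar>partial i f y - partial i f x\<bar> \<le> e" for i
      proof (cases ?C1)
        case True
        then show ?thesis using uniform_oscillation[of "partial i f" K e] K(1) pz e by metis
      qed (auto intro: exI[of _ 1])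
      then obtain di where di: "\<And>i. di i > 0" "\<And>i x y. dist x y \<le> di i \<Longrightarrow> ?C1 \<Longrightarrow> \<bar>partial i f y - partial i f x\<bar> \<le> e"
        by metis
      obtain d0 where d0: "d0 > 0" "\<And>x y. dist x y \<le> d0 \<Longrightarrow> \<bar>f y - f x\<bar> \<le> e"
        using uniform_oscillation[OF f(1) K(1) f(2) e] by blast
      define d where "d = Min (insert r (insert d0 (range di)))"
      have d: "d > 0" "d \<le> r" "d \<le> d0" "d \<le> di i" for i
        unfolding d_def using r d0 di by (simp, (intro Min_le; simp)+)
      have ps: "smooth_on UNIV (mollify d f)" by (rule mollify_smooth[OF f(1) K(1) f(2) d(1)])
      have pz': "mollify d f x = 0" if "x \<notin> K'" for x
      proof (rule mollify_zero[OF f(1) K(1) f(2) d(1)])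
        fix y assume "y \<in> K"
        then have "x \<notin> cball y r" using that unfolding K'eq by blast
        then show "d \<le> dist x y" using d(2) by (simp add: dist_commute)
      qed
      show ?thesis
      proof (intro exI[of _ "mollify d f"] conjI allI impI)
        show "test_function S (mollify d f)"
          unfolding test_function_def using ps pz' K' \<open>K' \<subseteq> S\<close> by blast
        show "\<bar>mollify d f x - f x\<bar> \<le> e" for x
        proof (rule mollify_near[OF f(1) K(1) f(2) d(1)])
          fix y assume "dist x y \<le> d"
          then have "dist x y \<le> d0" using d(3) by simp
          then show "\<bar>f y - f x\<bar> \<le> e" by (rule d0(2))
        qed
        fix i x assume C1: ?C1
        have "\<bar>mollify d (partial i f) x - partial i f x\<bar> \<le> e"
        proof (rule mollify_near[of "partial i f" K, OF _ K(1) pz d(1)])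
          fix y assume "dist x y \<le> d"
          then have "dist x y \<le> di i" using d(4)[of i] by simp
          then show "\<bar>partial i f y - partial i f x\<bar> \<le> e" by (rule di(2)[OF _ C1])
        qed (use C1 in auto)
        then show "\<bar>partial i (mollify d f) x - partial i f x\<bar> \<le> e"
          using mollify_partial[OF f(1) K(1) f(2) d(1)] C1 by simp
      qed (use pz' in auto)
    qed
  qed
qed

section \<open>The fundamental lemma and weak derivatives\<close>

lemma absolutely_integrable_on_iff:
  fixes f :: "real^'n::finite \<Rightarrow> real"
  assumes "S \<in> sets lebesgue"
  shows "f absolutely_integrable_on S \<longleftrightarrow> integrable (lebesgue_on S) f"
  unfolding set_integrable_def using assms by (subst integrable_restrict_space) auto

lemma compact_sets_lebesgue: "compact K \<Longrightarrow> K \<in> sets lebesgue"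
  by (intro sets_completionI_sets) (simp add: borel_compact)

lemma locally_integrable_bounded:
  assumes S: "open S" and f: "f \<in> borel_measurable (lebesgue_on S)"
    and b: "\<And>K. compact K \<Longrightarrow> K \<subseteq> S \<Longrightarrow> bounded (f ` K)"
  shows "locally_integrable S f"
  unfolding locally_integrable_def
proof (intro allI impI)
  fix K assume K: "compact K \<and> K \<subseteq> S"
  then have Ks: "K \<in> sets lebesgue" by (simp add: compact_sets_lebesgue)
  obtain c where c: "\<And>x. x \<in> K \<Longrightarrow> \<bar>f x\<bar> \<le> c" using b[of K] K unfolding bounded_iff by auto
  have "integrable (lebesgue_on K) f"
  proof (rule integrable_bounded_support[of K f K c, OF Ks])
    show "f \<in> borel_measurable (lebesgue_on K)"
      using f K by (meson measurable_restrict_mono)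
  qed (use K c in \<open>auto simp: compact_imp_bounded\<close>)
  then show "f absolutely_integrable_on K" by (simp add: absolutely_integrable_on_iff[OF Ks])
qed

lemma locally_integrable_continuous:
  assumes S: "open S" and f: "continuous_on S f"
  shows "locally_integrable S f"
  by (rule locally_integrable_bounded[OF S continuous_imp_measurable_on_sets_lebesgue[OF f open_sets_lebesgue[OF S]]])
    (use f in \<open>auto intro!: compact_imp_bounded compact_continuous_image intro: continuous_on_subset\<close>)

lemma integral_lebesgue_on_subset:
  fixes f :: "real^'n::finite \<Rightarrow> real"
  assumes "T \<subseteq> S" "T \<in> sets lebesgue" "S \<in> sets lebesgue" "\<And>x. x \<in> S \<Longrightarrow> x \<notin> T \<Longrightarrow> f x = 0"
  shows "integral\<^sup>L (lebesgue_on S) f = integral\<^sup>L (lebesgue_on T) f"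
proof -
  have "integral\<^sup>L (lebesgue_on S) f = integral\<^sup>L (lebesgue_on S) (\<lambda>x. if x \<in> T then f x else 0)"
    by (rule Bochner_Integration.integral_cong) (use assms(4) in auto)
  then show ?thesis using Lebesgue_Measure.integral_restrict[OF assms(1-3)] by simp
qed

lemma locally_integrable_mult:
  fixes g :: "real^'n::finite \<Rightarrow> real"
  assumes g: "locally_integrable S g" and \<psi>: "continuous_on UNIV \<psi>" and K: "compact K" "K \<subseteq> S"
  shows "integrable (lebesgue_on K) g" "integrable (lebesgue_on K) (\<lambda>x. g x * \<psi> x)"
    and "open S \<Longrightarrow> (\<And>x. x \<notin> K \<Longrightarrow> \<psi> x = 0) \<Longrightarrow> integrable (lebesgue_on S) (\<lambda>x. g x * \<psi> x)"
proof -
  have Ks: "K \<in> sets lebesgue" using K(1) by (rule compact_sets_lebesgue)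
  show gi: "integrable (lebesgue_on K) g"
    using g K Ks by (auto simp: locally_integrable_def absolutely_integrable_on_iff)
  have "bounded (\<psi> ` K)" by (intro compact_imp_bounded compact_continuous_image continuous_on_subset[OF \<psi>] K) auto
  then obtain c where c: "\<And>x. x \<in> K \<Longrightarrow> \<bar>\<psi> x\<bar> \<le> c" by (auto simp: bounded_iff)
  have hm: "\<psi> \<in> borel_measurable (lebesgue_on K)"
    using continuous_imp_measurable_on_sets_lebesgue[OF continuous_on_subset[OF \<psi>] Ks] by simp
  show i: "integrable (lebesgue_on K) (\<lambda>x. g x * \<psi> x)"
  proof (rule Bochner_Integration.integrable_bound[of _ "\<lambda>x. c * g x"])
    show "AE x in lebesgue_on K. norm (g x * \<psi> x) \<le> norm (c * g x)"
    proof (intro AE_I2)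
      fix x assume "x \<in> space (lebesgue_on K)"
      then have "\<bar>\<psi> x\<bar> \<le> \<bar>c\<bar>" using c[of x] by simp
      then have "\<bar>\<psi> x\<bar> * \<bar>g x\<bar> \<le> \<bar>c\<bar> * \<bar>g x\<bar>" by (intro mult_right_mono) auto
      then show "norm (g x * \<psi> x) \<le> norm (c * g x)" by (simp add: abs_mult mult.commute)
    qed
  qed (use gi hm in auto)
  assume S: "open S" and z: "\<And>x. x \<notin> K \<Longrightarrow> \<psi> x = 0"
  have "(\<lambda>x. g x * \<psi> x) absolutely_integrable_on K" using i by (simp add: absolutely_integrable_on_iff[OF Ks])
  then have "set_integrable lebesgue S (\<lambda>x. g x * \<psi> x)"
    unfolding set_integrable_def
    by (rule Bochner_Integration.integrable_cong[THEN iffD1, rotated 2]) (use z K(2) in \<open>auto simp: indicator_def\<close>)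
  then show "integrable (lebesgue_on S) (\<lambda>x. g x * \<psi> x)"
    by (simp add: absolutely_integrable_on_iff[OF open_sets_lebesgue[OF S]])
qed

text \<open>
  The integral of \<open>\<bar>g\<bar>\<close> over the common compact support turns uniform approximation of
  \<open>f\<close> into approximation of the integral.
\<close>

lemma integral_against_continuous_zero:
  fixes g :: "real^'n::finite \<Rightarrow> real"
  assumes S: "open S" and g: "locally_integrable S g"
    and 0: "\<And>\<psi>. test_function S \<psi> \<Longrightarrow> (LINT x|lebesgue_on S. g x * \<psi> x) = 0"
    and K: "compact K" "K \<subseteq> S" and f: "continuous_on UNIV f" "\<And>x. x \<notin> K \<Longrightarrow> f x = 0"
  shows "(LINT x|lebesgue_on S. g x * f x) = 0"
proof -
  obtain K' where K': "compact K'" "K' \<subseteq> S" "K \<subseteq> K'" and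
    ap: "\<And>e. 0 < e \<Longrightarrow> \<exists>\<psi>. test_function S \<psi> \<and> (\<forall>x. x \<notin> K' \<longrightarrow> \<psi> x = 0) \<and> (\<forall>x. \<bar>\<psi> x - f x\<bar> \<le> e) \<and>
      ((\<forall>x. f differentiable (at x)) \<and> (\<forall>i. continuous_on UNIV (partial i f)) \<longrightarrow>
        (\<forall>i x. \<bar>partial i \<psi> x - partial i f x\<bar> \<le> e))"
    by (rule test_function_approximation[OF S K f(1)]) (erule f(2), rule that)
  have Ks: "K' \<in> sets lebesgue" using K'(1) by (rule compact_sets_lebesgue)
  define I where "I = (LINT x|lebesgue_on K'. \<bar>g x\<bar>)"
  note gi = locally_integrable_mult(1)[OF g f(1) K'(1,2)] and mi = locally_integrable_mult(2)[OF g _ K'(1,2)]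
  have "\<bar>LINT x|lebesgue_on S. g x * f x\<bar> \<le> e * I" if e: "0 < e" for e
  proof -
    obtain \<psi> where p: "test_function S \<psi>" "\<forall>x. x \<notin> K' \<longrightarrow> \<psi> x = 0" "\<forall>x. \<bar>\<psi> x - f x\<bar> \<le> e"
      using ap[OF e] by blast
    have pc: "continuous_on UNIV \<psi>" using p(1) smooth_onD(2) by (auto simp: test_function_def)
    have r: "(LINT x|lebesgue_on S. g x * h x) = (LINT x|lebesgue_on K'. g x * h x)" if "\<forall>x. x \<notin> K' \<longrightarrow> h x = 0" for h
      by (rule integral_lebesgue_on_subset[OF K'(2) Ks open_sets_lebesgue[OF S]]) (use that in auto)
    have f0: "\<forall>x. x \<notin> K' \<longrightarrow> f x = 0" using f(2) K'(3) by blast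
    have z: "(LINT x|lebesgue_on K'. g x * \<psi> x) = 0" using 0[OF p(1)] r[OF p(2)] by simp
    have "\<bar>LINT x|lebesgue_on S. g x * f x\<bar> = \<bar>LINT x|lebesgue_on K'. g x * f x - g x * \<psi> x\<bar>"
      using z mi[OF f(1)] mi[OF pc] by (simp add: r[OF f0])
    also have "\<dots> \<le> (LINT x|lebesgue_on K'. e * \<bar>g x\<bar>)"
    proof (rule integral_abs_bound[THEN order_trans], rule integral_mono)
      show "integrable (lebesgue_on K') (\<lambda>x. \<bar>g x * f x - g x * \<psi> x\<bar>)" using mi[OF f(1)] mi[OF pc] by simp
      show "\<bar>g x * f x - g x * \<psi> x\<bar> \<le> e * \<bar>g x\<bar>" for x
      proof -
        have "\<bar>g x * f x - g x * \<psi> x\<bar> = \<bar>\<psi> x - f x\<bar> * \<bar>g x\<bar>"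
          by (simp add: abs_mult abs_minus_commute flip: right_diff_distrib)
        also have "\<dots> \<le> e * \<bar>g x\<bar>" using p(3) by (intro mult_right_mono) auto
        finally show ?thesis .
      qed
    qed (use gi in simp)
    also have "\<dots> = e * I" by (simp add: I_def)
    finally show ?thesis .
  qed note * = this
  have I: "0 \<le> I" by (simp add: I_def)
  show ?thesis
  proof (rule ccontr)
    assume "(LINT x|lebesgue_on S. g x * f x) \<noteq> 0" (is "?J \<noteq> 0")
    then have "0 < \<bar>?J\<bar> / (2 * (I + 1))" using I by simp
    from *[OF this] have "\<bar>?J\<bar> \<le> \<bar>?J\<bar> / (2 * (I + 1)) * I" .
    also have "\<dots> < \<bar>?J\<bar>" using \<open>?J \<noteq> 0\<close> I by (simp add: divide_simps)
    finally show False by simp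
  qed
qed

text \<open>
  The continuous functions \<open>f n\<close> decrease to the indicator of \<open>K\<close>.
\<close>

lemma integral_compact_zero:
  fixes g :: "real^'n::finite \<Rightarrow> real"
  assumes S: "open S" and g: "locally_integrable S g"
    and 0: "\<And>\<psi>. test_function S \<psi> \<Longrightarrow> (LINT x|lebesgue_on S. g x * \<psi> x) = 0"
    and K: "compact K" "K \<subseteq> S" "K \<noteq> {}"
  shows "integral\<^sup>L (lebesgue_on K) g = 0"
proof -
  obtain r where r: "r > 0" "(\<Union>x\<in>K. cball x r) \<subseteq> S"
    using compact_subset_open_imp_cball_epsilon_subset[OF K(1) S K(2)] by blast
  define K' where "K' = {x. infdist x K \<le> r}"
  have "K' \<subseteq> S"
  proof
    fix x assume "x \<in> K'"
    then have "infdist x K \<le> r" by (simp add: K'_def)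
    moreover obtain y where "y \<in> K" "infdist x K = dist x y"
      using infdist_attains_inf[OF compact_imp_closed[OF K(1)] K(3)] by blast
    ultimately have "x \<in> cball y r" "y \<in> K" by (auto simp: dist_commute)
    then show "x \<in> S" using r(2) by blast
  qed
  have ic: "continuous_on UNIV (\<lambda>x. infdist x K)" by (intro continuous_intros)
  have "closed K'" unfolding K'_def by (intro closed_Collect_le continuous_on_const ic)
  moreover have "bounded K'"
  proof -
    obtain R where R: "\<And>x. x \<in> K \<Longrightarrow> norm x \<le> R" using compact_imp_bounded[OF K(1)] by (auto simp: bounded_iff)
    have "norm x \<le> R + r" if "x \<in> K'" for x
    proof -
      obtain y where "y \<in> K" "infdist x K = dist x y"
        using infdist_attains_inf[OF compact_imp_closed[OF K(1)] K(3)] by blast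
      then show ?thesis using that R[of y] norm_triangle_ineq2[of x y] by (simp add: K'_def dist_norm)
    qed
    then show ?thesis by (auto simp: bounded_iff)
  qed
  ultimately have K': "compact K'" by (simp add: compact_eq_bounded_closed)
  have Ks: "K' \<in> sets lebesgue" using K' by (rule compact_sets_lebesgue)
  have Ss: "S \<in> sets lebesgue" using S by (rule open_sets_lebesgue)
  have gi: "integrable (lebesgue_on K') g"
    using g K' Ks \<open>K' \<subseteq> S\<close> by (auto simp: locally_integrable_def absolutely_integrable_on_iff)
  define f where "f n x = max 0 (1 - (real (Suc n) / r) * infdist x K)" for n x
  have fc: "continuous_on UNIV (f n)" for n unfolding f_def by (intro continuous_intros ic)
  have f1: "0 \<le> f n x" "f n x \<le> 1" for n x unfolding f_def using r(1) infdist_nonneg[of x K] by auto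
  have fz: "f n x = 0" if "x \<notin> K'" for n x
  proof -
    have "r < infdist x K" using that by (simp add: K'_def)
    then have "real (Suc n) * r \<le> real (Suc n) * infdist x K" by (intro mult_left_mono) auto
    moreover have "r \<le> real (Suc n) * r" using r(1) by simp
    ultimately have "r \<le> real (Suc n) * infdist x K" by (rule order_trans[rotated])
    then have "1 \<le> (real (Suc n) / r) * infdist x K" using r(1) by (simp add: divide_simps del: of_nat_Suc)
    then show ?thesis by (simp add: f_def)
  qed
  have l: "(\<lambda>n. f n x) \<longlonglongrightarrow> indicator K x" for x
  proof (cases "x \<in> K")
    case True
    then show ?thesis by (simp add: f_def)
  next
    case False
    then have i: "infdist x K > 0"
      using in_closed_iff_infdist_zero[OF compact_imp_closed[OF K(1)] K(3), of x] infdist_nonneg[of x K] by force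
    obtain N where N: "r / infdist x K < real N" using reals_Archimedean2 by blast
    have "f n x = 0" if "n \<ge> N" for n
    proof -
      have "r / infdist x K \<le> real (Suc n)" using N that by linarith
      then have "1 \<le> (real (Suc n) / r) * infdist x K" using r(1) i by (simp add: divide_simps del: of_nat_Suc)
      then show ?thesis by (simp add: f_def)
    qed
    then have "\<forall>\<^sub>F n in sequentially. f n x = indicator K x"
      using False unfolding eventually_sequentially by (intro exI[of _ N]) simp
    then show ?thesis by (rule tendsto_eventually)
  qed
  have zero: "(LINT x|lebesgue_on K'. g x * f n x) = 0" for n
  proof -
    have "(LINT x|lebesgue_on S. g x * f n x) = 0"
      by (rule integral_against_continuous_zero[OF S g 0 K' \<open>K' \<subseteq> S\<close> fc fz])
    then show ?thesis
      using integral_lebesgue_on_subset[OF \<open>K' \<subseteq> S\<close> Ks Ss, of "\<lambda>x. g x * f n x"] fz by simp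
  qed
  have fm: "f n \<in> borel_measurable (lebesgue_on K')" for n
    using continuous_imp_measurable_on_sets_lebesgue[OF continuous_on_subset[OF fc] Ks] by simp
  have im: "indicat_real K \<in> borel_measurable (lebesgue_on K')"
    by (rule borel_measurable_LIMSEQ_real[OF _ fm]) (use l in simp)
  have "(\<lambda>n. LINT x|lebesgue_on K'. g x * f n x) \<longlonglongrightarrow> (LINT x|lebesgue_on K'. g x * indicator K x)"
  proof (rule integral_dominated_convergence[where w = "\<lambda>x. \<bar>g x\<bar>"])
    show "AE x in lebesgue_on K'. norm (g x * f n x) \<le> \<bar>g x\<bar>" for n
      using f1 by (intro AE_I2) (simp add: abs_mult mult_left_le)
    show "AE x in lebesgue_on K'. (\<lambda>n. g x * f n x) \<longlonglongrightarrow> g x * indicator K x"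
      by (intro AE_I2 tendsto_intros l)
  qed (use gi im fm in auto)
  then have "(LINT x|lebesgue_on K'. g x * indicator K x) = 0" using zero by (simp add: LIMSEQ_const_iff)
  moreover have "K \<subseteq> K'" using r(1) by (auto simp: K'_def)
  ultimately have "(LINT x|lebesgue_on K. g x * indicator K x) = 0"
    using integral_lebesgue_on_subset[OF \<open>K \<subseteq> K'\<close> compact_sets_lebesgue[OF K(1)] Ks, of "\<lambda>x. g x * indicator K x"] by simp
  then show ?thesis
    using Bochner_Integration.integral_cong[of "lebesgue_on K" "lebesgue_on K" "\<lambda>x. g x * indicator K x" g] by simp
qed

text \<open>
  A compact subset of \<open>{g > 0}\<close> over which \<open>g\<close> integrates to 0 is a null set, and compact
  subsets exhaust \<open>{g > 0}\<close> up to arbitrarily small measure.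
\<close>

lemma nonpos_AE_of_integrals:
  fixes g :: "real^'n::finite \<Rightarrow> real"
  assumes Q: "compact Q" and g: "integrable (lebesgue_on Q) g"
    and 0: "\<And>K. compact K \<Longrightarrow> K \<subseteq> Q \<Longrightarrow> K \<noteq> {} \<Longrightarrow> integral\<^sup>L (lebesgue_on K) g = 0"
  shows "negligible {x \<in> Q. g x > 0}" (is "negligible ?E")
proof -
  have Qs: "Q \<in> sets lebesgue" using Q by (rule compact_sets_lebesgue)
  have Es: "?E \<in> sets lebesgue"
  proof -
    have "{x \<in> space (lebesgue_on Q). g x > 0} \<in> sets (lebesgue_on Q)" using g by measurable
    then show ?thesis using sets_restrict_space_subset[of Q lebesgue] Qs by (auto simp: sets_restrict_space_iff)
  qed
  have cn: "negligible K" if K: "closed K" "K \<subseteq> ?E" for K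
  proof (cases "K = {}")
    case False
    have KQ: "K \<subseteq> Q" using K(2) by auto
    have K': "compact K" using K(1) KQ Q bounded_subset compact_eq_bounded_closed by blast
    have Ks: "K \<in> sets lebesgue" using K' by (rule compact_sets_lebesgue)
    have gK: "integrable (lebesgue_on K) g"
      using g KQ Ks Qs absolutely_integrable_on_iff[OF Ks] absolutely_integrable_on_iff[OF Qs]
        set_integrable_subset[of lebesgue Q g K] by simp
    have pos: "AE x in lebesgue_on K. 0 \<le> g x" using K(2) by (intro AE_I2) auto
    have "AE x in lebesgue_on K. g x = 0"
      using integral_nonneg_eq_0_iff_AE[OF gK pos] 0[OF K' KQ False] by simp
    then have "AE x in lebesgue_on K. False"
      by (rule AE_mp) (use K(2) in \<open>auto intro!: AE_I2\<close>)
    then have "AE x in lebesgue. x \<in> K \<longrightarrow> False" using Ks by (simp add: AE_restrict_space_iff)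
    then obtain N where "{x. \<not> (x \<in> K \<longrightarrow> False)} \<subseteq> N" "N \<in> null_sets lebesgue"
      by (auto simp: eventually_ae_filter)
    then have "negligible N" "K \<subseteq> N" by (auto simp: negligible_iff_null_sets)
    then show ?thesis by (rule negligible_subset)
  next
    case True
    then show ?thesis by (simp only: negligible_empty)
  qed
  show ?thesis
  proof -
    have "emeasure lebesgue ?E \<le> 0"
    proof (rule ennreal_le_epsilon)
      fix e :: real assume e: "0 < e"
      obtain T where T: "closed T" "T \<subseteq> ?E" "?E - T \<in> lmeasurable" "emeasure lebesgue (?E - T) < ennreal e"
        by (rule sets_lebesgue_inner_closed[OF Es e])
      have "emeasure lebesgue ?E = emeasure lebesgue (T \<union> (?E - T))" using T(2) by (simp add: Un_absorb1)
      also have "\<dots> \<le> emeasure lebesgue T + emeasure lebesgue (?E - T)"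
      proof (rule emeasure_subadditive)
        show "T \<in> sets lebesgue" by (intro sets_completionI_sets) (simp add: borel_closed T(1))
        show "?E - T \<in> sets lebesgue" using T(3) by (rule fmeasurableD)
      qed
      also have "emeasure lebesgue T = 0" using cn[OF T(1,2)] by (simp add: negligible_iff_null_sets null_sets_def)
      finally show "emeasure lebesgue ?E \<le> 0 + ennreal e" using T(4) by simp
    qed
    then show ?thesis using Es by (auto simp: negligible_iff_null_sets null_sets_def)
  qed
qed

text \<open>
  On each box of a countable cover of \<open>S\<close>, both \<open>g\<close> and \<open>- g\<close> are nonpositive almost
  everywhere.
\<close>

theorem fundamental_lemma:
  fixes g :: "real^'n::finite \<Rightarrow> real"
  assumes S: "open S" and g: "locally_integrable S g"
    and 0: "\<And>\<psi>. test_function S \<psi> \<Longrightarrow> (LINT x|lebesgue_on S. g x * \<psi> x) = 0"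
  shows "AE x in lebesgue_on S. g x = 0"
proof -
  obtain \<D> where D: "countable \<D>" "\<D> \<subseteq> Pow S" "\<And>X. X \<in> \<D> \<Longrightarrow> \<exists>a b. X = cbox a b" "\<Union>\<D> = S"
    using open_countable_Union_open_cbox[OF S] by metis
  have "negligible {x \<in> Q. g x \<noteq> 0}" if "Q \<in> \<D>" for Q
  proof -
    have Q: "compact Q" "Q \<subseteq> S" using D(3)[OF that] D(4) that by auto
    note Qs = compact_sets_lebesgue[OF Q(1)]
    have gi: "integrable (lebesgue_on Q) g"
      using g Q by (auto simp: locally_integrable_def absolutely_integrable_on_iff[OF Qs])
    have z: "integral\<^sup>L (lebesgue_on K) g = 0" if "compact K" "K \<subseteq> Q" "K \<noteq> {}" for K
      using integral_compact_zero[OF S g 0] that Q(2) by blast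
    have "negligible {x \<in> Q. g x > 0}" by (rule nonpos_AE_of_integrals[OF Q(1) gi z])
    moreover have "negligible {x \<in> Q. - g x > 0}"
      by (rule nonpos_AE_of_integrals[OF Q(1)]) (use gi z in auto)
    ultimately have "negligible ({x \<in> Q. g x > 0} \<union> {x \<in> Q. - g x > 0})" by (rule negligible_Un)
    then show ?thesis by (rule negligible_subset) auto
  qed
  then have "negligible (\<Union>Q\<in>\<D>. {x \<in> Q. g x \<noteq> 0})"
    using D(1) by (intro negligible_countable_Union) auto
  then have "negligible {x \<in> S. g x \<noteq> 0}" by (rule negligible_subset) (use D(4) in auto)
  then have "AE x in lebesgue. x \<in> S \<longrightarrow> g x = 0"
    by (intro AE_I'[of "{x \<in> S. g x \<noteq> 0}"]) (auto simp: negligible_iff_null_sets)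
  then show ?thesis using open_sets_lebesgue[OF S] by (simp add: AE_restrict_space_iff)
qed

lemma integral_lebesgue_on_cong:
  "(\<And>x. x \<in> S \<Longrightarrow> f x = g x) \<Longrightarrow> integral\<^sup>L (lebesgue_on S) f = integral\<^sup>L (lebesgue_on S) g"
  by (rule Bochner_Integration.integral_cong) auto

lemma test_functionD:
  assumes "test_function S \<psi>"
  obtains K where "smooth_on UNIV \<psi>" "compact K" "K \<subseteq> S" "\<And>x. x \<notin> K \<Longrightarrow> \<psi> x = 0"
    "\<And>x i. x \<notin> K \<Longrightarrow> partial i \<psi> x = 0"
proof -
  obtain K where K: "smooth_on UNIV \<psi>" "compact K" "K \<subseteq> S" "\<And>x. x \<notin> K \<Longrightarrow> \<psi> x = 0"
    using assms by (auto simp: test_function_def)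
  have "partial i \<psi> x = 0" if "x \<notin> K" for x i
    using partial_cong_open[of "- K" x \<psi> "\<lambda>_. 0"] that K by (auto simp: compact_imp_closed open_Compl)
  with K that show ?thesis by blast
qed

lemma integrable_continuous_compact_support:
  fixes f :: "real^'n::finite \<Rightarrow> real"
  assumes S: "open S" and f: "continuous_on S f" and K: "compact K" "K \<subseteq> S" "\<And>x. x \<in> S \<Longrightarrow> x \<notin> K \<Longrightarrow> f x = 0"
  shows "integrable (lebesgue_on S) f"
proof (rule integrable_continuous_bounded_support[OF S f compact_imp_bounded[OF K(1)] K(3)])
  have "bounded (f ` K)"
    by (intro compact_imp_bounded compact_continuous_image continuous_on_subset[OF f K(2)] K(1))
  then show "bounded (f ` (S \<inter> K))" by (rule bounded_subset) auto
qed

lemma weak_partial_unique: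
  fixes f :: "real^'n::finite \<Rightarrow> real"
  assumes S: "open S" and g: "has_weak_partial S i f g" and h: "has_weak_partial S i f h"
  shows "AE x in lebesgue_on S. g x = h x"
proof -
  have lg: "locally_integrable S g" and lh: "locally_integrable S h" using g h by (auto simp: has_weak_partial_def)
  have "AE x in lebesgue_on S. g x - h x = 0"
  proof (rule fundamental_lemma[OF S])
    show "locally_integrable S (\<lambda>x. g x - h x)"
      using lg lh unfolding locally_integrable_def by (auto intro: set_integral_diff)
    fix \<psi> assume t: "test_function S \<psi>"
    then obtain K where K: "smooth_on UNIV \<psi>" "compact K" "K \<subseteq> S" "\<And>x. x \<notin> K \<Longrightarrow> \<psi> x = 0" by (rule test_functionD) (rule that)
    have i: "integrable (lebesgue_on S) (\<lambda>x. f x * \<psi> x)" if "locally_integrable S f" for f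
      by (rule locally_integrable_mult(3)[OF that smooth_onD(2)[OF K(1)] K(2,3) S K(4)])
    have "(LINT x|lebesgue_on S. g x * \<psi> x) = (LINT x|lebesgue_on S. h x * \<psi> x)"
      using g h t by (simp add: has_weak_partial_def)
    then show "(LINT x|lebesgue_on S. (g x - h x) * \<psi> x) = 0"
      using i[OF lg] i[OF lh] by (simp add: left_diff_distrib)
  qed
  then show ?thesis by (rule AE_mp) (auto intro!: AE_I2)
qed

lemma locally_integrable_AE_cong:
  fixes f :: "real^'n::finite \<Rightarrow> real"
  assumes S: "open S" and ae: "AE x in lebesgue_on S. f x = g x" and f: "locally_integrable S f"
  shows "locally_integrable S g"
  unfolding locally_integrable_def
proof (intro allI impI)
  fix K assume K: "compact K \<and> K \<subseteq> S"
  have "AE x in lebesgue. x \<in> S \<longrightarrow> f x = g x" using ae open_sets_lebesgue[OF S] by (simp add: AE_restrict_space_iff)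
  then obtain N where N: "{x. \<not> (x \<in> S \<longrightarrow> f x = g x)} \<subseteq> N" "N \<in> null_sets lebesgue"
    by (auto simp: eventually_ae_filter)
  have "f absolutely_integrable_on K" using f K by (simp add: locally_integrable_def)
  then show "g absolutely_integrable_on K"
    by (rule absolutely_integrable_spike[of _ _ N]) (use N K in \<open>auto simp: negligible_iff_null_sets\<close>)
qed

lemma has_weak_partial_AE_cong:
  fixes f :: "real^'n::finite \<Rightarrow> real"
  assumes S: "open S" and ae: "AE x in lebesgue_on S. f x = f' x" and g: "has_weak_partial S i f g"
  shows "has_weak_partial S i f' g"
  unfolding has_weak_partial_def
proof (intro conjI allI impI)
  show "locally_integrable S f'" using locally_integrable_AE_cong[OF S ae] g by (simp add: has_weak_partial_def)
  show "locally_integrable S g" using g by (simp add: has_weak_partial_def)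
  fix \<psi> assume t: "test_function S \<psi>"
  then obtain K where K: "smooth_on UNIV \<psi>" "compact K" "K \<subseteq> S" "\<And>x i. x \<notin> K \<Longrightarrow> partial i \<psi> x = 0"
    by (rule test_functionD) (rule that)
  have i: "integrable (lebesgue_on S) (\<lambda>x. f x * partial i \<psi> x)" if "locally_integrable S f" for f
    by (rule locally_integrable_mult(3)[OF that smooth_onD(2)[OF smooth_onD(3)[OF K(1)]] K(2,3) S K(4)])
  have "(LINT x|lebesgue_on S. f' x * partial i \<psi> x) = (LINT x|lebesgue_on S. f x * partial i \<psi> x)"
  proof (rule integral_cong_AE)
    show "(\<lambda>x. f' x * partial i \<psi> x) \<in> borel_measurable (lebesgue_on S)"
      using i[of f'] \<open>locally_integrable S f'\<close> by blast
    show "(\<lambda>x. f x * partial i \<psi> x) \<in> borel_measurable (lebesgue_on S)"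
      using i[of f] g by (auto simp: has_weak_partial_def)
    show "AE x in lebesgue_on S. f' x * partial i \<psi> x = f x * partial i \<psi> x"
      using ae by (rule AE_mp) (auto intro!: AE_I2)
  qed
  then show "(LINT x|lebesgue_on S. f' x * partial i \<psi> x) = - (LINT x|lebesgue_on S. g x * \<psi> x)"
    using g t by (simp add: has_weak_partial_def)
qed

lemma classical_weak_partial:
  fixes f :: "real^'n::finite \<Rightarrow> real"
  assumes S: "open S" and f: "Ck_on 1 S f"
  shows "has_weak_partial S i f (partial i f)"
proof -
  have d: "\<And>x. x \<in> S \<Longrightarrow> f differentiable (at x)" and c: "continuous_on S f" "continuous_on S (partial i f)"
    using f unfolding One_nat_def Ck_on_Suc Ck_on_0 by blast+
  show ?thesis
    unfolding has_weak_partial_def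
  proof (intro conjI allI impI locally_integrable_continuous S c)
    fix \<psi> assume "test_function S \<psi>"
    then obtain K where K: "smooth_on UNIV \<psi>" "compact K" "K \<subseteq> S" "\<And>x. x \<notin> K \<Longrightarrow> \<psi> x = 0"
       "\<And>x i. x \<notin> K \<Longrightarrow> partial i \<psi> x = 0" by (rule test_functionD) (rule that)
    have sc: "Ck_on 1 S \<psi>" by (rule Ck_on_subset[OF smooth_onD(4)[OF K(1)]]) simp
    have pc: "continuous_on S \<psi>" "continuous_on S (partial i \<psi>)"
      using sc unfolding One_nat_def Ck_on_Suc Ck_on_0 by blast+
    have "integral\<^sup>L (lebesgue_on S) (partial i (\<lambda>x. f x * \<psi> x)) = 0"
      by (rule integral_partial_compact_support[OF S Ck_on_mult[OF S f sc] K(2,3)]) (simp add: K(4))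
    also have "integral\<^sup>L (lebesgue_on S) (partial i (\<lambda>x. f x * \<psi> x)) =
        (LINT x|lebesgue_on S. partial i f x * \<psi> x + f x * partial i \<psi> x)"
      by (rule integral_lebesgue_on_cong) (use d smooth_onD(1)[OF K(1)] in \<open>simp add: partial_mult\<close>)
    finally have "(LINT x|lebesgue_on S. partial i f x * \<psi> x + f x * partial i \<psi> x) = 0" .
    moreover have "integrable (lebesgue_on S) (\<lambda>x. partial i f x * \<psi> x)"
      by (rule integrable_continuous_compact_support[OF S _ K(2,3)]) (auto intro!: continuous_intros c pc simp: K(4))
    moreover have "integrable (lebesgue_on S) (\<lambda>x. f x * partial i \<psi> x)"
      by (rule integrable_continuous_compact_support[OF S _ K(2,3)]) (auto intro!: continuous_intros c pc simp: K(5))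
    ultimately show "(LINT x|lebesgue_on S. f x * partial i \<psi> x) = - (LINT x|lebesgue_on S. partial i f x * \<psi> x)"
      by simp
  qed
qed

text \<open>
  The function \<open>weak_partial S i g\<close> is a choice among functions equal almost everywhere. It is
  applied to \<open>g\<close> rather than \<open>f\<close> because \<open>weak_laplacian\<close> differentiates such a choice
  once more.
\<close>

lemma weak_partial_classical:
  fixes f g :: "real^'n::finite \<Rightarrow> real"
  assumes S: "open S" and f: "Ck_on 1 S f" and fg: "AE x in lebesgue_on S. f x = g x"
  shows "AE x in lebesgue_on S. weak_partial S i g x = partial i f x"
proof -
  have w: "has_weak_partial S i g (partial i f)"
    by (rule has_weak_partial_AE_cong[OF S fg classical_weak_partial[OF S f]])
  then have "has_weak_partial S i g (weak_partial S i g)"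
    unfolding weak_partial_def by (rule someI[of "has_weak_partial S i g"])
  from weak_partial_unique[OF S this w] show ?thesis .
qed

lemma weak_laplacian_classical:
  fixes f :: "real^'n::finite \<Rightarrow> real"
  assumes S: "open S" and f: "Ck_on 2 S f"
  shows "AE x in lebesgue_on S. weak_laplacian S f x = laplacian f x"
proof -
  have f1: "Ck_on 1 S f" using f by (rule Ck_on_mono) simp
  have pf: "Ck_on 1 S (partial i f)" for i using f by (simp add: numeral_2_eq_2 Ck_on_Suc)
  have "AE x in lebesgue_on S. \<forall>i\<in>UNIV. weak_partial S i (weak_partial S i f) x = partial i (partial i f) x"
  proof (rule AE_finite_allI[OF finite])
    fix i :: 'n
    have "AE x in lebesgue_on S. weak_partial S i f x = partial i f x"
      by (rule weak_partial_classical[OF S f1]) simp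
    then have "AE x in lebesgue_on S. partial i f x = weak_partial S i f x" by (rule AE_mp) (auto intro!: AE_I2)
    from weak_partial_classical[OF S pf this]
    show "AE x in lebesgue_on S. weak_partial S i (weak_partial S i f) x = partial i (partial i f) x" .
  qed
  then show ?thesis by (rule AE_mp) (auto intro!: AE_I2 simp: weak_laplacian_def laplacian_def)
qed

lemma Ck_on_UNIV_imp_Ck_bdd:
  fixes f :: "real^'n::finite \<Rightarrow> real"
  assumes f: "Ck_on k UNIV f"
  shows "Ck_loc k S f"
  unfolding Ck_bdd_def
proof (intro conjI allI impI ballI)
  show "Ck_on k S f" by (rule Ck_on_subset[OF f]) simp
  fix "is" :: "'n list" and B assume l: "length is \<le> k" and B: "B \<in> bounded_subsets S"
  have c: "continuous_on UNIV (partials is f)"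
    using f l unfolding Ck_on_def by blast
  have "compact (closure B)" using B by (simp add: bounded_subsets_def)
  then have "bounded (partials is f ` closure B)"
    by (intro compact_imp_bounded compact_continuous_image continuous_on_subset[OF c]) auto
  then show "bounded (partials is f ` B)" by (rule bounded_subset) (use closure_subset in blast)
qed

lemma Ck_bdd_smooth: "smooth_on UNIV \<psi> \<Longrightarrow> Ck_loc k S \<psi>"
  by (rule Ck_on_UNIV_imp_Ck_bdd[OF smooth_onD(4)])

text \<open>
  Both the gradient of \<open>f\<close> and its restriction to the set where \<open>f\<close> is not 0 are weak gradients
  of \<open>f\<close>, the second by \<open>integration_by_parts_nonzero\<close>; so they agree almost everywhere.
\<close>

lemma partial_zero_on_level_set:
  fixes f :: "real^'n::finite \<Rightarrow> real"
  assumes S: "open S" and f: "Ck_loc 1 S f"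
  shows "AE x in lebesgue_on S. f x = 0 \<longrightarrow> partial i f x = 0"
proof -
  note fD = Ck_bddD[OF f[unfolded One_nat_def]]
  have Ss: "S \<in> sets lebesgue" using S by (rule open_sets_lebesgue)
  have fm: "f \<in> borel_measurable (lebesgue_on S)" "partial i f \<in> borel_measurable (lebesgue_on S)"
    using continuous_imp_measurable_on_sets_lebesgue[OF _ Ss] fD by blast+
  define g where "g x = (if f x = 0 then partial i f x else 0)" for x
  have "{x \<in> space (lebesgue_on S). f x = 0} \<in> sets (lebesgue_on S)" using fm by measurable
  then have gm: "g \<in> borel_measurable (lebesgue_on S)"
    unfolding g_def using fm by (intro measurable_If borel_measurable_const) auto
  have "AE x in lebesgue_on S. g x = 0"
  proof (rule fundamental_lemma[OF S])
    show "locally_integrable S g"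
    proof (rule locally_integrable_bounded[OF S gm])
      fix K assume K: "compact K" "K \<subseteq> S"
      have "bounded (partial i f ` (S \<inter> K))" by (rule fD(5)[OF compact_imp_bounded[OF K(1)]])
      then obtain c where c: "\<And>x. x \<in> S \<inter> K \<Longrightarrow> \<bar>partial i f x\<bar> \<le> c"
        by (auto simp: bounded_iff)
      then have "\<bar>g x\<bar> \<le> max 0 c" if "x \<in> K" for x using K(2) that unfolding g_def by force
      then show "bounded (g ` K)" unfolding bounded_iff by auto
    qed
    fix \<psi> assume "test_function S \<psi>"
    then obtain K where K: "smooth_on UNIV \<psi>" "compact K" "K \<subseteq> S" "\<And>x. x \<notin> K \<Longrightarrow> \<psi> x = 0"
       "\<And>x i. x \<notin> K \<Longrightarrow> partial i \<psi> x = 0" by (rule test_functionD) (rule that)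
    note pD = Ck_bddD[OF Ck_bdd_smooth[OF K(1), of S "Suc 0"]]
    have w: "(LINT x|lebesgue_on S. f x * partial i \<psi> x) = - (LINT x|lebesgue_on S. partial i f x * \<psi> x)"
      using classical_weak_partial[OF S Ck_bdd_imp_Ck_on[OF f], of i] \<open>test_function S \<psi>\<close>
      by (simp add: has_weak_partial_def)
    have i1: "integrable (lebesgue_on S) (\<lambda>x. partial i f x * \<psi> x)"
      by (rule integrable_continuous_compact_support[OF S _ K(2,3)]) (auto intro!: continuous_intros fD pD simp: K(4))
    have i2: "integrable (lebesgue_on S) (\<lambda>x. f x * partial i \<psi> x)"
      by (rule integrable_continuous_compact_support[OF S _ K(2,3)]) (auto intro!: continuous_intros fD pD simp: K(5))
    have i3: "integrable (lebesgue_on S) (\<lambda>x. g x * \<psi> x)"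
    proof (rule Bochner_Integration.integrable_bound[OF i1])
      show "(\<lambda>x. g x * \<psi> x) \<in> borel_measurable (lebesgue_on S)"
        using gm continuous_imp_measurable_on_sets_lebesgue[OF pD(2) Ss] by measurable
    qed (auto intro!: AE_I2 simp: g_def)
    have "(LINT x|lebesgue_on S. (if f x = 0 then 0 else 1) * partial i f x * \<psi> x + f x * partial i \<psi> x) = 0"
      by (rule integration_by_parts_nonzero[OF S f Ck_bdd_smooth[OF K(1)] K(2)]) (use K in auto)
    also have "(\<lambda>x. (if f x = 0 then 0 else 1) * partial i f x * \<psi> x + f x * partial i \<psi> x) =
       (\<lambda>x. partial i f x * \<psi> x + f x * partial i \<psi> x - g x * \<psi> x)"
      by (auto simp: g_def fun_eq_iff)
    finally show "(LINT x|lebesgue_on S. g x * \<psi> x) = 0" using i1 i2 i3 w by simp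
  qed
  then show ?thesis by (rule AE_mp) (auto intro!: AE_I2 simp: g_def)
qed

text \<open>
  The decay of \<open>f\<close> at the frontier takes the place of a boundary integral.
\<close>

theorem integration_by_parts:
  fixes f g :: "real^'n::finite \<Rightarrow> real"
  assumes S: "open S" and f: "Ck_loc 1 S f" "vanishes_on_frontier S f"
    and g: "Ck_loc 1 S g" and B: "compact B" "\<And>x. x \<in> S \<Longrightarrow> x \<notin> B \<Longrightarrow> g x = 0"
  shows "(LINT x|lebesgue_on S. partial i f x * g x + f x * partial i g x) = 0"
proof -
  note fD = Ck_bddD[OF f(1)[unfolded One_nat_def]] and gD = Ck_bddD[OF g[unfolded One_nat_def]]
  have Ss: "S \<in> sets lebesgue" using S by (rule open_sets_lebesgue)
  note m = continuous_imp_measurable_on_sets_lebesgue[OF _ Ss]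
  have mm: "f \<in> borel_measurable (lebesgue_on S)" "partial i f \<in> borel_measurable (lebesgue_on S)"
    "g \<in> borel_measurable (lebesgue_on S)" "partial i g \<in> borel_measurable (lebesgue_on S)"
    using m fD gD by blast+
  obtain r where r: "B \<subseteq> cball 0 r" using compact_imp_bounded[OF B(1)] bounded_subset_ballD[of B 0] ball_subset_cball by blast
  have "(LINT x|lebesgue_on S. partial i f x * g x + f x * partial i g x) =
    (LINT x|lebesgue_on S. (if f x = 0 then 0 else 1) * partial i f x * g x + f x * partial i g x)"
  proof (rule integral_cong_AE)
    show "(\<lambda>x. partial i f x * g x + f x * partial i g x) \<in> borel_measurable (lebesgue_on S)"
      using mm by measurable
    have "{x \<in> space (lebesgue_on S). f x = 0} \<in> sets (lebesgue_on S)" using mm by measurable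
    then show "(\<lambda>x. (if f x = 0 then 0 else 1) * partial i f x * g x + f x * partial i g x) \<in> borel_measurable (lebesgue_on S)"
      using mm by (intro borel_measurable_add borel_measurable_times measurable_If borel_measurable_const) auto
    show "AE x in lebesgue_on S. partial i f x * g x + f x * partial i g x =
        (if f x = 0 then 0 else 1) * partial i f x * g x + f x * partial i g x"
      using partial_zero_on_level_set[OF S f(1), of i] by eventually_elim auto
  qed
  also have "\<dots> = 0"
  proof (rule integration_by_parts_nonzero[OF S f(1) g B])
    fix e :: real assume e: "0 < e"
    show "\<exists>C. compact C \<and> C \<subseteq> S \<and> (\<forall>x\<in>S - C. \<bar>f x\<bar> \<le> e \<or> g x = 0)"
    proof (intro exI[of _ "{x \<in> S \<inter> cball 0 r. e \<le> \<bar>f x\<bar>}"] conjI ballI)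
      fix x assume x: "x \<in> S - {x \<in> S \<inter> cball 0 r. e \<le> \<bar>f x\<bar>}"
      show "\<bar>f x\<bar> \<le> e \<or> g x = 0"
      proof (cases "x \<in> B")
        case True
        then have "x \<in> cball 0 r" using r by blast
        then show ?thesis using x by auto
      qed (use x B(2) in auto)
    qed (use compact_superlevel[OF S fD(2) f(2) e] in auto)
  qed
  finally show ?thesis .
qed

section \<open>Admissible test functions\<close>

lemma partial_zero_outside_compact:
  fixes f :: "real^'n::finite \<Rightarrow> real"
  assumes S: "open S" and B: "compact B" "\<And>x. x \<in> S \<Longrightarrow> x \<notin> B \<Longrightarrow> f x = 0" and x: "x \<in> S" "x \<notin> B"
  shows "partial i f x = 0"
proof -
  have "open (S - B)" using S B(1) by (simp add: compact_imp_closed open_Diff)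
  from partial_cong_open[OF this, of x f "\<lambda>_. 0"] x B(2) show ?thesis by auto
qed

lemma L2_bounded_support:
  fixes f :: "real^'n::finite \<Rightarrow> real"
  assumes S: "open S" and f: "continuous_on S f" "bounded (f ` (S \<inter> B))"
    and B: "bounded B" "\<And>x. x \<in> S \<Longrightarrow> x \<notin> B \<Longrightarrow> f x = 0"
  shows "f \<in> L2 S"
proof -
  obtain c where c: "\<And>x. x \<in> S \<inter> B \<Longrightarrow> \<bar>f x\<bar> \<le> c" using f(2) by (auto simp: bounded_iff)
  have "\<bar>(f x)\<^sup>2\<bar> \<le> c\<^sup>2" if "x \<in> S \<inter> B" for x
    using power_mono[OF c[OF that], of 2] by simp
  then have b: "bounded ((\<lambda>x. (f x)\<^sup>2) ` (S \<inter> B))" unfolding bounded_iff by auto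
  have "integrable (lebesgue_on S) (\<lambda>x. (f x)\<^sup>2)"
    by (rule integrable_continuous_bounded_support[OF S _ B(1) _ b]) (auto intro!: continuous_intros f simp: B(2))
  then show ?thesis
    using continuous_imp_measurable_on_sets_lebesgue[OF f(1) open_sets_lebesgue[OF S]] by (simp add: L2_def)
qed

lemma Ck_bdd_imp_sobolev:
  fixes f :: "real^'n::finite \<Rightarrow> real"
  assumes S: "open S" and B: "compact B"
    and f: "Ck_loc k S f" "\<And>x. x \<in> S \<Longrightarrow> x \<notin> B \<Longrightarrow> f x = 0"
  shows "f \<in> sobolev S k"
  using f
proof (induction k arbitrary: f)
  have bs: "S \<inter> B \<in> bounded_subsets S"
    using compact_imp_bounded[OF B] by (auto simp: bounded_subsets_def intro: bounded_subset)
  case 0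
  then show ?case
    using L2_bounded_support[OF S, of f B] bs compact_imp_bounded[OF B] by (auto simp: Ck_bdd_0)
next
  have bs: "S \<inter> B \<in> bounded_subsets S"
    using compact_imp_bounded[OF B] by (auto simp: bounded_subsets_def intro: bounded_subset)
  case (Suc k)
  have "f \<in> L2 S"
    using L2_bounded_support[OF S, of f B] bs compact_imp_bounded[OF B] Suc.prems by (auto simp: Ck_bdd_Suc Ck_bdd_0)
  moreover have "has_weak_partial S i f (partial i f)" for i
    by (rule classical_weak_partial[OF S], rule Ck_bdd_imp_Ck_on, rule Ck_bdd_mono[OF Suc.prems(1)]) simp
  moreover have "partial i f \<in> sobolev S k" for i
  proof (rule Suc.IH)
    show "Ck_loc k S (partial i f)" using Suc.prems(1) by (simp add: Ck_bdd_Suc)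
    show "partial i f x = 0" if "x \<in> S" "x \<notin> B" for x
      by (rule partial_zero_outside_compact[OF S B Suc.prems(2) that])
  qed
  ultimately show ?case by auto
qed

lemma partial_diff:
  assumes "f differentiable (at x)" "g differentiable (at x)"
  shows "partial i (\<lambda>x. f x - g x) x = partial i f x - partial i g x"
  using assms[unfolded frechet_derivative_works]
  by (subst partial_eqI[OF has_derivative_diff]) (auto simp: partial_def)

lemma Ck_on_diff: "open S \<Longrightarrow> Ck_on k S f \<Longrightarrow> Ck_on k S g \<Longrightarrow> Ck_on k S (\<lambda>x. f x - g x)"
  using Ck_on_add[of S k f "\<lambda>x. (-1) * g x"] Ck_on_mult[OF _ Ck_on_const, of S k g "-1"] by simp

text \<open>
  Here \<open>q n\<close> will be the truncations of \<open>f\<close> (or of its gradient), which converge by dominated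
  convergence, and \<open>p n\<close> their mollifications.
\<close>

lemma L2_convergence_dominated:
  fixes f :: "'a \<Rightarrow> real"
  assumes f: "f \<in> borel_measurable M" "integrable M (\<lambda>x. (f x)\<^sup>2)"
    and q: "\<And>n. q n \<in> borel_measurable M" "AE x in M. (\<lambda>n. q n x) \<longlonglongrightarrow> f x" "\<And>n x. x \<in> space M \<Longrightarrow> \<bar>q n x\<bar> \<le> \<bar>f x\<bar>"
    and p: "\<And>n. p n \<in> borel_measurable M" "\<And>n. integrable M (\<lambda>x. (p n x - q n x)\<^sup>2)"
      "(\<lambda>n. LINT x|M. (p n x - q n x)\<^sup>2) \<longlonglongrightarrow> 0"
  shows "(\<lambda>n. LINT x|M. (p n x - f x)\<^sup>2) \<longlonglongrightarrow> 0"
proof -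
  have b: "(q n x - f x)\<^sup>2 \<le> 4 * (f x)\<^sup>2" if "x \<in> space M" for n x
  proof -
    have "\<bar>q n x - f x\<bar> \<le> 2 * \<bar>f x\<bar>" using q(3)[OF that, of n] by linarith
    from power_mono[OF this, of 2] show ?thesis by (simp add: power_mult_distrib)
  qed
  have iq: "integrable M (\<lambda>x. (q n x - f x)\<^sup>2)" for n
    by (rule Bochner_Integration.integrable_bound[of _ "\<lambda>x. 4 * (f x)\<^sup>2"])
      (use f q(1) b in \<open>auto intro!: AE_I2\<close>)
  have "(\<lambda>n. LINT x|M. (q n x - f x)\<^sup>2) \<longlonglongrightarrow> (LINT x|M. 0)"
  proof (rule integral_dominated_convergence[where w = "\<lambda>x. 4 * (f x)\<^sup>2"])
    show "AE x in M. (\<lambda>n. (q n x - f x)\<^sup>2) \<longlonglongrightarrow> 0"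
      using q(2) by eventually_elim (auto intro!: tendsto_eq_intros)
  qed (use f q(1) b in \<open>auto intro!: AE_I2\<close>)
  then have lim: "(\<lambda>n. 2 * (LINT x|M. (p n x - q n x)\<^sup>2) + 2 * (LINT x|M. (q n x - f x)\<^sup>2)) \<longlonglongrightarrow> 2 * 0 + 2 * 0"
    by (intro tendsto_intros p(3)) simp
  have sq: "(p n x - f x)\<^sup>2 \<le> 2 * (p n x - q n x)\<^sup>2 + 2 * (q n x - f x)\<^sup>2" for n x
    using sum_squares_ge_zero[of "(p n x - q n x) - (q n x - f x)" 0] by (simp add: power2_eq_square algebra_simps)
  have ip: "integrable M (\<lambda>x. (p n x - f x)\<^sup>2)" for n
    by (rule Bochner_Integration.integrable_bound[of _ "\<lambda>x. 2 * (p n x - q n x)\<^sup>2 + 2 * (q n x - f x)\<^sup>2"])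
      (use p(1,2) iq f sq in \<open>auto intro!: AE_I2\<close>)
  have le: "(LINT x|M. (p n x - f x)\<^sup>2) \<le> 2 * (LINT x|M. (p n x - q n x)\<^sup>2) + 2 * (LINT x|M. (q n x - f x)\<^sup>2)" for n
  proof -
    have "(LINT x|M. (p n x - f x)\<^sup>2) \<le> (LINT x|M. 2 * (p n x - q n x)\<^sup>2 + 2 * (q n x - f x)\<^sup>2)"
      by (rule integral_mono) (use ip p(2) iq sq in auto)
    then show ?thesis using p(2) iq by simp
  qed
  show ?thesis
    by (rule tendsto_sandwich[OF _ _ tendsto_const lim[simplified]]) (use le in auto)
qed

lemma integral_square_le_support:
  fixes f :: "real^'n::finite \<Rightarrow> real"
  assumes S: "open S" and f: "continuous_on S f" and K: "compact K" "K \<subseteq> S" "\<And>x. x \<in> S \<Longrightarrow> x \<notin> K \<Longrightarrow> f x = 0"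
    and d: "\<And>x. x \<in> S \<Longrightarrow> \<bar>f x\<bar> \<le> d" "0 \<le> d" "d \<le> 1" "d * measure lebesgue K \<le> e"
  shows "integrable (lebesgue_on S) (\<lambda>x. (f x)\<^sup>2)" "(LINT x|lebesgue_on S. (f x)\<^sup>2) \<le> e"
proof -
  show i: "integrable (lebesgue_on S) (\<lambda>x. (f x)\<^sup>2)"
    by (rule integrable_continuous_compact_support[OF S _ K(1,2)]) (auto intro!: continuous_intros f simp: K(3))
  have Ks: "K \<in> sets lebesgue" and Ss: "S \<in> sets lebesgue"
    using K(1) S by (auto intro: compact_sets_lebesgue open_sets_lebesgue)
  have Kf: "finite_measure (lebesgue_on K)"
    by (rule finite_measure_lebesgue_on[OF lmeasurable_compact[OF K(1)]])
  have "(LINT x|lebesgue_on S. (f x)\<^sup>2) = (LINT x|lebesgue_on K. (f x)\<^sup>2)"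
    by (rule integral_lebesgue_on_subset[OF K(2) Ks Ss]) (simp add: K(3))
  also have "\<dots> \<le> (LINT x|lebesgue_on K. d)"
  proof (rule integral_mono)
    have c: "continuous_on K (\<lambda>x. (f x)\<^sup>2)" by (intro continuous_intros continuous_on_subset[OF f K(2)])
    show "integrable (lebesgue_on K) (\<lambda>x. (f x)\<^sup>2)"
      using i absolutely_integrable_on_iff[OF Ss] absolutely_integrable_on_iff[OF Ks] set_integrable_subset[of lebesgue S _ K] Ks K(2) by blast
    show "integrable (lebesgue_on K) (\<lambda>x. d)" using Kf by (simp add: finite_measure.integrable_const)
    fix x assume "x \<in> space (lebesgue_on K)"
    then have "\<bar>f x\<bar> \<le> d" using d(1) K(2) by auto
    then have "\<bar>f x\<bar> * \<bar>f x\<bar> \<le> d * 1" using d(2,3) by (intro mult_mono) auto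
    then show "(f x)\<^sup>2 \<le> d" by (simp add: power2_eq_square)
  qed
  also have "\<dots> = d * measure lebesgue K" using Ks by (simp add: measure_restrict_space)
  finally show "(LINT x|lebesgue_on S. (f x)\<^sup>2) \<le> e" using d(4) by simp
qed

text \<open>
  Measurability of \<open>g\<close> follows from completeness of Lebesgue measure; the lemma is applied to
  functions \<open>g\<close> built from \<open>weak_partial\<close>, about which nothing else is known.
\<close>

lemma integral_lebesgue_on_spike:
  fixes f g :: "real^'n::finite \<Rightarrow> real"
  assumes S: "S \<in> sets lebesgue" and f: "integrable (lebesgue_on S) f" and ae: "AE x in lebesgue_on S. f x = g x"
  shows "integral\<^sup>L (lebesgue_on S) g = integral\<^sup>L (lebesgue_on S) f"
proof -
  have "AE x in lebesgue. x \<in> S \<longrightarrow> f x = g x" using ae S by (simp add: AE_restrict_space_iff)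
  then obtain N where N: "{x. \<not> (x \<in> S \<longrightarrow> f x = g x)} \<subseteq> N" "N \<in> null_sets lebesgue"
    by (auto simp: eventually_ae_filter)
  have n: "negligible N" using N(2) by (simp add: negligible_iff_null_sets)
  have eq: "g x = f x" if "x \<in> S - N" for x using that N(1) by auto
  have "f absolutely_integrable_on S" using f by (simp add: absolutely_integrable_on_iff[OF S])
  then have "g absolutely_integrable_on S" by (rule absolutely_integrable_spike[OF _ n eq])
  then have "integrable (lebesgue_on S) g" by (simp add: absolutely_integrable_on_iff[OF S])
  then have "integral\<^sup>L (lebesgue_on S) g = integral S g" by (rule lebesgue_integral_eq_integral[OF _ S])
  also have "\<dots> = integral S f" by (rule integral_spike[OF n]) (simp add: eq)
  also have "\<dots> = integral\<^sup>L (lebesgue_on S) f" by (rule lebesgue_integral_eq_integral[OF f S, symmetric])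
  finally show ?thesis .
qed

text \<open>
  The truncations \<open>h n\<close> have compact support in \<open>S\<close> and converge to \<open>f\<close> in
  \<open>H\<^sup>1\<close>; the gradients converge because that of \<open>f\<close> vanishes almost everywhere where
  \<open>f\<close> does. Mollifying the truncations gives the test functions.
\<close>

lemma Ck_bdd_imp_H1_0:
  fixes f :: "real^'n::finite \<Rightarrow> real"
  assumes S: "open S" and f: "Ck_loc 1 S f" "vanishes_on_frontier S f"
    and B: "compact B" "\<And>x. x \<in> S \<Longrightarrow> x \<notin> B \<Longrightarrow> f x = 0"
  shows "f \<in> H1_0 S"
proof -
  note fD = Ck_bddD[OF f(1)[unfolded One_nat_def]]
  have Ss: "S \<in> sets lebesgue" using S by (rule open_sets_lebesgue)
  obtain r where r: "B \<subseteq> cball 0 r" using compact_imp_bounded[OF B(1)] bounded_subset_ballD[of B 0] ball_subset_cball by blast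
  define e where "e n = inverse (real (Suc n))" for n
  have e: "0 < e n" for n by (simp add: e_def)
  define C where "C n = {x \<in> S \<inter> cball 0 r. e n \<le> \<bar>f x\<bar>}" for n
  have C: "compact (C n)" "C n \<subseteq> S" for n
    unfolding C_def using compact_superlevel[OF S fD(2) f(2) e] by auto
  define h where "h n x = trunc (e n) (f x)" for n x
  have h0: "h n x = 0" if "x \<in> S" "x \<notin> C n" for n x
  proof (cases "x \<in> B")
    case True
    then have "x \<in> cball 0 r" using r by blast
    then show ?thesis using that trunc_zero[OF e, of "f x" n] by (auto simp: C_def h_def)
  qed (use that B(2) trunc_zero[OF e, of 0 n] e[of n] in \<open>auto simp: h_def\<close>)
  have t1: "(trunc (e n) has_real_derivative trunc' (e n) t) (at t)" for n t using trunc_deriv[OF e] .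
  have h1: "Ck_on 1 S (h n)" for n
  proof -
    have "Ck_on 1 S (\<lambda>x. (case 0 of 0 \<Rightarrow> trunc (e n) | Suc _ \<Rightarrow> trunc' (e n)) (f x))"
      by (rule Ck_on_compose[OF S Ck_bdd_imp_Ck_on[OF f(1)], of "\<lambda>j. (case j of 0 \<Rightarrow> trunc (e n) | Suc _ \<Rightarrow> trunc' (e n))"])
        (auto intro: t1 continuous_trunc'[OF e])
    then show ?thesis by (simp add: h_def[abs_def])
  qed
  have hp: "partial i (h n) x = trunc' (e n) (f x) * partial i f x" if "x \<in> S" for n i x
    unfolding h_def by (rule partial_compose[OF fD(1)[OF that] t1])
  define k where "k n = (\<lambda>x. if x \<in> S then h n x else 0)" for n
  have h0': "\<forall>x\<in>S - C n. h n x = 0" for n using h0 by blast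
  note k = zero_extension[OF S h1 C h0', folded k_def]
  have k0: "k n x = 0" if "x \<notin> C n" for n x using that h0 by (auto simp: k_def)
  have kc: "continuous_on UNIV (k n)" for n
    using k(1) by (auto intro!: continuous_at_imp_continuous_on differentiable_imp_continuous_within)
  have "\<exists>\<psi> K d. test_function S \<psi> \<and> compact K \<and> K \<subseteq> S \<and> (\<forall>x. x \<notin> K \<longrightarrow> \<psi> x = 0 \<and> k n x = 0) \<and>
      0 \<le> d \<and> d \<le> 1 \<and> d * measure lebesgue K \<le> e n \<and>
      (\<forall>x. \<bar>\<psi> x - k n x\<bar> \<le> d) \<and> (\<forall>i x. \<bar>partial i \<psi> x - partial i (k n) x\<bar> \<le> d)" for n
  proof -
    obtain K where K: "compact K" "K \<subseteq> S" "C n \<subseteq> K" and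
      ap: "\<And>e. 0 < e \<Longrightarrow> \<exists>\<psi>. test_function S \<psi> \<and> (\<forall>x. x \<notin> K \<longrightarrow> \<psi> x = 0) \<and> (\<forall>x. \<bar>\<psi> x - k n x\<bar> \<le> e) \<and>
      ((\<forall>x. k n differentiable (at x)) \<and> (\<forall>i. continuous_on UNIV (partial i (k n))) \<longrightarrow>
        (\<forall>i x. \<bar>partial i \<psi> x - partial i (k n) x\<bar> \<le> e))"
      by (rule test_function_approximation[OF S C kc]) (erule k0, rule that)
    \<comment> \<open>the error is small relative to the measure of the support, which depends on \<open>n\<close>\<close>
    define d where "d = e n / (1 + measure lebesgue K)"
    have m: "0 \<le> measure lebesgue K" by simp
    have en: "e n \<le> 1" by (simp add: e_def field_simps)
    have le: "e n \<le> 1 + measure lebesgue K" using en m by linarith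
    have d: "0 < d" "d \<le> 1" "d * measure lebesgue K \<le> e n"
      using e[of n] m le by (auto simp: d_def divide_simps add_pos_nonneg algebra_simps)
    obtain \<psi> where p: "test_function S \<psi>" "\<forall>x. x \<notin> K \<longrightarrow> \<psi> x = 0" "\<forall>x. \<bar>\<psi> x - k n x\<bar> \<le> d"
      "\<forall>i x. \<bar>partial i \<psi> x - partial i (k n) x\<bar> \<le> d"
      using ap[OF d(1)] k(1,3) by blast
    have "k n x = 0" if "x \<notin> K" for x using k0 K(3) that by blast
    then show ?thesis
      by (intro exI[of _ \<psi>] exI[of _ K] exI[of _ d]) (use p K d in auto)
  qed
  then obtain \<psi> K d where p: "\<And>n. test_function S (\<psi> n)" "\<And>n. compact (K n)" "\<And>n. K n \<subseteq> S"
    "\<And>n x. x \<notin> K n \<Longrightarrow> \<psi> n x = 0" "\<And>n x. x \<notin> K n \<Longrightarrow> k n x = 0"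
    "\<And>n. 0 \<le> d n" "\<And>n. d n \<le> 1" "\<And>n. d n * measure lebesgue (K n) \<le> e n"
    "\<And>n x. \<bar>\<psi> n x - k n x\<bar> \<le> d n" "\<And>n i x. \<bar>partial i (\<psi> n) x - partial i (k n) x\<bar> \<le> d n"
    by metis
  have el: "e \<longlonglongrightarrow> 0" unfolding e_def by (rule LIMSEQ_inverse_real_of_nat)
  have ps: "smooth_on UNIV (\<psi> n)" for n using p(1) by (simp add: test_function_def)
  have pp0: "partial i (\<psi> n) x = 0" "partial i (k n) x = 0" if "x \<notin> K n" for i n x
    using partial_zero_outside_compact[OF open_UNIV p(2), of n "\<psi> n" x i]
      partial_zero_outside_compact[OF open_UNIV p(2), of n "k n" x i] p(4,5) that by auto
  note meas = continuous_imp_measurable_on_sets_lebesgue[OF _ Ss]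
  have pcon: "continuous_on S (\<psi> n)" "continuous_on S (partial i (\<psi> n))" for n i
    using continuous_on_subset[OF smooth_onD(2)[OF ps]] continuous_on_subset[OF smooth_onD(2)[OF smooth_onD(3)[OF ps]]] by auto
  have kcon: "continuous_on S (k n)" "continuous_on S (partial i (k n))" for n i
    using continuous_on_subset[OF kc] continuous_on_subset[OF k(3)] by auto
  have fsob: "f \<in> sobolev S 1" by (rule Ck_bdd_imp_sobolev[OF S B(1) f(1) B(2)])
  have f2: "integrable (lebesgue_on S) (\<lambda>x. (f x)\<^sup>2)"
  proof -
    have "f \<in> L2 S"
      by (rule L2_bounded_support[OF S fD(2) fD(4)[OF compact_imp_bounded[OF B(1)]] compact_imp_bounded[OF B(1)] B(2)])
    then show ?thesis by (simp add: L2_def)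
  qed
  have pf2: "integrable (lebesgue_on S) (\<lambda>x. (partial i f x)\<^sup>2)" for i
  proof -
    have "partial i f \<in> L2 S"
      by (rule L2_bounded_support[OF S fD(3) fD(5)[OF compact_imp_bounded[OF B(1)]] compact_imp_bounded[OF B(1)]])
        (rule partial_zero_outside_compact[OF S B])
    then show ?thesis by (simp add: L2_def)
  qed
  have c0: "(\<lambda>n. LINT x|lebesgue_on S. (\<psi> n x - f x)\<^sup>2) \<longlonglongrightarrow> 0"
  proof (rule L2_convergence_dominated[OF meas[OF fD(2)] f2, where q = k])
    show "AE x in lebesgue_on S. (\<lambda>n. k n x) \<longlonglongrightarrow> f x"
      by (intro AE_I2) (simp add: k_def h_def e_def trunc_tendsto del: of_nat_Suc)
    show "\<bar>k n x\<bar> \<le> \<bar>f x\<bar>" if "x \<in> space (lebesgue_on S)" for n x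
      using that trunc_abs_le[OF e] by (simp add: k_def h_def)
    have i: "integrable (lebesgue_on S) (\<lambda>x. (\<psi> n x - k n x)\<^sup>2)" "(LINT x|lebesgue_on S. (\<psi> n x - k n x)\<^sup>2) \<le> e n" for n
      by (rule integral_square_le_support[OF S _ p(2,3) _ p(9) p(6) p(7) p(8)];
          use pcon kcon p(4,5) in \<open>auto intro!: continuous_intros\<close>)+
    show "integrable (lebesgue_on S) (\<lambda>x. (\<psi> n x - k n x)\<^sup>2)" for n by (rule i)
    show "(\<lambda>n. LINT x|lebesgue_on S. (\<psi> n x - k n x)\<^sup>2) \<longlonglongrightarrow> 0"
      by (rule tendsto_sandwich[OF _ _ tendsto_const el]) (use i in auto)
  qed (intro meas pcon kcon)+
  have c1: "(\<lambda>n. LINT x|lebesgue_on S. (partial i (\<psi> n) x - partial i f x)\<^sup>2) \<longlonglongrightarrow> 0" for i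
  proof (rule L2_convergence_dominated[OF meas[OF fD(3)] pf2, where q = "\<lambda>n. partial i (k n)"])
    show "AE x in lebesgue_on S. (\<lambda>n. partial i (k n) x) \<longlonglongrightarrow> partial i f x"
    proof -
      have "AE x in lebesgue_on S. x \<in> S" by (intro AE_I2) simp
      with partial_zero_on_level_set[OF S f(1), of i] show ?thesis
      proof eventually_elim
        case (elim x)
        have "(\<lambda>n. trunc' (e n) (f x) * partial i f x) \<longlonglongrightarrow> (if f x = 0 then 0 else 1) * partial i f x"
          unfolding e_def by (intro tendsto_intros trunc'_tendsto)
        then show ?case using elim by (simp add: k(2) hp split: if_splits)
      qed
    qed
    show "\<bar>partial i (k n) x\<bar> \<le> \<bar>partial i f x\<bar>" if "x \<in> space (lebesgue_on S)" for n x
      using that trunc'_bounds[OF e, of n "f x"] by (simp add: k(2) hp abs_mult mult_left_le_one_le)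
    have i: "integrable (lebesgue_on S) (\<lambda>x. (partial i (\<psi> n) x - partial i (k n) x)\<^sup>2)"
      "(LINT x|lebesgue_on S. (partial i (\<psi> n) x - partial i (k n) x)\<^sup>2) \<le> e n" for n
      by (rule integral_square_le_support[OF S _ p(2,3) _ p(10) p(6) p(7) p(8)];
          use pcon kcon pp0 in \<open>auto intro!: continuous_intros\<close>)+
    show "integrable (lebesgue_on S) (\<lambda>x. (partial i (\<psi> n) x - partial i (k n) x)\<^sup>2)" for n by (rule i)
    show "(\<lambda>n. LINT x|lebesgue_on S. (partial i (\<psi> n) x - partial i (k n) x)\<^sup>2) \<longlonglongrightarrow> 0"
      by (rule tendsto_sandwich[OF _ _ tendsto_const el]) (use i in auto)
  qed (intro meas pcon kcon)+
  have wp: "(LINT x|lebesgue_on S. (weak_partial S i (\<lambda>x. \<psi> n x - f x) x)\<^sup>2) =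
      (LINT x|lebesgue_on S. (partial i (\<psi> n) x - partial i f x)\<^sup>2)" for i n
  proof -
    have C1: "Ck_on 1 S (\<lambda>x. \<psi> n x - f x)"
      by (intro Ck_on_diff S Ck_on_subset[OF smooth_onD(4)[OF ps]] Ck_bdd_imp_Ck_on[OF f(1)]) simp
    have "AE x in lebesgue_on S. weak_partial S i (\<lambda>x. \<psi> n x - f x) x = partial i (\<lambda>x. \<psi> n x - f x) x"
      by (rule weak_partial_classical[OF S C1]) simp
    moreover have "AE x in lebesgue_on S. x \<in> S" by (intro AE_I2) simp
    ultimately have ae: "AE x in lebesgue_on S. partial i (\<psi> n) x - partial i f x = weak_partial S i (\<lambda>x. \<psi> n x - f x) x"
      by eventually_elim (use smooth_onD(1)[OF ps] fD(1) in \<open>simp add: partial_diff\<close>)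
    have "integrable (lebesgue_on S) (\<lambda>x. (partial i (\<psi> n) x - partial i f x)\<^sup>2)" (is "integrable _ ?g")
    proof (rule integrable_continuous_bounded_support[OF S])
      show "continuous_on S ?g" using pcon fD(3) by (intro continuous_intros) auto
      have K: "bounded (K n \<union> B)" using p(2) B(1) compact_imp_bounded by blast
      then show "bounded (K n \<union> B)" .
      show "?g x = 0" if "x \<in> S" "x \<notin> K n \<union> B" for x
      proof -
        have "partial i f x = 0" by (rule partial_zero_outside_compact[OF S B]) (use that in auto)
        then show ?thesis using that pp0(1)[of x n i] by auto
      qed
      have "Ck_loc 0 S (\<lambda>x. partial i (\<psi> n) x + (-1) * partial i f x)"
      proof (intro Ck_bdd_add Ck_bdd_cmult S)
        show "Ck_loc 0 S (partial i (\<psi> n))" by (rule Ck_bdd_smooth[OF smooth_onD(3)[OF ps]])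
        show "Ck_loc 0 S (partial i f)" using f(1) by (simp add: Ck_bdd_Suc)
      qed (auto simp: bounded_subsets_def)
      moreover have "S \<inter> (K n \<union> B) \<in> bounded_subsets S"
        using bounded_Int[OF disjI2, OF K] by (simp only: bounded_subsets_def mem_Collect_eq Int_lower1 simp_thms)
      ultimately have "bounded ((\<lambda>x. partial i (\<psi> n) x - partial i f x) ` (S \<inter> (K n \<union> B)))"
        by (simp add: Ck_bdd_0)
      then obtain c where c: "\<And>x. x \<in> S \<inter> (K n \<union> B) \<Longrightarrow> \<bar>partial i (\<psi> n) x - partial i f x\<bar> \<le> c"
        by (auto simp: bounded_iff)
      have "\<bar>?g x\<bar> \<le> c\<^sup>2" if "x \<in> S \<inter> (K n \<union> B)" for x using power_mono[OF c[OF that], of 2] by simp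
      then show "bounded (?g ` (S \<inter> (K n \<union> B)))" unfolding bounded_iff by auto
    qed
    moreover have "AE x in lebesgue_on S. ?g x = (weak_partial S i (\<lambda>x. \<psi> n x - f x) x)\<^sup>2"
      using ae by eventually_elim simp
    ultimately show ?thesis by (rule integral_lebesgue_on_spike[OF Ss])
  qed
  have "(\<lambda>n. sqrt ((LINT x|lebesgue_on S. (\<psi> n x - f x)\<^sup>2) +
           (\<Sum>i\<in>UNIV. LINT x|lebesgue_on S. (partial i (\<psi> n) x - partial i f x)\<^sup>2))) \<longlonglongrightarrow> sqrt (0 + (\<Sum>i\<in>(UNIV :: 'n set). 0))"
    by (intro tendsto_intros c0 c1)
  then have "(\<lambda>n. H1_norm S (\<lambda>x. \<psi> n x - f x)) \<longlonglongrightarrow> 0" by (simp add: H1_norm_def wp)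
  then show ?thesis using fsob p(1) unfolding H1_0_def by blast
qed

lemma Ck_bdd_boundedD:
  assumes "Ck_loc 0 S f" "bounded B"
  shows "continuous_on S f" "bounded (f ` (S \<inter> B))"
proof -
  have "S \<inter> B \<in> bounded_subsets S"
    using bounded_Int[OF disjI2, OF assms(2)] by (simp only: bounded_subsets_def mem_Collect_eq Int_lower1 simp_thms)
  then show "bounded (f ` (S \<inter> B))" using assms(1) by (simp add: Ck_bdd_0)
qed (use assms in \<open>simp add: Ck_bdd_0\<close>)

lemma integrable_Ck_bdd:
  fixes f :: "real^'n::finite \<Rightarrow> real"
  assumes S: "open S" and f: "Ck_loc 0 S f"
    and B: "bounded B" "\<And>x. x \<in> S \<Longrightarrow> x \<notin> B \<Longrightarrow> f x = 0"
  shows "integrable (lebesgue_on S) f"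
  by (rule integrable_continuous_bounded_support[OF S Ck_bdd_boundedD(1)[OF f B(1)] B Ck_bdd_boundedD(2)[OF f B(1)]])

lemma Ck_bdd_0_compose:
  fixes f :: "real^'n::finite \<Rightarrow> real"
  assumes f: "Ck_loc 0 S f" and G: "continuous_on UNIV G"
  shows "Ck_loc 0 S (\<lambda>x. G (f x))"
  unfolding Ck_bdd_0
proof (intro conjI ballI)
  show "continuous_on S (\<lambda>x. G (f x))"
    using f by (auto simp: Ck_bdd_0 intro: continuous_on_compose2[OF G])
  fix B assume "B \<in> bounded_subsets S"
  then have "compact (closure (f ` B))" using f by (simp add: Ck_bdd_0)
  then have "bounded (G ` closure (f ` B))"
    by (intro compact_imp_bounded compact_continuous_image continuous_on_subset[OF G]) auto
  moreover have "(\<lambda>x. G (f x)) ` B \<subseteq> G ` closure (f ` B)" using closure_subset[of "f ` B"] by auto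
  ultimately show "bounded ((\<lambda>x. G (f x)) ` B)" by (rule bounded_subset)
qed

text \<open>
  For these \<open>\<phi>\<close> both integrals in \<open>Lambda0\<close> are finite, and the weak Laplacian is the
  classical one.
\<close>

lemma stable_imp_inequality:
  fixes \<phi> :: "real^'n::finite \<Rightarrow> real"
  assumes S: "open S" and p: "p > 1" and f: "Ck_loc 2 S \<phi>" "vanishes_on_frontier S \<phi>"
    and B: "compact B" "\<And>x. x \<in> S \<Longrightarrow> x \<notin> B \<Longrightarrow> \<phi> x = 0"
    and u: "Ck_loc 0 S u" "\<And>x. x \<in> S \<Longrightarrow> 0 < u x"
    and st: "\<forall>\<phi> \<in> sobolev S 2 \<inter> H1_0 S. Lambda0 S p u \<phi> \<ge> 0"
  shows "p * (LINT x|lebesgue_on S. u x powr (p - 1) * (\<phi> x)\<^sup>2) \<le> (LINT x|lebesgue_on S. (laplacian \<phi> x)\<^sup>2)"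
proof -
  note bB = compact_imp_bounded[OF B(1)]
  have bsub: "\<And>B. B \<in> bounded_subsets S \<Longrightarrow> B \<subseteq> S" by (simp add: bounded_subsets_def)
  have f1: "Ck_loc 1 S \<phi>" and f0: "Ck_loc 0 S \<phi>"
    using Ck_bdd_mono[OF f(1)] by auto
  have "\<phi> \<in> sobolev S 2 \<inter> H1_0 S"
    using Ck_bdd_imp_sobolev[OF S B(1) f(1) B(2)] Ck_bdd_imp_H1_0[OF S f1 f(2) B] by blast
  then have L: "Lambda0 S p u \<phi> \<ge> 0" using st by blast
  have lap: "Ck_loc 0 S (laplacian \<phi>)"
    using f(1) unfolding laplacian_def numeral_2_eq_2 Ck_bdd_Suc
    by (intro Ck_bdd_sum[OF S bsub]) auto
  have lap0: "laplacian \<phi> x = 0" if "x \<in> S" "x \<notin> B" for x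
  proof -
    have z: "partial i \<phi> x = 0" if "x \<in> S" "x \<notin> B" for x i by (rule partial_zero_outside_compact[OF S B that])
    have "partial i (partial i \<phi>) x = 0" for i by (rule partial_zero_outside_compact[OF S B(1) z that])
    then show ?thesis by (simp add: laplacian_def)
  qed
  have a: "integrable (lebesgue_on S) (\<lambda>x. (laplacian \<phi> x)\<^sup>2)"
    by (rule integrable_Ck_bdd[OF S _ bB])
      (use lap0 in \<open>auto intro!: Ck_bdd_mult[OF S bsub] lap simp: power2_eq_square\<close>)
  have cp: "continuous_on UNIV (\<lambda>t::real. \<bar>t\<bar> powr (p - 1))"
    using p by (intro continuous_on_powr' continuous_intros) auto
  have "Ck_loc 0 S (\<lambda>x. \<bar>u x\<bar> powr (p - 1) * (\<phi> x * \<phi> x))"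
    by (intro Ck_bdd_mult[OF S bsub] f0 Ck_bdd_0_compose[OF u(1) cp])
  then have "integrable (lebesgue_on S) (\<lambda>x. \<bar>u x\<bar> powr (p - 1) * (\<phi> x * \<phi> x))"
    by (rule integrable_Ck_bdd[OF S _ bB]) (simp add: B(2))
  also have "?this \<longleftrightarrow> integrable (lebesgue_on S) (\<lambda>x. u x powr (p - 1) * (\<phi> x)\<^sup>2)"
    by (rule Bochner_Integration.integrable_cong) (use u(2) in \<open>force simp: power2_eq_square\<close>)+
  finally have b: "integrable (lebesgue_on S) (\<lambda>x. u x powr (p - 1) * (\<phi> x)\<^sup>2)" .
  have "(\<integral>\<^sup>+x. ennreal (\<bar>weak_laplacian S \<phi> x\<bar>\<^sup>2) \<partial>lebesgue_on S) = (\<integral>\<^sup>+x. ennreal ((laplacian \<phi> x)\<^sup>2) \<partial>lebesgue_on S)"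
    by (rule nn_integral_cong_AE) (use weak_laplacian_classical[OF S Ck_bdd_imp_Ck_on[OF f(1)]] in \<open>eventually_elim, simp\<close>)
  also have "\<dots> = ennreal (LINT x|lebesgue_on S. (laplacian \<phi> x)\<^sup>2)"
    by (rule nn_integral_eq_integral[OF a]) simp
  finally have 1: "(\<integral>\<^sup>+x. ennreal (\<bar>weak_laplacian S \<phi> x\<bar>\<^sup>2) \<partial>lebesgue_on S) = ennreal (LINT x|lebesgue_on S. (laplacian \<phi> x)\<^sup>2)" .
  have 2: "(\<integral>\<^sup>+x. ennreal (u x powr (p - 1) * (\<phi> x)\<^sup>2) \<partial>lebesgue_on S) = ennreal (LINT x|lebesgue_on S. u x powr (p - 1) * (\<phi> x)\<^sup>2)"
    by (rule nn_integral_eq_integral[OF b]) simp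
  have nn: "0 \<le> (LINT x|lebesgue_on S. u x powr (p - 1) * (\<phi> x)\<^sup>2)" "0 \<le> (LINT x|lebesgue_on S. (laplacian \<phi> x)\<^sup>2)"
    by (auto intro!: Bochner_Integration.integral_nonneg)
  show ?thesis using L nn unfolding Lambda0_def 1 2 by (simp add: enn2ereal_ennreal)
qed

section \<open>Radial functions and cutoffs\<close>

lemma smooth_inner_self: "smooth_on UNIV (\<lambda>x::real^'n::finite. x \<bullet> x)"
  and smooth_coord: "smooth_on UNIV (\<lambda>x::real^'n::finite. x $ i)"
  by (intro smooth_term_smooth smooth_term_inner_self smooth_term.intros)+

lemma partial_inner_self: "partial i (\<lambda>x. x \<bullet> x) x = 2 * x $ i"
proof -
  have "((\<lambda>x. x \<bullet> x) has_derivative (\<lambda>h. x \<bullet> h + h \<bullet> x)) (at x)"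
    by (auto intro!: derivative_eq_intros)
  from partial_eqI[OF this] show ?thesis by (simp add: inner_axis inner_commute)
qed

context
  fixes g g' g'' :: "real \<Rightarrow> real"
  assumes g1: "\<And>t. 0 \<le> t \<Longrightarrow> (g has_real_derivative g' t) (at t)"
    and g2: "\<And>t. 0 \<le> t \<Longrightarrow> (g' has_real_derivative g'' t) (at t)"
    and g3: "continuous_on {0..} g''"
begin

lemma radial_Ck_on: "Ck_on 2 UNIV (\<lambda>x::real^'n::finite. g (x \<bullet> x))"
proof -
  have "Ck_on 2 UNIV (\<lambda>x::real^'n. ([g, g', g''] ! 0) (x \<bullet> x))"
  proof (rule Ck_on_compose[OF open_UNIV smooth_onD(4)[OF smooth_inner_self], of 2 "\<lambda>j. [g, g', g''] ! j"])
    show "(([g, g', g''] ! j) has_real_derivative ([g, g', g''] ! Suc j) (x \<bullet> x)) (at (x \<bullet> x))" if "j < 2" for j and x :: "real^'n"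
      using that g1[of "x \<bullet> x"] g2[of "x \<bullet> x"] by (cases j) (auto simp: less_Suc_eq numeral_2_eq_2)
    show "continuous_on ((\<lambda>x::real^'n. x \<bullet> x) ` UNIV) ([g, g', g''] ! 2)"
      by (simp add: numeral_2_eq_2, rule continuous_on_subset[OF g3]) auto
  qed
  then show ?thesis by simp
qed

lemma radial_partial: "partial i (\<lambda>x::real^'n::finite. g (x \<bullet> x)) x = 2 * x $ i * g' (x \<bullet> x)"
proof -
  have d: "(\<lambda>x::real^'n. x \<bullet> x) differentiable (at x)" by (rule smooth_onD(1)[OF smooth_inner_self]) simp
  note G = g1[OF inner_ge_zero, of x]
  show "partial i (\<lambda>x. g (x \<bullet> x)) x = 2 * x $ i * g' (x \<bullet> x)"
    by (subst partial_compose[OF d G]) (simp add: partial_inner_self mult.commute)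
qed

lemma radial_laplacian:
  "laplacian (\<lambda>x::real^'n::finite. g (x \<bullet> x)) x = 4 * (x \<bullet> x) * g'' (x \<bullet> x) + 2 * real CARD('n) * g' (x \<bullet> x)"
proof -
  have d: "(\<lambda>x::real^'n. x \<bullet> x) differentiable (at x)" by (rule smooth_onD(1)[OF smooth_inner_self]) simp
  note G = g2[OF inner_ge_zero, of x]
  have "partial i (partial i (\<lambda>x::real^'n. g (x \<bullet> x))) x = 4 * (x $ i * x $ i) * g'' (x \<bullet> x) + 2 * g' (x \<bullet> x)" for i
  proof -
    have c: "(\<lambda>x::real^'n. x $ i) differentiable (at x)" by (rule smooth_onD(1)[OF smooth_coord]) simp
    have "partial i (partial i (\<lambda>x::real^'n. g (x \<bullet> x))) x = partial i (\<lambda>x. (2 * x $ i) * g' (x \<bullet> x)) x"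
      by (simp add: radial_partial[abs_def])
    also have "\<dots> = partial i (\<lambda>x. 2 * x $ i) x * g' (x \<bullet> x) + 2 * x $ i * partial i (\<lambda>x. g' (x \<bullet> x)) x"
      by (rule partial_mult) (use c differentiable_compose_real[OF d G] in auto)
    finally show ?thesis
      using partial_cmult[OF c, of i 2] by (simp add: partial_compose[OF d G] partial_inner_self partial_coord algebra_simps)
  qed
  then show ?thesis
    by (simp add: laplacian_def sum.distrib inner_vec_def flip: sum_distrib_left sum_distrib_right)
qed

end

text \<open>
  A function of \<open>t = |x|\<^sup>2\<close>. The power serves two purposes: it makes the cutoff \<open>C\<^sup>2\<close>,
  and it lets a derivative of the cutoff be estimated by a lower power of the same cutoff.
\<close>

definition cutoff :: "real \<Rightarrow> nat \<Rightarrow> real \<Rightarrow> real" where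
  "cutoff R k t = (max 0 (1 - t / R\<^sup>2)) ^ k"

abbreviation cut :: "real \<Rightarrow> nat \<Rightarrow> real^'n::finite \<Rightarrow> real" where
  "cut R k x \<equiv> cutoff R k (x \<bullet> x)"

lemma max_power_deriv:
  "((\<lambda>t::real. max 0 t ^ (Suc (Suc k))) has_real_derivative real (Suc (Suc k)) * max 0 t ^ (Suc k)) (at t)"
proof (cases t "0::real" rule: linorder_cases)
  case less
  have "((\<lambda>t::real. 0) has_real_derivative real (Suc (Suc k)) * max 0 t ^ (Suc k)) (at t)" using less by (simp add: max_def)
  then show ?thesis
    by (rule has_field_derivative_transform_within_open[of _ _ _ "{..<0}"]) (use less in \<open>auto simp: max_def\<close>)
next
  case equal
  have "((\<lambda>h::real. max 0 h ^ (Suc (Suc k)) / h) \<longlongrightarrow> 0) (at 0)"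
  proof (rule Lim_transform_eventually)
    have "continuous (at 0) (\<lambda>h::real. max 0 h ^ (Suc k))" by (intro continuous_intros)
    then show "((\<lambda>h::real. max 0 h ^ (Suc k)) \<longlongrightarrow> 0) (at 0)" by (simp add: continuous_at)
    show "\<forall>\<^sub>F h::real in at 0. max 0 h ^ (Suc k) = max 0 h ^ (Suc (Suc k)) / h"
      by (auto simp: eventually_at_filter max_def)
  qed
  then show ?thesis using equal by (simp add: DERIV_def)
next
  case greater
  have "((\<lambda>t::real. t ^ (Suc (Suc k))) has_real_derivative real (Suc (Suc k)) * max 0 t ^ (Suc k)) (at t)"
    using DERIV_pow[of "Suc (Suc k)" t UNIV] greater by (simp add: max_def)
  then show ?thesis
    by (rule has_field_derivative_transform_within_open[of _ _ _ "{0<..}"]) (use greater in \<open>auto simp: max_def\<close>)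
qed

lemma cutoff_deriv:
  assumes "k \<ge> 2" "R > 0"
  shows "(cutoff R k has_real_derivative - (real k / R\<^sup>2) * cutoff R (k - 1) t) (at t)"
proof -
  obtain j where j: "k = Suc (Suc j)" using assms(1) by (metis Suc_le_D numeral_2_eq_2 Suc_le_mono)
  have "((\<lambda>t. 1 - t / R\<^sup>2) has_real_derivative 0 - 1 / R\<^sup>2) (at t)"
    by (intro DERIV_diff DERIV_const DERIV_cdivide DERIV_ident)
  from DERIV_chain2[OF max_power_deriv this, of j] show ?thesis
    by (simp add: cutoff_def[abs_def] j)
qed

lemma continuous_cutoff: "continuous_on A (cutoff R k)"
  unfolding cutoff_def[abs_def] divide_inverse by (intro continuous_intros)

section \<open>The energy estimate\<close>

text \<open>
  The letters stand for the integrals of the squares and products of \<open>a = |w| \<eta>\<close>,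
  \<open>b = u \<xi>\<^sup>m\<^sup>-\<^sup>2 / R\<^sup>2\<close> and \<open>d\<close>, a radial derivative of \<open>u\<close> times
  \<open>\<xi>\<^sup>m\<^sup>-\<^sup>1\<close>, where \<open>\<eta> = \<xi>\<^sup>m\<close> is the cutoff: \<open>A\<close> is the integral of
  \<open>u\<^sup>p\<^sup>+\<^sup>1 \<eta>\<^sup>2\<close>, \<open>\<alpha>\<close> and \<open>\<beta>\<close> those of \<open>a\<^sup>2\<close> and
  \<open>b\<^sup>2\<close>, and \<open>\<gamma>\<close> that of the squared gradient, which dominates \<open>d\<^sup>2\<close>. Young's
  inequality absorbs everything into \<open>\<beta>\<close>, with a constant depending on \<open>p\<close> and \<open>K\<close>
  only, hence not on the radius.
\<close>

lemma quadratic_absorption: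
  fixes p K :: real
  assumes p: "p > 1" and K: "K \<ge> 1"
  shows "\<exists>C\<ge>0. \<forall>A \<alpha> \<beta> \<gamma> ab ad bd. 0 \<le> A \<longrightarrow> 0 \<le> \<alpha> \<longrightarrow> 0 \<le> \<beta> \<longrightarrow> 0 \<le> \<gamma> \<longrightarrow>
     (\<forall>e>0. ab \<le> e * \<alpha> + \<beta> / (4 * e)) \<longrightarrow> (\<forall>e>0. bd \<le> e * \<beta> + \<gamma> / (4 * e)) \<longrightarrow>
     (\<forall>e>0. ad \<le> e * \<alpha> + \<gamma> / (4 * e)) \<longrightarrow>
     \<gamma> \<le> ab + K * bd \<longrightarrow> (p - 1) * A \<le> K * \<gamma> + K * \<beta> + K * bd + K * ab \<longrightarrow>
     \<alpha> \<le> A + K * ad + K * ab \<longrightarrow> A + \<alpha> \<le> C * \<beta>"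
proof -
  define q where "q = p - 1"
  have q: "q > 0" using p by (simp add: q_def)
  define L where "L = 3 * K\<^sup>2 + 5 * K / q"
  define T where "T = L\<^sup>2 + 4 * K^3 / q + K^4 + (K^4 - K^3) / 2"
  define C where "C = 2 * T + (5 * K * (2 * T + 1 / 4) + 4 * K^3) / q"
  have L: "L > 0" using K q by (auto simp: L_def intro!: add_pos_pos)
  have "K^3 \<le> K^4" using K by (intro power_increasing) auto
  then have T: "T \<ge> 0" using K q by (auto simp: T_def intro!: add_nonneg_nonneg)
  have C: "C \<ge> 0" unfolding C_def using T q K by (intro add_nonneg_nonneg divide_nonneg_nonneg mult_nonneg_nonneg) auto
  show ?thesis
  proof (intro exI[of _ C] conjI C allI impI)
    fix A \<alpha> \<beta> \<gamma> ab ad bd :: real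
    assume nn: "0 \<le> A" "0 \<le> \<alpha>" "0 \<le> \<beta>" "0 \<le> \<gamma>"
      and yab: "\<forall>e>0. ab \<le> e * \<alpha> + \<beta> / (4 * e)" and ybd: "\<forall>e>0. bd \<le> e * \<beta> + \<gamma> / (4 * e)"
      and yad: "\<forall>e>0. ad \<le> e * \<alpha> + \<gamma> / (4 * e)"
      and 1: "\<gamma> \<le> ab + K * bd" and 2: "(p - 1) * A \<le> K * \<gamma> + K * \<beta> + K * bd + K * ab"
      and 3: "\<alpha> \<le> A + K * ad + K * ab"
    have "bd \<le> (K / 2) * \<beta> + \<gamma> / (4 * (K / 2))" using K by (intro ybd[rule_format]) simp
    then have "K * bd \<le> K * ((K / 2) * \<beta> + \<gamma> / (4 * (K / 2)))" using K by (intro mult_left_mono) auto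
    also have "\<dots> = K\<^sup>2 / 2 * \<beta> + \<gamma> / 2" using K by (simp add: field_simps power2_eq_square)
    finally have bd: "K * bd \<le> K\<^sup>2 / 2 * \<beta> + \<gamma> / 2" .
    with 1 have g: "\<gamma> \<le> 2 * ab + K\<^sup>2 * \<beta>" by (simp add: field_simps)
    have "ad \<le> (1 / (4 * K)) * \<alpha> + \<gamma> / (4 * (1 / (4 * K)))" using K by (intro yad[rule_format]) simp
    then have "K * ad \<le> K * ((1 / (4 * K)) * \<alpha> + \<gamma> / (4 * (1 / (4 * K))))" using K by (intro mult_left_mono) auto
    also have "\<dots> = \<alpha> / 4 + K\<^sup>2 * \<gamma>" using K by (simp add: field_simps power2_eq_square)
    finally have ad: "K * ad \<le> \<alpha> / 4 + K\<^sup>2 * \<gamma>" .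
    have ab0: "0 \<le> 2 * ab + K\<^sup>2 * \<beta>" using g nn by linarith
    have Kb: "K * \<beta> \<le> K\<^sup>2 * \<beta>" using K nn by (intro mult_right_mono) (auto simp: power2_eq_square)
    have Kg: "\<gamma> \<le> K * \<gamma>" using K nn mult_right_mono[of 1 K \<gamma>] by simp
    have g2: "K * \<gamma> \<le> 2 * K * ab + K^3 * \<beta>"
      using mult_left_mono[OF g, of K] K by (simp add: algebra_simps power2_eq_square power3_eq_cube)
    have g3: "K\<^sup>2 * \<gamma> \<le> 2 * K\<^sup>2 * ab + K^4 * \<beta>"
      using mult_left_mono[OF g, of "K\<^sup>2"] by (simp add: algebra_simps power2_eq_square power4_eq_xxxx)
    have b23: "K\<^sup>2 * \<beta> \<le> K^3 * \<beta>"
      using K nn by (intro mult_right_mono power_increasing) auto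
    have "q * A \<le> 5 * (K * ab) + 4 * (K^3 * \<beta>)"
    proof -
      have "0 \<le> 2 * K * ab + K^3 * \<beta>" using g2 Kg nn by linarith
      moreover have "0 \<le> K^3 * \<beta>" using nn K by simp
      moreover have "K\<^sup>2 / 2 * \<beta> = K\<^sup>2 * \<beta> / 2" by simp
      ultimately show ?thesis using 2 bd Kb Kg g2 b23 nn unfolding q_def by linarith
    qed
    then have A: "A \<le> (5 * (K * ab) + 4 * (K^3 * \<beta>)) / q" using q by (simp add: pos_le_divide_eq mult.commute)
    have K2: "K * ab \<le> K\<^sup>2 * ab + (K^4 - K^3) / 2 * \<beta>"
    proof -
      have "(K\<^sup>2 - K) / 2 * (2 * ab + K\<^sup>2 * \<beta>) \<ge> 0" using ab0 K by (intro mult_nonneg_nonneg) (auto simp: power2_eq_square)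
      moreover have "(K\<^sup>2 - K) / 2 * (2 * ab + K\<^sup>2 * \<beta>) = K\<^sup>2 * ab - K * ab + (K^4 - K^3) / 2 * \<beta>"
        by (simp add: field_simps power2_eq_square power3_eq_cube power4_eq_xxxx)
      ultimately show ?thesis by linarith
    qed
    have yab': "L * ab \<le> \<alpha> / 4 + L\<^sup>2 * \<beta>"
    proof -
      have "ab \<le> (1 / (4 * L)) * \<alpha> + \<beta> / (4 * (1 / (4 * L)))" using L by (intro yab[rule_format]) simp
      then have "L * ab \<le> L * ((1 / (4 * L)) * \<alpha> + \<beta> / (4 * (1 / (4 * L))))" using L by (intro mult_left_mono) auto
      also have "\<dots> = \<alpha> / 4 + L\<^sup>2 * \<beta>" using L by (simp add: field_simps power2_eq_square)
      finally show ?thesis .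
    qed
    have "\<alpha> \<le> (5 * (K * ab) + 4 * (K^3 * \<beta>)) / q + (\<alpha> / 4 + (2 * K\<^sup>2 * ab + K^4 * \<beta>)) + (K\<^sup>2 * ab + (K^4 - K^3) / 2 * \<beta>)"
      using 3 A ad g3 K2 by linarith
    also have "\<dots> = \<alpha> / 4 + L * ab + (4 * K^3 / q + K^4 + (K^4 - K^3) / 2) * \<beta>"
      using q by (simp add: L_def field_simps)
    also have "\<dots> \<le> \<alpha> / 4 + (\<alpha> / 4 + L\<^sup>2 * \<beta>) + (4 * K^3 / q + K^4 + (K^4 - K^3) / 2) * \<beta>" using yab' by simp
    finally have "\<alpha> \<le> \<alpha> / 4 + (\<alpha> / 4 + L\<^sup>2 * \<beta>) + (4 * K^3 / q + K^4 + (K^4 - K^3) / 2) * \<beta>" .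
    moreover have "T * \<beta> = L\<^sup>2 * \<beta> + (4 * K^3 / q + K^4 + (K^4 - K^3) / 2) * \<beta>"
      unfolding T_def by (simp only: distrib_right add.assoc)
    ultimately have a1: "\<alpha> \<le> 2 * T * \<beta>" by linarith
    have "ab \<le> 1 * \<alpha> + \<beta> / (4 * 1)" by (intro yab[rule_format]) simp
    then have "ab \<le> (2 * T + 1 / 4) * \<beta>" using a1 by (simp add: algebra_simps)
    then have "K * ab \<le> K * ((2 * T + 1 / 4) * \<beta>)" using K by (intro mult_left_mono) auto
    then have "(5 * (K * ab) + 4 * (K^3 * \<beta>)) / q \<le> (5 * (K * ((2 * T + 1 / 4) * \<beta>)) + 4 * (K^3 * \<beta>)) / q"
      using q by (intro divide_right_mono) auto
    with A have "A \<le> (5 * (K * ((2 * T + 1 / 4) * \<beta>)) + 4 * (K^3 * \<beta>)) / q" by simp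
    also have "\<dots> = ((5 * K * (2 * T + 1 / 4) + 4 * K^3) / q) * \<beta>" by (simp add: algebra_simps add_divide_distrib)
    finally show "A + \<alpha> \<le> C * \<beta>" using a1 by (simp add: C_def algebra_simps)
  qed
qed

lemma bounded_subsets_sub: "B \<in> bounded_subsets S \<Longrightarrow> B \<subseteq> S"
  by (simp add: bounded_subsets_def)

lemma Ck_bdd_bounded_mult:
  assumes "open S" "Ck_loc k S f" "Ck_loc k S g"
  shows "Ck_loc k S (\<lambda>x. f x * g x)"
  by (rule Ck_bdd_mult[OF assms(1) bounded_subsets_sub assms(2,3)])

lemma Ck_bdd_bounded_add:
  assumes "open S" "Ck_loc k S f" "Ck_loc k S g"
  shows "Ck_loc k S (\<lambda>x. f x + g x)"
  by (rule Ck_bdd_add[OF assms(1) bounded_subsets_sub assms(2,3)])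

lemma Ck_bdd_bounded_sum:
  assumes "open S" "\<And>j. j \<in> A \<Longrightarrow> Ck_loc k S (f j)"
  shows "Ck_loc k S (\<lambda>x. \<Sum>j\<in>A. f j x)"
  by (rule Ck_bdd_sum[OF assms(1) bounded_subsets_sub assms(2)])

lemma divergence_theorem_frontier:
  fixes f :: "real^'n::finite \<Rightarrow> real" and G :: "'n \<Rightarrow> real^'n \<Rightarrow> real"
  assumes S: "open S" and f: "Ck_loc 1 S f" "vanishes_on_frontier S f"
    and G: "\<And>i. Ck_loc 1 S (G i)" and B: "compact B" "\<And>i x. x \<in> S \<Longrightarrow> x \<notin> B \<Longrightarrow> G i x = 0"
  shows "integrable (lebesgue_on S) (\<lambda>x. \<Sum>i\<in>UNIV. partial i f x * G i x + f x * partial i (G i) x)"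
    and "(LINT x|lebesgue_on S. (\<Sum>i\<in>UNIV. partial i f x * G i x + f x * partial i (G i) x)) = 0"
proof -
  have i: "integrable (lebesgue_on S) (\<lambda>x. partial i f x * G i x + f x * partial i (G i) x)" for i
  proof (rule integrable_Ck_bdd[OF S _ compact_imp_bounded[OF B(1)]])
    show "Ck_loc 0 S (\<lambda>x. partial i f x * G i x + f x * partial i (G i) x)"
      using f(1) G[of i] unfolding One_nat_def Ck_bdd_Suc
      by (intro Ck_bdd_bounded_add Ck_bdd_bounded_mult S) auto
    have "partial i (G i) x = 0" if "x \<in> S" "x \<notin> B" for x
      by (rule partial_zero_outside_compact[OF S B that])
    then show "partial i f x * G i x + f x * partial i (G i) x = 0" if "x \<in> S" "x \<notin> B" for x
      using B(2) that by auto
  qed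
  then show "integrable (lebesgue_on S) (\<lambda>x. \<Sum>i\<in>UNIV. partial i f x * G i x + f x * partial i (G i) x)"
    by (rule Bochner_Integration.integrable_sum)
  show "(LINT x|lebesgue_on S. (\<Sum>i\<in>UNIV. partial i f x * G i x + f x * partial i (G i) x)) = 0"
    by (subst Bochner_Integration.integral_sum[OF i]) (use integration_by_parts[OF S f G B] in simp)
qed

lemma laplacian_mult:
  fixes f g :: "real^'n::finite \<Rightarrow> real"
  assumes S: "open S" and f: "Ck_on 2 S f" and g: "Ck_on 2 S g" and x: "x \<in> S"
  shows "laplacian (\<lambda>x. f x * g x) x = laplacian f x * g x + 2 * (\<Sum>i\<in>UNIV. partial i f x * partial i g x) + f x * laplacian g x"
proof -
  have d: "f differentiable (at x)" "g differentiable (at x)" "partial i f differentiable (at x)" "partial i g differentiable (at x)"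
    if "x \<in> S" for x i using f g that unfolding numeral_2_eq_2 Ck_on_Suc by auto
  have "partial i (partial i (\<lambda>x. f x * g x)) x =
     partial i (partial i f) x * g x + 2 * (partial i f x * partial i g x) + f x * partial i (partial i g) x" for i
  proof -
    have "partial i (partial i (\<lambda>x. f x * g x)) x = partial i (\<lambda>x. partial i f x * g x + f x * partial i g x) x"
      by (rule partial_cong_open[OF S x]) (simp add: partial_mult d)
    also have "\<dots> = partial i (\<lambda>x. partial i f x * g x) x + partial i (\<lambda>x. f x * partial i g x) x"
      by (rule partial_add) (intro differentiable_mult d x)+
    finally show ?thesis by (simp add: partial_mult d x)
  qed
  then show ?thesis
    by (simp add: laplacian_def sum.distrib sum_distrib_right sum_distrib_left)
qed

lemma cutoff_facts:
  assumes R: "R > 0"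
  shows cutoff_power: "cutoff R k t = cutoff R 1 t ^ k"
    and cutoff_nonneg: "0 \<le> cutoff R k t"
    and cutoff_le_1: "0 \<le> t \<Longrightarrow> cutoff R k t \<le> 1"
    and cutoff_zero: "R\<^sup>2 \<le> t \<Longrightarrow> 1 \<le> k \<Longrightarrow> cutoff R k t = 0"
  using R by (auto simp: cutoff_def divide_simps intro!: power_le_one)

lemma cutoff_radial:
  assumes R: "R > 0" and k: "k \<ge> 3"
  shows "Ck_on 2 UNIV (\<lambda>x::real^'n::finite. cut R k x)"
    and "partial i (\<lambda>x::real^'n::finite. cut R k x) x = - (2 * real k / R\<^sup>2) * (x $ i * cut R (k - 1) x)"
    and "laplacian (\<lambda>x::real^'n::finite. cut R k x) x =
      (4 * (real k * (real k - 1)) * ((x \<bullet> x) / R\<^sup>2) * cut R (k - 2) x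
        - 2 * real CARD('n) * real k * cut R (k - 1) x) / R\<^sup>2"
proof -
  define g' where "g' t = - (real k / R\<^sup>2) * cutoff R (k - 1) t" for t
  define g'' where "g'' t = - (real k / R\<^sup>2) * (- (real (k - 1) / R\<^sup>2) * cutoff R (k - 2) t)" for t
  have 1: "(cutoff R k has_real_derivative g' t) (at t)" for t
    unfolding g'_def by (rule cutoff_deriv) (use k R in auto)
  have 2: "(g' has_real_derivative g'' t) (at t)" for t
    unfolding g'_def[abs_def] g''_def using cutoff_deriv[of "k - 1" R t] k R
    by (intro DERIV_cmult) (simp add: numeral_2_eq_2)
  have 3: "continuous_on {0..} g''"
    unfolding g''_def[abs_def] by (intro continuous_intros continuous_cutoff)
  show "Ck_on 2 UNIV (\<lambda>x::real^'n. cut R k x)" by (rule radial_Ck_on[OF 1 2 3])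
  show "partial i (\<lambda>x::real^'n. cut R k x) x = - (2 * real k / R\<^sup>2) * (x $ i * cut R (k - 1) x)"
    using radial_partial[of "cutoff R k" g' g'' i x, OF 1 2 3] by (simp add: g'_def)
  show "laplacian (\<lambda>x::real^'n. cut R k x) x =
      (4 * (real k * (real k - 1)) * ((x \<bullet> x) / R\<^sup>2) * cut R (k - 2) x
        - 2 * real CARD('n) * real k * cut R (k - 1) x) / R\<^sup>2"
    by (subst radial_laplacian[of "cutoff R k" g' g'' x, OF 1 2 3])
      (use k R in \<open>simp add: g'_def g''_def of_nat_diff field_simps power2_eq_square\<close>)
qed

lemma young: "0 < e \<Longrightarrow> x * y \<le> e * x\<^sup>2 + y\<^sup>2 / (4 * e)" for x y e :: real
proof -
  assume e: "0 < e"
  have "0 \<le> (2 * e * x - y)\<^sup>2 / (4 * e)" using e by simp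
  also have "\<dots> = e * x\<^sup>2 + y\<^sup>2 / (4 * e) - x * y" using e by (simp add: field_simps power2_eq_square)
  finally show ?thesis by simp
qed

locale stable_biharmonic =
  fixes S :: "(real^'n::finite) set" and u :: "real^'n \<Rightarrow> real" and p :: real
  assumes S: "open S" and p: "p > 1" and sol: "stable_solution S p u"
begin

abbreviation "w \<equiv> laplacian u"

lemma solution_Ck_bdd: "Ck_loc 4 S u"
proof -
  have c: "Ck_closure 4 S u" using sol by (simp add: stable_solution_def classical_solution_def)
  have "bounded (partials is u ` B)" if l: "length is \<le> 4" and B: "B \<in> bounded_subsets S" for "is" B
  proof -
    obtain g where g: "continuous_on (closure S) g" "\<forall>x\<in>S. g x = partials is u x"
      using c l by (auto simp: Ck_closure_def)
    have BS: "B \<subseteq> S" "bounded B" using B by (auto simp: bounded_subsets_def)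
    have "compact (g ` closure B)"
      using BS by (intro compact_continuous_image continuous_on_subset[OF g(1)] closure_mono) auto
    then have "bounded (g ` closure B)" by (rule compact_imp_bounded)
    moreover have "partials is u ` B \<subseteq> g ` closure B"
      using g(2) BS closure_subset[of B] by (force simp: image_iff)
    ultimately show ?thesis by (rule bounded_subset)
  qed
  then show ?thesis using c by (simp add: Ck_bdd_def Ck_closure_def)
qed

lemma solution_pos: "x \<in> S \<Longrightarrow> 0 < u x"
  and solution_eq: "x \<in> S \<Longrightarrow> laplacian w x = u x powr p"
  using sol by (auto simp: stable_solution_def classical_solution_def)

lemma solution_vanishes: "vanishes_on_frontier S u" "vanishes_on_frontier S w"
proof -
  show "vanishes_on_frontier S w"
    using sol by (simp add: vanishes_on_frontier_def stable_solution_def classical_solution_def)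
  have c: "continuous_on (closure S) u" and z: "\<And>x. x \<in> frontier S \<Longrightarrow> u x = 0"
    using sol by (auto simp: stable_solution_def classical_solution_def Ck_closure_def)
  show "vanishes_on_frontier S u"
    unfolding vanishes_on_frontier_def
  proof
    fix x assume x: "x \<in> frontier S"
    then have "x \<in> closure S" by (simp add: frontier_def)
    then have "(u \<longlongrightarrow> u x) (at x within closure S)" using c by (simp add: continuous_on)
    then have "(u \<longlongrightarrow> u x) (at x within S)" by (rule tendsto_within_subset) (rule closure_subset)
    then show "(u \<longlongrightarrow> 0) (at x within S)" using z[OF x] by simp
  qed
qed

lemma solution_partial_Ck_bdd: "Ck_loc 3 S (partial i u)"
  and solution_laplacian_Ck_bdd: "Ck_loc 2 S w"
  and laplacian_partial_Ck_bdd: "Ck_loc 1 S (partial i w)"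
proof -
  have 4: "Ck_loc (Suc (Suc 2)) S u"
    using solution_Ck_bdd by (simp add: numeral_eq_Suc)
  then show "Ck_loc 3 S (partial i u)"
    unfolding Ck_bdd_Suc[of _ "Suc 2"] by (simp add: numeral_eq_Suc)
  show w: "Ck_loc 2 S w"
  proof -
    have "Ck_loc (Suc 2) S (partial i u)" for i
      using 4 unfolding Ck_bdd_Suc[of _ "Suc 2"] by blast
    then have "Ck_loc 2 S (partial i (partial i u))" for i
      unfolding Ck_bdd_Suc[of _ 2] by blast
    then show ?thesis unfolding laplacian_def by (intro Ck_bdd_bounded_sum S)
  qed
  show "Ck_loc 1 S (partial i w)"
    using w unfolding numeral_2_eq_2 Ck_bdd_Suc[of _ "Suc 0"] by simp
qed

end

text \<open>
  The integrands of the energy argument at one point: \<open>s\<close> is the base of the cutoff, \<open>t\<close> its power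
  \<open>m - 2\<close>, \<open>\<rho> = |x|\<^sup>2 / R\<^sup>2\<close>, \<open>n\<close> the dimension, \<open>D\<close> the radial derivative
  \<open>drift R x\<close>, and \<open>l1\<close>, \<open>l2\<close> are the Laplacians of the powers \<open>m\<close> and \<open>2 m\<close>
  of the cutoff. In the first difference the terms with \<open>w\<^sup>2\<close> and with \<open>w D\<close> cancel, so that
  every remaining product carries a factor that can be absorbed.
\<close>

lemma energy_pointwise:
  fixes s t \<rho> w u D g m n R :: real
  assumes s: "0 \<le> s" and t: "0 \<le> t" "s \<le> 1" and \<rho>: "0 \<le> \<rho>" "\<rho> * t \<le> t" and u: "0 \<le> u" and R: "0 < R"
    and m: "1 \<le> m" and n: "0 \<le> n" and D: "D\<^sup>2 * (s\<^sup>2 * t\<^sup>2) \<le> g * (s\<^sup>2 * t\<^sup>2)"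
  defines "l1 \<equiv> (4 * (m * (m - 1)) * \<rho> * t - 2 * n * m * (s * t)) / R\<^sup>2"
    and "l2 \<equiv> (4 * (2 * m * (2 * m - 1)) * \<rho> * (s\<^sup>2 * t\<^sup>2) - 2 * n * (2 * m) * (s^3 * t\<^sup>2)) / R\<^sup>2"
    and "K \<equiv> 16 * m\<^sup>2 + (4 * m\<^sup>2 + 2 * n * m)\<^sup>2 + 8 * m * (4 * m\<^sup>2 + 2 * n * m) + (16 * m\<^sup>2 + 4 * n * m) + 8 * m"
  shows "(w * (s\<^sup>2 * t) - 4 * m * (s * t) * D + u * l1)\<^sup>2 - w * (w * (s^4 * t\<^sup>2) - 8 * m * (s^3 * t\<^sup>2) * D + u * l2)
     \<le> K * (g * (s\<^sup>2 * t\<^sup>2)) + K * (u\<^sup>2 / R^4 * t\<^sup>2) + K * (u * \<bar>D\<bar> / R\<^sup>2 * (s * t\<^sup>2)) + K * (\<bar>w\<bar> * u / R\<^sup>2 * (s\<^sup>2 * t\<^sup>2))" (is ?A)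
    and "w\<^sup>2 * (s^4 * t\<^sup>2) - w * (w * (s^4 * t\<^sup>2) - 8 * m * (s^3 * t\<^sup>2) * D + u * l2)
     \<le> K * (\<bar>w\<bar> * \<bar>D\<bar> * (s^3 * t\<^sup>2)) + K * (\<bar>w\<bar> * u / R\<^sup>2 * (s\<^sup>2 * t\<^sup>2))" (is ?B)
proof -
  define C0 where "C0 = 4 * m\<^sup>2 + 2 * n * m"
  define C1 where "C1 = 16 * m\<^sup>2 + 4 * n * m"
  have C0: "0 \<le> C0" "0 \<le> C1" using m n by (auto simp: C0_def C1_def)
  define b where "b = u * t / R\<^sup>2"
  define d where "d = \<bar>D\<bar> * (s * t)"
  have b: "0 \<le> b" and d: "0 \<le> d" using u t s R by (auto simp: b_def d_def)
  have st: "s * t \<le> t" "0 \<le> s * t" using s t mult_right_mono[of s 1 t] by auto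
  have l1: "\<bar>l1\<bar> \<le> C0 * t / R\<^sup>2"
  proof -
    have "\<bar>4 * (m * (m - 1)) * \<rho> * t - 2 * n * m * (s * t)\<bar> \<le> (4 * (m * (m - 1))) * (\<rho> * t) + 2 * n * m * (s * t)"
      using m n \<rho> t st by (simp add: abs_le_iff mult.assoc)
    also have "\<dots> \<le> (4 * (m * (m - 1))) * t + 2 * n * m * t"
      using m n \<rho> st by (intro add_mono mult_left_mono) auto
    also have "\<dots> \<le> C0 * t" using m t by (simp add: C0_def algebra_simps power2_eq_square)
    finally show ?thesis using R by (simp add: l1_def divide_right_mono)
  qed
  have ul1: "\<bar>u * l1\<bar> \<le> C0 * b"
    using mult_left_mono[OF l1 u] u by (simp add: abs_mult b_def mult_ac)
  have l2: "\<bar>l2\<bar> \<le> C1 * (s\<^sup>2 * t\<^sup>2) / R\<^sup>2"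
  proof -
    have q: "0 \<le> s\<^sup>2 * t" "s^3 * t\<^sup>2 \<le> s\<^sup>2 * t\<^sup>2"
      using s t power_decreasing[of 2 3 s] by (auto intro!: mult_right_mono)
    have r: "\<rho> * (s\<^sup>2 * t\<^sup>2) \<le> s\<^sup>2 * t\<^sup>2"
      using mult_left_mono[OF \<rho>(2) q(1)] by (simp add: power2_eq_square mult_ac)
    have "\<bar>4 * (2 * m * (2 * m - 1)) * \<rho> * (s\<^sup>2 * t\<^sup>2) - 2 * n * (2 * m) * (s^3 * t\<^sup>2)\<bar> \<le>
      (4 * (2 * m * (2 * m - 1))) * (\<rho> * (s\<^sup>2 * t\<^sup>2)) + 2 * n * (2 * m) * (s^3 * t\<^sup>2)"
      using m n \<rho> t s by (simp add: abs_le_iff mult.assoc)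
    also have "\<dots> \<le> (4 * (2 * m * (2 * m - 1))) * (s\<^sup>2 * t\<^sup>2) + 2 * n * (2 * m) * (s\<^sup>2 * t\<^sup>2)"
      using m n r q by (intro add_mono mult_left_mono) auto
    also have "\<dots> = (C1 - 8 * m) * (s\<^sup>2 * t\<^sup>2)" by (simp add: C1_def algebra_simps power2_eq_square)
    also have "\<dots> \<le> C1 * (s\<^sup>2 * t\<^sup>2)" using m by (intro mult_right_mono) auto
    finally show ?thesis using R by (simp add: l2_def divide_right_mono)
  qed
  have K: "16 * m\<^sup>2 \<le> K" "C0\<^sup>2 \<le> K" "8 * m * C0 \<le> K" "8 * m\<^sup>2 \<le> K" "8 * m \<le> K" "C1 \<le> K"
    using C0 m n unfolding K_def C0_def[symmetric] C1_def[symmetric] by (auto simp: add_nonneg_nonneg)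
  have ab: "0 \<le> \<bar>w\<bar> * u / R\<^sup>2 * (s\<^sup>2 * t\<^sup>2)" using u by simp
  have e1: "(w * (s\<^sup>2 * t) - 4 * m * (s * t) * D + u * l1)\<^sup>2 - w * (w * (s^4 * t\<^sup>2) - 8 * m * (s^3 * t\<^sup>2) * D + u * l2)
    = 16 * m\<^sup>2 * (D\<^sup>2 * (s\<^sup>2 * t\<^sup>2)) + (u * l1)\<^sup>2 - 8 * m * ((D * (s * t)) * (u * l1)) + u * w * (2 * (s\<^sup>2 * t) * l1 - l2)"
    by (simp add: power2_eq_square power3_eq_cube power4_eq_xxxx algebra_simps)
  have e2: "2 * (s\<^sup>2 * t) * l1 - l2 = - (8 * m\<^sup>2 * \<rho> * (s\<^sup>2 * t\<^sup>2)) / R\<^sup>2"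
    using R by (simp add: l1_def l2_def divide_simps power2_eq_square power3_eq_cube) (simp add: algebra_simps)
  have e3: "u * w * (- (8 * m\<^sup>2 * \<rho> * (s\<^sup>2 * t\<^sup>2)) / R\<^sup>2) \<le> 8 * m\<^sup>2 * (\<bar>w\<bar> * u / R\<^sup>2 * (s\<^sup>2 * t\<^sup>2))"
  proof -
    have "u * w * (- (8 * m\<^sup>2 * \<rho> * (s\<^sup>2 * t\<^sup>2)) / R\<^sup>2) \<le> \<bar>u * w * (- (8 * m\<^sup>2 * \<rho> * (s\<^sup>2 * t\<^sup>2)) / R\<^sup>2)\<bar>"
      by (rule abs_ge_self)
    also have "\<dots> = 8 * m\<^sup>2 * (\<bar>w\<bar> * u / R\<^sup>2 * s\<^sup>2 * t) * (\<rho> * t)"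
      using u \<rho> by (simp add: abs_mult power2_eq_square mult_ac)
    also have "\<dots> \<le> 8 * m\<^sup>2 * (\<bar>w\<bar> * u / R\<^sup>2 * s\<^sup>2 * t) * t"
      using u t \<rho>(2) by (intro mult_left_mono) auto
    finally show ?thesis by (simp add: power2_eq_square mult_ac)
  qed
  have e4: "- (8 * m * ((D * (s * t)) * (u * l1))) \<le> 8 * m * C0 * (d * b)"
  proof -
    have "\<bar>(D * (s * t)) * (u * l1)\<bar> \<le> d * (C0 * b)"
      unfolding abs_mult[of "D * (s * t)"] using st s ul1 d by (intro mult_mono) (auto simp: d_def abs_mult)
    then have "8 * m * (- ((D * (s * t)) * (u * l1))) \<le> 8 * m * (d * (C0 * b))"
      using m by (intro mult_left_mono) auto
    then show ?thesis by (simp add: mult_ac)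
  qed
  have e5: "(u * l1)\<^sup>2 \<le> C0\<^sup>2 * b\<^sup>2"
    using power_mono[OF ul1, of 2] by (simp add: power_mult_distrib)
  have 1: "(w * (s\<^sup>2 * t) - 4 * m * (s * t) * D + u * l1)\<^sup>2 - w * (w * (s^4 * t\<^sup>2) - 8 * m * (s^3 * t\<^sup>2) * D + u * l2)
    \<le> 16 * m\<^sup>2 * (D\<^sup>2 * (s\<^sup>2 * t\<^sup>2)) + C0\<^sup>2 * b\<^sup>2 + 8 * m * C0 * (d * b) + 8 * m\<^sup>2 * (\<bar>w\<bar> * u / R\<^sup>2 * (s\<^sup>2 * t\<^sup>2))"
    using e1 e3 e4 e5 unfolding e2 by linarith
  have "16 * m\<^sup>2 * (D\<^sup>2 * (s\<^sup>2 * t\<^sup>2)) \<le> K * (g * (s\<^sup>2 * t\<^sup>2))"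
  proof -
    have "16 * m\<^sup>2 * (D\<^sup>2 * (s\<^sup>2 * t\<^sup>2)) \<le> K * (D\<^sup>2 * (s\<^sup>2 * t\<^sup>2))" using K(1) by (intro mult_right_mono) auto
    also have "\<dots> \<le> K * (g * (s\<^sup>2 * t\<^sup>2))" using D K(5) m by (intro mult_left_mono) auto
    finally show ?thesis .
  qed
  moreover have "C0\<^sup>2 * b\<^sup>2 \<le> K * b\<^sup>2" "8 * m * C0 * (d * b) \<le> K * (d * b)"
    "8 * m\<^sup>2 * (\<bar>w\<bar> * u / R\<^sup>2 * (s\<^sup>2 * t\<^sup>2)) \<le> K * (\<bar>w\<bar> * u / R\<^sup>2 * (s\<^sup>2 * t\<^sup>2))"
    using K b d ab by (intro mult_right_mono; simp)+
  moreover have "b\<^sup>2 = u\<^sup>2 / R^4 * t\<^sup>2" "d * b = u * \<bar>D\<bar> / R\<^sup>2 * (s * t\<^sup>2)"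
    by (simp_all add: b_def d_def power2_eq_square power4_eq_xxxx mult_ac)
  ultimately show ?A using 1 by simp
  have "w\<^sup>2 * (s^4 * t\<^sup>2) - w * (w * (s^4 * t\<^sup>2) - 8 * m * (s^3 * t\<^sup>2) * D + u * l2)
     = 8 * m * (w * D * (s^3 * t\<^sup>2)) - w * u * l2"
    by (simp add: power2_eq_square algebra_simps)
  also have "\<dots> \<le> 8 * m * (\<bar>w\<bar> * \<bar>D\<bar> * (s^3 * t\<^sup>2)) + C1 * (\<bar>w\<bar> * u / R\<^sup>2 * (s\<^sup>2 * t\<^sup>2))"
  proof -
    have "w * D * (s^3 * t\<^sup>2) \<le> \<bar>w\<bar> * \<bar>D\<bar> * (s^3 * t\<^sup>2)"
      using s abs_ge_self[of "w * D"] by (intro mult_right_mono) (auto simp: abs_mult)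
    then have "8 * m * (w * D * (s^3 * t\<^sup>2)) \<le> 8 * m * (\<bar>w\<bar> * \<bar>D\<bar> * (s^3 * t\<^sup>2))" using m by (intro mult_left_mono) auto
    moreover have "- (w * u * l2) \<le> C1 * (\<bar>w\<bar> * u / R\<^sup>2 * (s\<^sup>2 * t\<^sup>2))"
    proof -
      have "- (w * u * l2) \<le> \<bar>w\<bar> * u * \<bar>l2\<bar>" using u abs_ge_minus_self[of "w * u * l2"] by (simp add: abs_mult)
      also have "\<dots> \<le> \<bar>w\<bar> * u * (C1 * (s\<^sup>2 * t\<^sup>2) / R\<^sup>2)" using l2 u by (intro mult_left_mono) auto
      finally show ?thesis by (simp add: mult_ac)
    qed
    ultimately show ?thesis by simp
  qed
  also have "\<dots> \<le> K * (\<bar>w\<bar> * \<bar>D\<bar> * (s^3 * t\<^sup>2)) + K * (\<bar>w\<bar> * u / R\<^sup>2 * (s\<^sup>2 * t\<^sup>2))"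
    using K ab s by (intro add_mono mult_right_mono) auto
  finally show ?B .
qed

lemma cutoff_Ck_bdd_0: "Ck_loc 0 S (\<lambda>x::real^'n::finite. cut R k x)"
proof (rule Ck_on_UNIV_imp_Ck_bdd)
  show "Ck_on 0 UNIV (\<lambda>x::real^'n. cut R k x)"
    unfolding Ck_on_0 by (rule continuous_on_compose2[OF continuous_cutoff[of UNIV]]) (auto intro!: continuous_intros)
qed

lemma cutoff_outside: "R > 0 \<Longrightarrow> 1 \<le> k \<Longrightarrow> x \<notin> cball 0 R \<Longrightarrow> cut R k x = 0"
  for x :: "real^'n::finite"
  using power_mono[of R "norm x" 2] by (intro cutoff_zero) (auto simp: power2_norm_eq_inner)

lemma integrable_cutoff:
  fixes f :: "real^'n::finite \<Rightarrow> real"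
  assumes "open S" "Ck_loc 0 S f" "R > 0" "1 \<le> k"
  shows "integrable (lebesgue_on S) (\<lambda>x. f x * cut R k x)"
  by (rule integrable_Ck_bdd[OF assms(1) Ck_bdd_bounded_mult[OF assms(1,2) cutoff_Ck_bdd_0], of "cball 0 R"])
    (use cutoff_outside[OF assms(3,4)] in auto)

context stable_biharmonic
begin

text \<open>
  Up to the factor \<open>- 2\<close> the scalar product of the gradients of \<open>u\<close> and of
  \<open>1 - |x|\<^sup>2 / R\<^sup>2\<close>.
\<close>

definition drift :: "real \<Rightarrow> real^'n \<Rightarrow> real" where
  "drift R x = (\<Sum>i\<in>UNIV. partial i u x * x $ i) / R\<^sup>2"

definition grad_sq :: "real^'n \<Rightarrow> real" where
  "grad_sq x = (\<Sum>i\<in>UNIV. partial i u x * partial i u x)"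

lemma u_Ck_bdd: "k \<le> 4 \<Longrightarrow> Ck_loc k S u"
  by (rule Ck_bdd_mono[OF solution_Ck_bdd])

lemma w_Ck_bdd: "k \<le> 2 \<Longrightarrow> Ck_loc k S w"
  by (rule Ck_bdd_mono[OF solution_laplacian_Ck_bdd])

lemma partial_u_Ck_bdd: "k \<le> 3 \<Longrightarrow> Ck_loc k S (partial i u)"
  by (rule Ck_bdd_mono[OF solution_partial_Ck_bdd])

lemma drift_Ck_bdd: "Ck_loc 0 S (drift R)"
  unfolding drift_def[abs_def] divide_inverse
  by (intro Ck_bdd_bounded_mult Ck_bdd_bounded_sum S partial_u_Ck_bdd Ck_bdd_const Ck_bdd_smooth smooth_coord) simp_all

lemma grad_sq_Ck_bdd: "Ck_loc 0 S grad_sq"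
  unfolding grad_sq_def[abs_def] by (intro Ck_bdd_bounded_mult Ck_bdd_bounded_sum S partial_u_Ck_bdd) simp_all

lemma abs_Ck_bdd: "Ck_loc 0 S f \<Longrightarrow> Ck_loc 0 S (\<lambda>x. \<bar>f x\<bar>)"
  by (rule Ck_bdd_0_compose) (auto intro!: continuous_intros)

lemma u_powr_Ck_bdd:
  assumes "a > 0" shows "Ck_loc 0 S (\<lambda>x. u x powr a)"
proof -
  have "Ck_loc 0 S (\<lambda>x. \<bar>u x\<bar> powr a)"
    using assms by (intro Ck_bdd_0_compose[OF u_Ck_bdd, where G = "\<lambda>t. \<bar>t\<bar> powr a"] continuous_on_powr' continuous_intros) auto
  then show ?thesis
    by (subst Ck_bdd_cong[OF S bounded_subsets_sub, of _ _ "\<lambda>x. \<bar>u x\<bar> powr a"]) (use solution_pos in \<open>auto simp: less_imp_le\<close>)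
qed

lemma cutoff_C2: "R > 0 \<Longrightarrow> k \<ge> 3 \<Longrightarrow> Ck_loc 2 S (\<lambda>x. cut R k x)"
  by (rule Ck_on_UNIV_imp_Ck_bdd[OF cutoff_radial(1)])

lemma laplacian_u_cutoff:
  assumes R: "R > 0" and k: "k \<ge> 3" and x: "x \<in> S"
  shows "laplacian (\<lambda>x. u x * cut R k x) x =
    w x * cut R k x - 4 * real k * cut R (k - 1) x * drift R x
      + u x * laplacian (\<lambda>x. cut R k x) x"
proof -
  have "(\<Sum>i\<in>UNIV. partial i u x * partial i (\<lambda>x. cut R k x) x) = - (2 * real k) * cut R (k - 1) x * drift R x"
    unfolding cutoff_radial(2)[OF R k] drift_def by (simp add: sum_distrib_left sum_divide_distrib sum_negf mult_ac)
  then show ?thesis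
    by (subst laplacian_mult[OF S Ck_bdd_imp_Ck_on[OF u_Ck_bdd] Ck_bdd_imp_Ck_on[OF cutoff_C2[OF R k]] x]) simp_all
qed

text \<open>
  Stability tested with \<open>u\<close> times the cutoff, which inherits the boundary values 0 of \<open>u\<close>.
\<close>

lemma energy_stability:
  assumes R: "R > 0" and m: "m \<ge> 3"
  shows "p * (LINT x|lebesgue_on S. u x powr (p + 1) * cut R (2 * m) x) \<le>
    (LINT x|lebesgue_on S. (laplacian (\<lambda>x. u x * cut R m x) x)\<^sup>2)"
    and "integrable (lebesgue_on S) (\<lambda>x. (laplacian (\<lambda>x. u x * cut R m x) x)\<^sup>2)"
proof -
  let ?f = "\<lambda>x. u x * cut R m x"
  have f: "Ck_loc 2 S ?f"
    by (intro Ck_bdd_bounded_mult S cutoff_C2 R m u_Ck_bdd) simp_all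
  have f0: "?f x = 0" if "x \<notin> cball 0 R" for x using cutoff_outside[OF R _ that, of m] m by simp
  have v: "vanishes_on_frontier S ?f"
    unfolding vanishes_on_frontier_def
  proof
    fix z assume z: "z \<in> frontier S"
    have "continuous_on UNIV (\<lambda>x::real^'n. cut R m x)"
      by (rule continuous_on_compose2[OF continuous_cutoff[of UNIV]]) (auto intro!: continuous_intros)
    then have "((\<lambda>x. cut R m x) \<longlongrightarrow> cutoff R m (z \<bullet> z)) (at z within S)"
      by (auto simp: continuous_on intro: tendsto_within_subset)
    moreover have "(u \<longlongrightarrow> 0) (at z within S)" using solution_vanishes(1) z by (simp add: vanishes_on_frontier_def)
    ultimately show "(?f \<longlongrightarrow> 0) (at z within S)" using tendsto_mult[of u 0 "at z within S"] by fastforce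
  qed
  have st: "\<forall>\<phi> \<in> sobolev S 2 \<inter> H1_0 S. Lambda0 S p u \<phi> \<ge> 0" using sol by (simp add: stable_solution_def)
  have "p * (LINT x|lebesgue_on S. u x powr (p - 1) * (?f x)\<^sup>2) \<le> (LINT x|lebesgue_on S. (laplacian ?f x)\<^sup>2)"
    by (rule stable_imp_inequality[OF S p f v compact_cball[of 0 R] _ u_Ck_bdd solution_pos st]) (use f0 in auto)
  also have "(LINT x|lebesgue_on S. u x powr (p - 1) * (?f x)\<^sup>2) = (LINT x|lebesgue_on S. u x powr (p + 1) * cut R (2 * m) x)"
  proof (rule integral_lebesgue_on_cong)
    fix x assume "x \<in> S"
    then have "u x powr (p + 1) = u x powr (p - 1) * (u x)\<^sup>2"
      using solution_pos[of x] powr_add[of "u x" "p - 1" 2] by (simp add: powr_numeral add.commute)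
    then show "u x powr (p - 1) * (?f x)\<^sup>2 = u x powr (p + 1) * cut R (2 * m) x"
      by (simp add: power_mult_distrib cutoff_def power_mult mult.commute[of 2] power_even_eq)
  qed
  finally show "p * (LINT x|lebesgue_on S. u x powr (p + 1) * cut R (2 * m) x) \<le> (LINT x|lebesgue_on S. (laplacian ?f x)\<^sup>2)" .
  have "Ck_loc 0 S (laplacian ?f)"
    using f unfolding laplacian_def numeral_2_eq_2 Ck_bdd_Suc
    by (intro Ck_bdd_bounded_sum[OF S]) auto
  then have "Ck_loc 0 S (\<lambda>x. laplacian ?f x * laplacian ?f x)" by (intro Ck_bdd_bounded_mult S)
  then have "integrable (lebesgue_on S) (\<lambda>x. laplacian ?f x * laplacian ?f x)"
  proof (rule integrable_Ck_bdd[OF S _ bounded_cball[of 0 R]])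
    fix x :: "real^'n" assume x: "x \<in> S" "x \<notin> cball 0 R"
    have z: "cut R k x = 0" if "1 \<le> k" for k using cutoff_outside[OF R that x(2)] .
    show "laplacian ?f x * laplacian ?f x = 0"
      unfolding laplacian_u_cutoff[OF R m x(1)] using m by (simp add: cutoff_radial(3)[OF R m] z)
  qed
  then show "integrable (lebesgue_on S) (\<lambda>x. (laplacian ?f x)\<^sup>2)" by (simp add: power2_eq_square)
qed

text \<open>
  The equation multiplied by \<open>u\<close> times the cutoff. Two integrations by parts move the outer Laplacian
  to the other factor: the first uses that \<open>u\<close> vanishes on the frontier, the second that \<open>w\<close>
  does.
\<close>

lemma energy_testing:
  assumes R: "R > 0" and m: "m \<ge> 3"
  shows "(LINT x|lebesgue_on S. u x powr (p + 1) * cut R m x) =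
    (LINT x|lebesgue_on S. w x * laplacian (\<lambda>x. u x * cut R m x) x)"
    and "integrable (lebesgue_on S) (\<lambda>x. w x * laplacian (\<lambda>x. u x * cut R m x) x)"
proof -
  let ?c = "\<lambda>x::real^'n. cut R m x"
  let ?f = "\<lambda>x. u x * ?c x"
  have f: "Ck_loc 2 S ?f"
    by (intro Ck_bdd_bounded_mult S cutoff_C2 R m u_Ck_bdd) simp_all
  have c2: "Ck_loc 2 S ?c" by (rule cutoff_C2[OF R m])
  have c1: "Ck_loc 1 S ?c" by (rule Ck_bdd_mono[OF c2]) simp
  have c0: "?c x = 0" if "x \<notin> cball 0 R" for x using cutoff_outside[OF R _ that, of m] m by simp
  have pf1: "Ck_loc 1 S (partial i ?f)" for i
    using f unfolding numeral_2_eq_2 Ck_bdd_Suc[of _ "Suc 0"] by simp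
  have pf0: "partial i ?f x = 0" if "x \<in> S" "x \<notin> cball 0 R" for i x
    by (rule partial_zero_outside_compact[OF S compact_cball _ that]) (use c0 in auto)
  let ?A = "\<lambda>x. \<Sum>i\<in>UNIV. partial i u x * (?c x * partial i w x) + u x * partial i (\<lambda>x. ?c x * partial i w x) x"
  let ?B = "\<lambda>x. \<Sum>i\<in>UNIV. partial i w x * partial i ?f x + w x * partial i (partial i ?f) x"
  have A: "integrable (lebesgue_on S) ?A" "integral\<^sup>L (lebesgue_on S) ?A = 0"
    by (rule divergence_theorem_frontier[OF S u_Ck_bdd solution_vanishes(1) _ compact_cball[of 0 R]];
      use c0 in \<open>auto intro!: Ck_bdd_bounded_mult S c1[unfolded One_nat_def] laplacian_partial_Ck_bdd[unfolded One_nat_def]\<close>)+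
  have B: "integrable (lebesgue_on S) ?B" "integral\<^sup>L (lebesgue_on S) ?B = 0"
    by (rule divergence_theorem_frontier[OF S w_Ck_bdd solution_vanishes(2) pf1 compact_cball[of 0 R] pf0]; simp)+
  have e: "?B x - ?A x = w x * laplacian ?f x - u x powr (p + 1) * ?c x" if x: "x \<in> S" for x
  proof -
    have d: "u differentiable (at x)" "?c differentiable (at x)" "partial i w differentiable (at x)" for i
      using u_Ck_bdd[of 1] c1 laplacian_partial_Ck_bdd[of i] x unfolding One_nat_def Ck_bdd_Suc by auto
    have "partial i ?f x = partial i u x * ?c x + u x * partial i ?c x" for i
      using d by (simp add: partial_mult)
    moreover have "partial i (\<lambda>x. ?c x * partial i w x) x = partial i ?c x * partial i w x + ?c x * partial i (partial i w) x" for i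
      using d by (simp add: partial_mult)
    ultimately have "?B x - ?A x = (\<Sum>i\<in>UNIV. w x * partial i (partial i ?f) x - u x * ?c x * partial i (partial i w) x)"
      unfolding sum_subtractf[symmetric] by (intro sum.cong refl) (simp add: algebra_simps)
    also have "\<dots> = w x * laplacian ?f x - u x * ?c x * laplacian w x"
      by (simp add: sum_subtractf laplacian_def flip: sum_distrib_left)
    also have "u x * ?c x * laplacian w x = u x powr (p + 1) * ?c x"
      using solution_pos[OF x] powr_add[of "u x" p 1] by (simp add: solution_eq[OF x])
    finally show ?thesis .
  qed
  have C: "integrable (lebesgue_on S) (\<lambda>x. u x powr (p + 1) * ?c x)"
    using m p by (intro integrable_cutoff S u_powr_Ck_bdd R) auto
  have D: "integrable (lebesgue_on S) (\<lambda>x. w x * laplacian ?f x - u x powr (p + 1) * ?c x)"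
    using Bochner_Integration.integrable_diff[OF B(1) A(1)]
    by (rule Bochner_Integration.integrable_cong[THEN iffD1, rotated 2]) (use e in auto)
  from Bochner_Integration.integrable_add[OF D C]
  show I: "integrable (lebesgue_on S) (\<lambda>x. w x * laplacian ?f x)" by simp
  have "(LINT x|lebesgue_on S. w x * laplacian ?f x - u x powr (p + 1) * ?c x) = (LINT x|lebesgue_on S. ?B x - ?A x)"
    by (rule integral_lebesgue_on_cong) (use e in simp)
  also have "\<dots> = 0" using A B by simp
  finally show "(LINT x|lebesgue_on S. u x powr (p + 1) * ?c x) = (LINT x|lebesgue_on S. w x * laplacian ?f x)"
    using I C by simp
qed

text \<open>
  The identity \<open>\<Delta>u = w\<close> multiplied by \<open>u\<close> times the cutoff; it controls the gradient.
\<close>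

lemma energy_gradient:
  assumes R: "R > 0" and m: "m \<ge> 3"
  shows "(LINT x|lebesgue_on S. grad_sq x * cut R m x + u x * w x * cut R m x
      - 2 * real m * (u x * drift R x) * cut R (m - 1) x) = 0"
    and "integrable (lebesgue_on S) (\<lambda>x. grad_sq x * cut R m x + u x * w x * cut R m x
      - 2 * real m * (u x * drift R x) * cut R (m - 1) x)"
proof -
  let ?c = "\<lambda>x::real^'n. cut R m x"
  let ?I = "\<lambda>x. grad_sq x * ?c x + u x * w x * ?c x - 2 * real m * (u x * drift R x) * cut R (m - 1) x"
  let ?A = "\<lambda>x. \<Sum>i\<in>UNIV. partial i u x * (?c x * partial i u x) + u x * partial i (\<lambda>x. ?c x * partial i u x) x"
  have c1: "Ck_loc 1 S ?c" by (rule Ck_bdd_mono[OF cutoff_C2[OF R m]]) simp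
  have c0: "?c x = 0" if "x \<notin> cball 0 R" for x using cutoff_outside[OF R _ that, of m] m by simp
  have pu1: "Ck_loc 1 S (partial i u)" for i by (rule partial_u_Ck_bdd) simp
  have A: "integrable (lebesgue_on S) ?A" "integral\<^sup>L (lebesgue_on S) ?A = 0"
    by (rule divergence_theorem_frontier[OF S u_Ck_bdd solution_vanishes(1) _ compact_cball[of 0 R]];
      use c0 in \<open>auto intro!: Ck_bdd_bounded_mult S c1[unfolded One_nat_def] pu1[unfolded One_nat_def]\<close>)+
  have e: "?A x = ?I x" if x: "x \<in> S" for x
  proof -
    have d: "?c differentiable (at x)" "partial i u differentiable (at x)" for i
      using c1 pu1[of i] x unfolding One_nat_def Ck_bdd_Suc by auto
    have "partial i (\<lambda>x. ?c x * partial i u x) x = partial i ?c x * partial i u x + ?c x * partial i (partial i u) x" for i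
      using d by (simp add: partial_mult)
    note P = this[unfolded cutoff_radial(2)[OF R m]]
    have "?A x = (\<Sum>i\<in>UNIV. (partial i u x * partial i u x) * ?c x + (u x * ?c x) * partial i (partial i u) x
        + (- (2 * real m * u x * cut R (m - 1) x) / R\<^sup>2) * (partial i u x * x $ i))"
      by (intro sum.cong refl, simp only: P, simp add: algebra_simps)
    also have "\<dots> = ?I x"
      unfolding sum.distrib sum_distrib_left[symmetric] sum_distrib_right[symmetric]
      by (simp add: grad_sq_def laplacian_def drift_def mult_ac)
    finally show ?thesis .
  qed
  show "integral\<^sup>L (lebesgue_on S) ?I = 0"
    using A(2) integral_lebesgue_on_cong[of S ?A ?I, OF e] by simp
  show "integrable (lebesgue_on S) ?I"
    using A(1) by (rule Bochner_Integration.integrable_cong[THEN iffD1, rotated 2]) (use e in auto)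
qed

end

lemma cutoff_add: "cutoff R (a + b) y = cutoff R 1 y ^ a * cutoff R b y"
  and cutoff_add_double: "cutoff R (a + 2 * b) y = cutoff R 1 y ^ a * (cutoff R b y)\<^sup>2"
  by (simp_all add: cutoff_def power_add power_mult mult.commute[of 2] power_even_eq)

context stable_biharmonic
begin

lemma drift_bound:
  assumes R: "R > 0" and k: "cut R 1 x \<noteq> 0"
  shows "(drift R x)\<^sup>2 \<le> grad_sq x / R\<^sup>2"
proof -
  define v where "v = (\<chi> i. partial i u x)"
  have xR: "x \<bullet> x \<le> R\<^sup>2" using k cutoff_zero[OF R, of "x \<bullet> x" 1] by fastforce
  have "(v \<bullet> x)\<^sup>2 \<le> (v \<bullet> v) * (x \<bullet> x)" by (rule Cauchy_Schwarz_ineq)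
  also have "\<dots> \<le> (v \<bullet> v) * R\<^sup>2" using xR by (intro mult_left_mono) auto
  finally have "(v \<bullet> x)\<^sup>2 / (R\<^sup>2)\<^sup>2 \<le> (v \<bullet> v) * R\<^sup>2 / (R\<^sup>2)\<^sup>2" by (rule divide_right_mono) simp
  also have "\<dots> = (v \<bullet> v) / R\<^sup>2" using R by (simp add: power2_eq_square)
  finally show ?thesis by (simp add: drift_def grad_sq_def v_def inner_vec_def power_divide)
qed

text \<open>
  \<open>energy_stability\<close> minus \<open>energy_testing\<close> leaves \<open>p - 1\<close> times the integral of
  \<open>u\<^sup>p\<^sup>+\<^sup>1\<close> on the left; \<open>energy_testing\<close> alone bounds that of \<open>w\<^sup>2\<close>, and
  \<open>energy_gradient\<close> that of the gradient. That \<open>C\<close> does not depend on \<open>R\<close> is essential.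
\<close>

lemma energy_absorbed:
  assumes m: "m \<ge> 3"
  shows "\<exists>C\<ge>0. \<forall>R>0. (LINT x|lebesgue_on S. u x powr (p + 1) * cut R (2 * m) x) +
     (LINT x|lebesgue_on S. (w x)\<^sup>2 * cut R (2 * m) x) \<le>
     C * (LINT x|lebesgue_on S. (u x)\<^sup>2 / R^4 * cut R (2 * m - 4) x)"
proof -
  define M where "M = real m"
  define n where "n = real CARD('n)"
  have M: "1 \<le> M" and n: "0 \<le> n" using m by (auto simp: M_def n_def)
  define K where "K = 16 * M\<^sup>2 + (4 * M\<^sup>2 + 2 * n * M)\<^sup>2 + 8 * M * (4 * M\<^sup>2 + 2 * n * M) + (16 * M\<^sup>2 + 4 * n * M) + 8 * M"
  have K8: "8 * M \<le> K" unfolding K_def using M n by (simp add: add_nonneg_nonneg)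
  then have K: "K \<ge> 1" using M by linarith
  obtain C where C: "C \<ge> 0" "\<forall>A \<alpha> \<beta> \<gamma> ab ad bd. 0 \<le> A \<longrightarrow> 0 \<le> \<alpha> \<longrightarrow> 0 \<le> \<beta> \<longrightarrow> 0 \<le> \<gamma> \<longrightarrow>
     (\<forall>e>0. ab \<le> e * \<alpha> + \<beta> / (4 * e)) \<longrightarrow> (\<forall>e>0. bd \<le> e * \<beta> + \<gamma> / (4 * e)) \<longrightarrow>
     (\<forall>e>0. ad \<le> e * \<alpha> + \<gamma> / (4 * e)) \<longrightarrow>
     \<gamma> \<le> ab + K * bd \<longrightarrow> (p - 1) * A \<le> K * \<gamma> + K * \<beta> + K * bd + K * ab \<longrightarrow>
     \<alpha> \<le> A + K * ad + K * ab \<longrightarrow> A + \<alpha> \<le> C * \<beta>"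
    using quadratic_absorption[OF p K] by blast
  show ?thesis
  proof (intro exI[of _ C] conjI C(1) allI impI)
    fix R :: real assume R: "0 < R"
    define s where "s x = cut R 1 x" for x :: "real^'n"
    define t where "t x = cut R (m - 2) x" for x :: "real^'n"
    define D where "D = drift R"
    define G where "G x = grad_sq x / R\<^sup>2" for x
    have st: "0 \<le> s x" "s x \<le> 1" "0 \<le> t x" for x
      unfolding s_def t_def using cutoff_nonneg[OF R] cutoff_le_1[OF R] by auto
    have tz: "t x = 0" if "R\<^sup>2 \<le> x \<bullet> x" for x unfolding t_def using cutoff_zero[OF R that] m by simp
    have rho: "0 \<le> (x \<bullet> x) / R\<^sup>2" "(x \<bullet> x) / R\<^sup>2 * t x \<le> t x" for x
    proof -
      show "(x \<bullet> x) / R\<^sup>2 * t x \<le> t x"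
      proof (cases "R\<^sup>2 \<le> x \<bullet> x")
        case False
        then have "(x \<bullet> x) / R\<^sup>2 \<le> 1" using R by (simp add: divide_le_eq)
        then show ?thesis using st(3)[of x] mult_right_mono[of "(x \<bullet> x) / R\<^sup>2" 1 "t x"] by simp
      qed (simp add: tz)
    qed simp
    have Dst: "(D x)\<^sup>2 * ((s x)\<^sup>2 * (t x)\<^sup>2) \<le> G x * ((s x)\<^sup>2 * (t x)\<^sup>2)" for x
    proof (cases "s x = 0")
      case False
      then show ?thesis unfolding D_def G_def using drift_bound[OF R] by (intro mult_right_mono) (auto simp: s_def)
    qed simp
    have ex: "cut R m x = (s x)\<^sup>2 * t x" "cut R (m - 1) x = s x * t x"
      "cut R (2 * m) x = (s x)^4 * (t x)\<^sup>2" "cut R (2 * m - 1) x = (s x)^3 * (t x)\<^sup>2"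
      "cut R (2 * m - 2) x = (s x)\<^sup>2 * (t x)\<^sup>2" "cut R (2 * m - 3) x = s x * (t x)\<^sup>2"
      "cut R (2 * m - 4) x = (t x)\<^sup>2" for x
    proof -
      have "m = 2 + (m - 2)" "m - 1 = 1 + (m - 2)" "2 * m = 4 + 2 * (m - 2)" "2 * m - 1 = 3 + 2 * (m - 2)"
        "2 * m - 2 = 2 + 2 * (m - 2)" "2 * m - 3 = 1 + 2 * (m - 2)" "2 * m - 4 = 0 + 2 * (m - 2)" using m by auto
      then show "cut R m x = (s x)\<^sup>2 * t x" "cut R (m - 1) x = s x * t x"
        "cut R (2 * m) x = (s x)^4 * (t x)\<^sup>2" "cut R (2 * m - 1) x = (s x)^3 * (t x)\<^sup>2"
        "cut R (2 * m - 2) x = (s x)\<^sup>2 * (t x)\<^sup>2" "cut R (2 * m - 3) x = s x * (t x)\<^sup>2"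
        "cut R (2 * m - 4) x = (t x)\<^sup>2"
        unfolding s_def t_def using cutoff_add[of R _ "m - 2" "x \<bullet> x"] cutoff_add_double[of R _ "m - 2" "x \<bullet> x"]
        by (metis power_one_right power_0 mult_1)+
    qed
    define fA where "fA x = u x powr (p + 1) * ((s x)^4 * (t x)\<^sup>2)" for x
    define fa where "fa x = (w x)\<^sup>2 * ((s x)^4 * (t x)\<^sup>2)" for x
    define fb where "fb x = (u x)\<^sup>2 / R^4 * (t x)\<^sup>2" for x
    define fc where "fc x = G x * ((s x)\<^sup>2 * (t x)\<^sup>2)" for x
    define fab where "fab x = \<bar>w x\<bar> * u x / R\<^sup>2 * ((s x)\<^sup>2 * (t x)\<^sup>2)" for x
    define fbd where "fbd x = u x * \<bar>D x\<bar> / R\<^sup>2 * (s x * (t x)\<^sup>2)" for x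
    define fad where "fad x = \<bar>w x\<bar> * \<bar>D x\<bar> * ((s x)^3 * (t x)\<^sup>2)" for x
    define I where "I f = integral\<^sup>L (lebesgue_on S) f" for f :: "real^'n \<Rightarrow> real"
    note nice = Ck_bdd_bounded_mult[OF S] u_Ck_bdd w_Ck_bdd drift_Ck_bdd grad_sq_Ck_bdd abs_Ck_bdd Ck_bdd_const u_powr_Ck_bdd
    have iA: "integrable (lebesgue_on S) fA"
    proof -
      have "integrable (lebesgue_on S) (\<lambda>x. u x powr (p + 1) * cut R (2 * m) x)"
        using p m by (intro integrable_cutoff S R nice) auto
      then show ?thesis unfolding ex fA_def[abs_def] .
    qed
    have ia: "integrable (lebesgue_on S) fa"
    proof -
      have "integrable (lebesgue_on S) (\<lambda>x. (w x)\<^sup>2 * cut R (2 * m) x)"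
        unfolding power2_eq_square divide_inverse using p m by (intro integrable_cutoff S R nice) auto
      then show ?thesis unfolding ex fa_def[abs_def] .
    qed
    have ib: "integrable (lebesgue_on S) fb"
    proof -
      have "integrable (lebesgue_on S) (\<lambda>x. (u x)\<^sup>2 / R^4 * cut R (2 * m - 4) x)"
        unfolding power2_eq_square divide_inverse using p m by (intro integrable_cutoff S R nice) auto
      then show ?thesis unfolding ex fb_def[abs_def] .
    qed
    have ic: "integrable (lebesgue_on S) fc"
    proof -
      have "integrable (lebesgue_on S) (\<lambda>x. G x * cut R (2 * m - 2) x)"
        unfolding G_def power2_eq_square divide_inverse using p m by (intro integrable_cutoff S R nice) auto
      then show ?thesis unfolding ex fc_def[abs_def] .
    qed
    have iab: "integrable (lebesgue_on S) fab"
    proof -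
      have "integrable (lebesgue_on S) (\<lambda>x. \<bar>w x\<bar> * u x / R\<^sup>2 * cut R (2 * m - 2) x)"
        unfolding divide_inverse using p m by (intro integrable_cutoff S R nice) auto
      then show ?thesis unfolding ex fab_def[abs_def] .
    qed
    have ibd: "integrable (lebesgue_on S) fbd"
    proof -
      have "integrable (lebesgue_on S) (\<lambda>x. u x * \<bar>D x\<bar> / R\<^sup>2 * cut R (2 * m - 3) x)"
        unfolding D_def divide_inverse using p m by (intro integrable_cutoff S R nice) auto
      then show ?thesis unfolding ex fbd_def[abs_def] .
    qed
    have iad: "integrable (lebesgue_on S) fad"
    proof -
      have "integrable (lebesgue_on S) (\<lambda>x. \<bar>w x\<bar> * \<bar>D x\<bar> * cut R (2 * m - 1) x)"
        unfolding D_def using p m by (intro integrable_cutoff S R nice) auto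
      then show ?thesis unfolding ex fad_def[abs_def] .
    qed
    have up: "0 \<le> u x" if "x \<in> S" for x using solution_pos[OF that] by simp
    have Gn: "0 \<le> G x" for x unfolding G_def grad_sq_def by (intro divide_nonneg_nonneg sum_nonneg) auto
    have mono: "I f \<le> I g" if "integrable (lebesgue_on S) f" "integrable (lebesgue_on S) g" "\<And>x. x \<in> S \<Longrightarrow> f x \<le> g x" for f g
      unfolding I_def by (rule integral_mono) (use that in auto)
    have pos: "0 \<le> I f" if "\<And>x. x \<in> S \<Longrightarrow> 0 \<le> f x" for f
      unfolding I_def by (rule Bochner_Integration.integral_nonneg) (use that in auto)
    have yab: "I fab \<le> e * I fa + I fb / (4 * e)" if e: "0 < e" for e
    proof -
      have "I fab \<le> I (\<lambda>x. e * fa x + fb x / (4 * e))"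
      proof (rule mono)
        show "fab x \<le> e * fa x + fb x / (4 * e)" if "x \<in> S" for x
          using young[OF e, of "\<bar>w x\<bar> * ((s x)\<^sup>2 * t x)" "u x / R\<^sup>2 * t x"]
          by (simp add: fab_def fa_def fb_def power_mult_distrib power_divide power2_eq_square power4_eq_xxxx mult_ac)
      qed (use iab ia ib in auto)
      then show ?thesis using ia ib by (simp add: I_def)
    qed
    have ybd: "I fbd \<le> e * I fb + I fc / (4 * e)" if e: "0 < e" for e
    proof -
      have "I fbd \<le> I (\<lambda>x. e * fb x + fc x / (4 * e))"
      proof (rule mono)
        show "fbd x \<le> e * fb x + fc x / (4 * e)" if "x \<in> S" for x
        proof -
          have "fbd x \<le> e * fb x + (D x)\<^sup>2 * ((s x)\<^sup>2 * (t x)\<^sup>2) / (4 * e)"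
            using young[OF e, of "u x / R\<^sup>2 * t x" "\<bar>D x\<bar> * (s x * t x)"]
            by (simp add: fbd_def fb_def power_mult_distrib power_divide power2_eq_square power4_eq_xxxx mult_ac)
          also have "\<dots> \<le> e * fb x + fc x / (4 * e)"
            unfolding fc_def using Dst[of x] e by (intro add_left_mono divide_right_mono) auto
          finally show ?thesis .
        qed
      qed (use ibd ib ic in auto)
      then show ?thesis using ib ic by (simp add: I_def)
    qed
    have yad: "I fad \<le> e * I fa + I fc / (4 * e)" if e: "0 < e" for e
    proof -
      have "I fad \<le> I (\<lambda>x. e * fa x + fc x / (4 * e))"
      proof (rule mono)
        show "fad x \<le> e * fa x + fc x / (4 * e)" if "x \<in> S" for x
        proof -
          have "fad x \<le> e * fa x + (D x)\<^sup>2 * ((s x)\<^sup>2 * (t x)\<^sup>2) / (4 * e)"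
            using young[OF e, of "\<bar>w x\<bar> * ((s x)\<^sup>2 * t x)" "\<bar>D x\<bar> * (s x * t x)"]
            by (simp add: fad_def fa_def power_mult_distrib power2_eq_square power3_eq_cube power4_eq_xxxx mult_ac)
          also have "\<dots> \<le> e * fa x + fc x / (4 * e)"
            unfolding fc_def using Dst[of x] e by (intro add_left_mono divide_right_mono) auto
          finally show ?thesis .
        qed
      qed (use iad ia ic in auto)
      then show ?thesis using ia ic by (simp add: I_def)
    qed
    define l1 where "l1 x = (4 * (M * (M - 1)) * ((x \<bullet> x) / R\<^sup>2) * t x - 2 * n * M * (s x * t x)) / R\<^sup>2" for x
    define l2 where "l2 x = (4 * (2 * M * (2 * M - 1)) * ((x \<bullet> x) / R\<^sup>2) * ((s x)\<^sup>2 * (t x)\<^sup>2) - 2 * n * (2 * M) * ((s x)^3 * (t x)\<^sup>2)) / R\<^sup>2" for x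
    have m2: "2 * m \<ge> 3" "2 * m - 2 \<ge> 3" using m by auto
    have L1: "laplacian (\<lambda>x::real^'n. cut R m x) x = l1 x" for x
      unfolding cutoff_radial(3)[OF R m, of x] l1_def ex[of x] by (simp add: M_def n_def t_def)
    have L2: "laplacian (\<lambda>x::real^'n. cut R (2 * m) x) x = l2 x" for x
      unfolding cutoff_radial(3)[OF R m2(1), of x] l2_def ex[of x] by (simp add: M_def n_def)
    define I1 where "I1 x = (laplacian (\<lambda>x. u x * cut R m x) x)\<^sup>2" for x
    define I2 where "I2 x = w x * laplacian (\<lambda>x. u x * cut R (2 * m) x) x" for x
    have I1: "I1 x = (w x * ((s x)\<^sup>2 * t x) - 4 * M * (s x * t x) * D x + u x * l1 x)\<^sup>2" if "x \<in> S" for x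
      unfolding I1_def laplacian_u_cutoff[OF R m that] L1 D_def M_def ex[of x] ..
    have I2: "I2 x = w x * (w x * ((s x)^4 * (t x)\<^sup>2) - 8 * M * ((s x)^3 * (t x)\<^sup>2) * D x + u x * l2 x)" if "x \<in> S" for x
      unfolding I2_def laplacian_u_cutoff[OF R m2(1) that] L2 D_def M_def ex[of x] by simp
    have fA: "fA = (\<lambda>x. u x powr (p + 1) * cut R (2 * m) x)" by (simp add: fA_def ex fun_eq_iff)
    have E1: "p * I fA \<le> I I1" "integrable (lebesgue_on S) I1"
      unfolding I_def fA I1_def[abs_def] by (rule energy_stability[OF R m])+
    have E2: "I fA = I I2" "integrable (lebesgue_on S) I2"
      unfolding I_def fA I2_def[abs_def] by (rule energy_testing[OF R m2(1)])+
    define J where "J x = grad_sq x * ((s x)\<^sup>2 * (t x)\<^sup>2) + u x * w x * ((s x)\<^sup>2 * (t x)\<^sup>2) - 2 * real (2 * m - 2) * (u x * D x) * (s x * (t x)\<^sup>2)" for x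
    have m3: "2 * m - 2 - 1 = 2 * m - 3" by simp
    have E3: "I J = 0" "integrable (lebesgue_on S) J"
      using energy_gradient[OF R m2(2)] unfolding m3 ex I_def J_def[abs_def] D_def by simp_all
    have h1: "I fc \<le> I fab + K * I fbd"
    proof -
      have "I fc \<le> I (\<lambda>x. J x / R\<^sup>2 + fab x + K * fbd x)"
      proof (rule mono)
        fix x assume x: "x \<in> S"
        have "- (u x * w x * ((s x)\<^sup>2 * (t x)\<^sup>2)) \<le> \<bar>w x\<bar> * u x * ((s x)\<^sup>2 * (t x)\<^sup>2)"
          using up[OF x] abs_ge_minus_self[of "w x"] mult_right_mono[of "- w x" "\<bar>w x\<bar>" "u x * ((s x)\<^sup>2 * (t x)\<^sup>2)"]
          by (simp add: mult_ac)
        moreover have "2 * real (2 * m - 2) * (u x * D x) * (s x * (t x)\<^sup>2) \<le> K * (u x * \<bar>D x\<bar>) * (s x * (t x)\<^sup>2)"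
        proof -
          have "2 * real (2 * m - 2) \<le> K" using K8 m by (simp add: M_def of_nat_diff)
          then have "2 * real (2 * m - 2) * (u x * D x) \<le> K * (u x * \<bar>D x\<bar>)"
            using up[OF x] K abs_ge_self[of "D x"] 
            by (intro order_trans[OF mult_left_mono mult_right_mono]) (auto intro!: mult_left_mono)
          then show ?thesis using st[of x] by (intro mult_right_mono) auto
        qed
        ultimately have "grad_sq x * ((s x)\<^sup>2 * (t x)\<^sup>2) \<le> J x + \<bar>w x\<bar> * u x * ((s x)\<^sup>2 * (t x)\<^sup>2) + K * (u x * \<bar>D x\<bar>) * (s x * (t x)\<^sup>2)"
          unfolding J_def by linarith
        from divide_right_mono[OF this, of "R\<^sup>2"]
        show "fc x \<le> J x / R\<^sup>2 + fab x + K * fbd x"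
          by (simp add: fc_def fab_def fbd_def G_def add_divide_distrib)
      qed (use ic iab ibd E3 in auto)
      also have "\<dots> = I fab + K * I fbd" using E3 iab ibd by (simp add: I_def)
      finally show ?thesis .
    qed
    note pw = energy_pointwise[OF st(1) st(3) st(2) rho up R M n Dst, folded K_def l1_def l2_def]
    have h2: "(p - 1) * I fA \<le> K * I fc + K * I fb + K * I fbd + K * I fab"
    proof -
      have "(p - 1) * I fA \<le> I I1 - I I2" using E1(1) E2(1) by (simp add: left_diff_distrib)
      also have "\<dots> = I (\<lambda>x. I1 x - I2 x)" using E1 E2 by (simp add: I_def)
      also have "\<dots> \<le> I (\<lambda>x. K * fc x + K * fb x + K * fbd x + K * fab x)"
      proof (rule mono)
        show "I1 x - I2 x \<le> K * fc x + K * fb x + K * fbd x + K * fab x" if "x \<in> S" for x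
          using pw(1)[OF that, of "w x"] unfolding I1[OF that] I2[OF that] fc_def fb_def fbd_def fab_def .
      qed (use E1 E2 ic ib ibd iab in auto)
      also have "\<dots> = K * I fc + K * I fb + K * I fbd + K * I fab" using ic ib ibd iab by (simp add: I_def)
      finally show ?thesis .
    qed
    have h3: "I fa \<le> I fA + K * I fad + K * I fab"
    proof -
      have "I fa - I fA = I (\<lambda>x. fa x - I2 x)" using ia E2 by (simp add: I_def)
      also have "\<dots> \<le> I (\<lambda>x. K * fad x + K * fab x)"
      proof (rule mono)
        show "fa x - I2 x \<le> K * fad x + K * fab x" if "x \<in> S" for x
          using pw(2)[OF that, of "w x"] unfolding fa_def I2[OF that] fad_def fab_def .
      qed (use ia E2 iad iab in auto)
      also have "\<dots> = K * I fad + K * I fab" using iad iab by (simp add: I_def)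
      finally show ?thesis by simp
    qed
    have "I fA + I fa \<le> C * I fb"
      by (rule C(2)[rule_format, of "I fA" "I fa" "I fb" "I fc" "I fab" "I fbd" "I fad"])
        (use yab ybd yad h1 h2 h3 in \<open>auto intro!: pos simp: fA_def fa_def fb_def fc_def Gn\<close>)
    then show "(LINT x|lebesgue_on S. u x powr (p + 1) * cut R (2 * m) x) +
     (LINT x|lebesgue_on S. (w x)\<^sup>2 * cut R (2 * m) x) \<le>
     C * (LINT x|lebesgue_on S. (u x)\<^sup>2 / R^4 * cut R (2 * m - 4) x)"
      unfolding ex I_def fA_def[abs_def] fa_def[abs_def] fb_def[abs_def] .
  qed
qed

end

text \<open>
  With \<open>X = u\<^sup>p\<^sup>-\<^sup>1 s\<^sup>4\<close>, the first term on the right wins if \<open>X R\<^sup>4 \<ge> \<kappa>\<close>;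
  otherwise \<open>X \<le> \<kappa>\<close> bounds \<open>u\<^sup>2 s\<^sup>8\<^sup>/\<^sup>(\<^sup>p\<^sup>-\<^sup>1\<^sup>)\<close>, and the exponent of
  \<open>s\<close> is large enough for that to suffice.
\<close>

lemma energy_young_pointwise:
  fixes u s R \<kappa> p :: real and m :: nat
  assumes p: "p > 1" and m: "m \<ge> 3" "8 / (p - 1) \<le> real (2 * m - 4)" and u: "0 < u" and s: "0 \<le> s" "s \<le> 1"
    and R: "1 \<le> R" and k: "0 < \<kappa>"
  shows "u\<^sup>2 / R^4 * s ^ (2 * m - 4) \<le> (1 / \<kappa>) * (u powr (p + 1) * s ^ (2 * m)) + \<kappa> powr (2 / (p - 1)) / R^4"
proof (cases "s = 0")
  case True
  then show ?thesis using m(1) by (simp add: power_0_left)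
next
  case False
  then have s0: "0 < s" using s by simp
  have R0: "0 < R" using R by simp
  define X where "X = u powr (p - 1) * s^4"
  have X: "0 < X" using u s0 by (simp add: X_def)
  have e1: "u powr (p + 1) * s ^ (2 * m) = X * (u\<^sup>2 * s ^ (2 * m - 4))"
  proof -
    have "u powr (p + 1) = u powr (p - 1) * u\<^sup>2" using u powr_add[of u "p - 1" 2] by (simp add: powr_numeral add.commute)
    moreover have "s ^ (2 * m) = s^4 * s ^ (2 * m - 4)" using m(1) by (simp flip: power_add)
    ultimately show ?thesis by (simp add: X_def mult_ac)
  qed
  show ?thesis
  proof (cases "\<kappa> \<le> X * R^4")
    case True
    have "u\<^sup>2 / R^4 * s ^ (2 * m - 4) = (1 / \<kappa>) * ((\<kappa> / R^4) * (u\<^sup>2 * s ^ (2 * m - 4)))" using k by simp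
    also have "\<dots> \<le> (1 / \<kappa>) * (X * (u\<^sup>2 * s ^ (2 * m - 4)))"
      using True k R0 s by (intro mult_left_mono mult_right_mono) (auto simp: divide_le_eq)
    finally show ?thesis using e1 by (simp add: add_increasing2)
  next
    case False
    have "X * 1 \<le> X * R^4" using X R by (intro mult_left_mono one_le_power) auto
    then have Xk: "X \<le> \<kappa>" using False by simp
    have "u\<^sup>2 * s powr (8 / (p - 1)) = X powr (2 / (p - 1))"
    proof -
      have "X powr (2 / (p - 1)) = (u powr (p - 1)) powr (2 / (p - 1)) * (s^4) powr (2 / (p - 1))"
        unfolding X_def by (rule powr_mult)
      also have "(u powr (p - 1)) powr (2 / (p - 1)) = u powr 2"
      proof -
        have "(p - 1) * (2 / (p - 1)) = 2" using p by (simp add: field_simps)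
        then show ?thesis by (simp only: powr_powr)
      qed
      also have "u powr 2 = u\<^sup>2" using u by (simp add: powr_numeral)
      also have "(s^4) powr (2 / (p - 1)) = s powr (8 / (p - 1))"
      proof -
        have "s^4 = s powr 4" using s0 by (simp add: powr_numeral)
        moreover have "4 * (2 / (p - 1)) = 8 / (p - 1)" by simp
        ultimately show ?thesis by (simp only: powr_powr)
      qed
      finally show ?thesis by simp
    qed
    also have "\<dots> \<le> \<kappa> powr (2 / (p - 1))" using Xk X p by (intro powr_mono2) auto
    finally have 1: "u\<^sup>2 * s powr (8 / (p - 1)) \<le> \<kappa> powr (2 / (p - 1))" .
    have "s ^ (2 * m - 4) = s powr (real (2 * m - 4))" using s0 by (simp add: powr_realpow)
    also have "\<dots> \<le> s powr (8 / (p - 1))" using m(2) s0 s by (intro powr_mono') auto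
    finally have "u\<^sup>2 * s ^ (2 * m - 4) \<le> u\<^sup>2 * s powr (8 / (p - 1))" by (intro mult_left_mono) auto
    with 1 have "u\<^sup>2 * s ^ (2 * m - 4) \<le> \<kappa> powr (2 / (p - 1))" by simp
    from divide_right_mono[OF this, of "R^4"]
    have "u\<^sup>2 / R^4 * s ^ (2 * m - 4) \<le> \<kappa> powr (2 / (p - 1)) / R^4" by simp
    also have "\<dots> \<le> (1 / \<kappa>) * (u powr (p + 1) * s ^ (2 * m)) + \<kappa> powr (2 / (p - 1)) / R^4"
      using k s by simp
    finally show ?thesis .
  qed
qed

context stable_biharmonic
begin

text \<open>
  Young's inequality returns half of the left-hand side of \<open>energy_absorbed\<close> and a multiple of the
  volume of the ball times \<open>R\<^sup>-\<^sup>4\<close>. Any bound of order less than \<open>R\<^sup>N\<close> serves the Liouville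
  argument.
\<close>

lemma energy_growth:
  "\<exists>C m. C \<ge> 0 \<and> 1 \<le> m \<and> (\<forall>R\<ge>1. integrable (lebesgue_on S) (\<lambda>x. (u x powr (p + 1) + (w x)\<^sup>2) * cut R m x) \<and>
     (LINT x|lebesgue_on S. (u x powr (p + 1) + (w x)\<^sup>2) * cut R m x) \<le> C * (R ^ CARD('n) / R^4))"
proof -
  obtain m0 :: nat where m0: "2 + 8 / (p - 1) < real m0" using reals_Archimedean2 by blast
  \<comment> \<open>then \<open>2 m - 4\<close> exceeds \<open>8 / (p - 1)\<close>, as \<open>energy_young_pointwise\<close> requires\<close>
  define m where "m = m0 + 3"
  have "real (2 * m - 4) = 2 * real m0 + 2" by (simp add: m_def of_nat_diff)
  moreover have "0 \<le> 8 / (p - 1)" using p by simp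
  ultimately have m: "m \<ge> 3" "8 / (p - 1) \<le> real (2 * m - 4)" using m0 by (auto simp: m_def)
  obtain C where C: "C \<ge> 0" "\<And>R. R > 0 \<Longrightarrow> (LINT x|lebesgue_on S. u x powr (p + 1) * cut R (2 * m) x) +
     (LINT x|lebesgue_on S. (w x)\<^sup>2 * cut R (2 * m) x) \<le>
     C * (LINT x|lebesgue_on S. (u x)\<^sup>2 / R^4 * cut R (2 * m - 4) x)"
    using energy_absorbed[OF m(1)] by blast
  \<comment> \<open>makes \<open>C / \<kappa>\<close> at most \<open>1 / 2\<close>\<close>
  define \<kappa> where "\<kappa> = 2 * C + 1"
  have k: "\<kappa> > 0" using C by (simp add: \<kappa>_def)
  define V where "V = unit_ball_vol (real CARD('n))"
  define B where "B = 2 * C * \<kappa> powr (2 / (p - 1)) * V"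
  have V: "V \<ge> 0" by (simp add: V_def)
  note nice = Ck_bdd_bounded_mult[OF S] u_Ck_bdd w_Ck_bdd Ck_bdd_const u_powr_Ck_bdd
  have "integrable (lebesgue_on S) (\<lambda>x. (u x powr (p + 1) + (w x)\<^sup>2) * cut R (2 * m) x) \<and>
     (LINT x|lebesgue_on S. (u x powr (p + 1) + (w x)\<^sup>2) * cut R (2 * m) x) \<le> B * (R ^ CARD('n) / R^4)"
    if R: "1 \<le> R" for R
  proof -
    have R0: "0 < R" using R by simp
    have iA: "integrable (lebesgue_on S) (\<lambda>x. u x powr (p + 1) * cut R (2 * m) x)"
      using p m by (intro integrable_cutoff S R0 nice) auto
    have ia: "integrable (lebesgue_on S) (\<lambda>x. (w x)\<^sup>2 * cut R (2 * m) x)"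
      unfolding power2_eq_square using p m by (intro integrable_cutoff S R0 nice) auto
    have ib: "integrable (lebesgue_on S) (\<lambda>x. (u x)\<^sup>2 / R^4 * cut R (2 * m - 4) x)"
      unfolding power2_eq_square divide_inverse using p m by (intro integrable_cutoff S R0 nice) auto
    have ii: "integrable (lebesgue_on S) (\<lambda>x. c * indicat_real (cball 0 R) x)" for c
      by (rule integrable_indicator_cball[OF open_sets_lebesgue[OF S]])
    define A where "A = (LINT x|lebesgue_on S. u x powr (p + 1) * cut R (2 * m) x)"
    define a where "a = (LINT x|lebesgue_on S. (w x)\<^sup>2 * cut R (2 * m) x)"
    define b where "b = (LINT x|lebesgue_on S. (u x)\<^sup>2 / R^4 * cut R (2 * m - 4) x)"
    define c where "c = \<kappa> powr (2 / (p - 1)) / R^4"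
    have c0: "0 \<le> c" by (simp add: c_def)
    have vol: "(LINT x|lebesgue_on S. c * indicat_real (cball 0 R) x) \<le> c * (V * R ^ CARD('n))"
    proof -
      have "(LINT x|lebesgue_on S. c * indicat_real (cball 0 R) x) = (LINT x|lebesgue. indicat_real S x * (c * indicat_real (cball 0 R) x))"
        using open_sets_lebesgue[OF S] by (subst integral_restrict_space) auto
      also have "\<dots> \<le> (LINT x|lebesgue. c * indicat_real (cball (0::real^'n) R) x)"
      proof (rule integral_mono)
        show "integrable lebesgue (\<lambda>x. c * indicat_real (cball (0::real^'n) R) x)"
          using integrable_indicator_cball[of UNIV c 0 R] by (simp add: lebesgue_on_UNIV_eq)
        show "integrable lebesgue (\<lambda>x. indicat_real S x * (c * indicat_real (cball 0 R) x))"
          using ii[of c] open_sets_lebesgue[OF S] by (subst (asm) integrable_restrict_space) auto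
      qed (use c0 in \<open>auto simp: indicator_def\<close>)
      also have "\<dots> = c * measure lebesgue (cball (0::real^'n) R)" by simp
      also have "measure lebesgue (cball (0::real^'n) R) = V * R ^ CARD('n)"
        using content_cball[of R "0::real^'n"] R0 by (simp add: V_def)
      finally show ?thesis .
    qed
    have "b \<le> (LINT x|lebesgue_on S. (1 / \<kappa>) * (u x powr (p + 1) * cut R (2 * m) x) + c * indicat_real (cball 0 R) x)"
      unfolding b_def
    proof (rule integral_mono)
      fix x assume "x \<in> space (lebesgue_on S)"
      then have x: "x \<in> S" by simp
      show "(u x)\<^sup>2 / R^4 * cut R (2 * m - 4) x \<le>
        (1 / \<kappa>) * (u x powr (p + 1) * cut R (2 * m) x) + c * indicat_real (cball 0 R) x"
      proof (cases "x \<in> cball 0 R")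
        case True
        then have "indicat_real (cball 0 R) x = 1" by simp
        then show ?thesis
          using energy_young_pointwise[OF p m solution_pos[OF x] cutoff_nonneg[OF R0] cutoff_le_1[OF R0 inner_ge_zero] R k, of 1 x]
          unfolding cutoff_power[OF R0, symmetric] c_def by (simp only: mult_1_right)
      next
        case False
        have "2 * m - 4 \<ge> 1" "2 * m \<ge> 1" using m(1) by auto
        then show ?thesis using cutoff_outside[OF R0 _ False] False by simp
      qed
    qed (use ib iA ii in auto)
    also have "\<dots> \<le> (1 / \<kappa>) * A + c * (V * R ^ CARD('n))" using iA ii vol by (simp add: A_def)
    finally have b: "b \<le> (1 / \<kappa>) * A + c * (V * R ^ CARD('n))" .
    have An: "0 \<le> A" "0 \<le> a" unfolding A_def a_def using cutoff_nonneg[OF R0]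
      by (auto intro!: Bochner_Integration.integral_nonneg mult_nonneg_nonneg)
    have "A + a \<le> C * b" using C(2)[OF R0] by (simp add: A_def a_def b_def)
    also have "\<dots> \<le> C * ((1 / \<kappa>) * A + c * (V * R ^ CARD('n)))" using b C(1) by (rule mult_left_mono)
    also have "\<dots> \<le> A / 2 + C * (c * (V * R ^ CARD('n)))"
    proof -
      have "C / \<kappa> * A \<le> 1 / 2 * A" using An C(1) by (intro mult_right_mono) (auto simp: \<kappa>_def divide_simps)
      then show ?thesis by (simp add: distrib_left)
    qed
    finally have "A + a \<le> 2 * (C * (c * (V * R ^ CARD('n))))" using An by simp
    also have "\<dots> = B * (R ^ CARD('n) / R^4)" by (simp add: B_def c_def)
    finally have "A + a \<le> B * (R ^ CARD('n) / R^4)" .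
    then show ?thesis using iA ia by (simp add: A_def a_def distrib_right)
  qed
  moreover have "B \<ge> 0" using C V by (simp add: B_def)
  moreover have "1 \<le> 2 * m" using m by simp
  ultimately show ?thesis by blast
qed

end

section \<open>A compactly supported barrier\<close>

text \<open>
  Let \<open>\<Phi> = (1 + |x|\<^sup>2)\<^sup>-\<^sup>a\<close>, a superharmonic function, and \<open>e\<close> its value on the sphere of
  radius \<open>R\<close>. The barrier is \<open>e soft (\<Phi> / e - 1)\<close>, which cuts \<open>\<Phi>\<close> off at that sphere.
  The Laplacian of \<open>\<Phi>\<close> is \<open>- 2 N a (1 + |x|\<^sup>2)\<^sup>-\<^sup>a\<^sup>-\<^sup>2\<close>; well inside the ball at
  least half of it survives, and the convexity of \<open>soft\<close> costs a term of order \<open>R\<^sup>-\<^sup>N\<close>, as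
  \<open>soft''\<close> decays like the inverse cube and \<open>2 a + 2 = N\<close>.
\<close>

lemma barrier:
  fixes a R :: real
  assumes a: "a = (real CARD('n::finite) - 2) / 2" "1 \<le> a" and R: "0 < R"
  shows "\<exists>\<psi> :: real^'n \<Rightarrow> real. Ck_on 2 UNIV \<psi> \<and> (\<forall>x. 0 \<le> \<psi> x) \<and> (\<forall>x. x \<notin> cball 0 R \<longrightarrow> \<psi> x = 0) \<and>
    (\<forall>x \<in> cball 0 R. laplacian \<psi> x \<le> 24 * a\<^sup>2 * (1 + R\<^sup>2) powr (- a - 1)) \<and>
    (\<forall>r x. x \<in> cball 0 r \<longrightarrow> 6 * (1 + r\<^sup>2) \<le> 1 + R\<^sup>2 \<longrightarrow>
      laplacian \<psi> x \<le> - (real CARD('n) * a * (1 + r\<^sup>2) powr (- a - 2)) + 24 * a\<^sup>2 * (1 + R\<^sup>2) powr (- a - 1))"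
proof -
  define N where "N = real CARD('n)"
  have N: "N = 2 * a + 2" using a(1) by (simp add: N_def)
  define Y where "Y = 1 + R\<^sup>2"
  have Y: "1 \<le> Y" by (simp add: Y_def)
  define e where "e = Y powr (- a)"
  have e: "0 < e" using Y by (simp add: e_def)
  define \<sigma> where "\<sigma> t = (1 + t) powr (- a) / e" for t :: real
  define g where "g t = e * soft (\<sigma> t - 1)" for t
  define g' where "g' t = - a * (1 + t) powr (- a - 1) * soft' (\<sigma> t - 1)" for t
  define g'' where "g'' t = a * (a + 1) * (1 + t) powr (- a - 2) * soft' (\<sigma> t - 1)
     + a\<^sup>2 * ((1 + t) powr (- a - 1))\<^sup>2 / e * soft'' (\<sigma> t - 1)" for t
  have d: "(\<sigma> has_real_derivative - a * (1 + t) powr (- a - 1) / e) (at t)" if "0 \<le> t" for t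
    unfolding \<sigma>_def[abs_def] using that
    by (intro DERIV_cdivide) (auto intro!: derivative_eq_intros simp: powr_diff)
  have d1: "((\<lambda>t. \<sigma> t - 1) has_real_derivative - a * (1 + t) powr (- a - 1) / e) (at t)" if "0 \<le> t" for t
    using DERIV_diff[OF d[OF that] DERIV_const] by simp
  have 1: "(g has_real_derivative g' t) (at t)" if "0 \<le> t" for t
    using DERIV_cmult[OF DERIV_chain2[OF soft_deriv d1[OF that]], of e] e
    by (simp add: g_def[abs_def] g'_def mult_ac)
  have d2: "((\<lambda>t. - a * (1 + t) powr (- a - 1)) has_real_derivative a * (a + 1) * (1 + t) powr (- a - 2)) (at t)" if "0 \<le> t" for t
  proof -
    have "((\<lambda>t. 1 + t) has_real_derivative 0 + 1) (at t)" by (intro DERIV_add DERIV_const DERIV_ident)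
    moreover have "((\<lambda>z. z powr (- a - 1)) has_real_derivative (- a - 1) * (1 + t) powr (- a - 1 - 1)) (at (1 + t))"
      by (rule has_real_derivative_powr) (use that in simp)
    ultimately have "((\<lambda>t. (1 + t) powr (- a - 1)) has_real_derivative (- a - 1) * (1 + t) powr (- a - 1 - 1) * (0 + 1)) (at t)"
      by (rule DERIV_chain2[rotated])
    from DERIV_cmult[OF this, of "- a"] show ?thesis by (simp add: algebra_simps)
  qed
  have 2: "(g' has_real_derivative g'' t) (at t)" if "0 \<le> t" for t
    using DERIV_mult[OF d2[OF that] DERIV_chain2[OF soft'_deriv d1[OF that]]] e
    by (simp add: g'_def[abs_def] g''_def power2_eq_square mult_ac)
  have 3: "continuous_on {0..} g''"
  proof -
    have c: "continuous_on {0..} (\<lambda>t::real. (1 + t) powr b)" for b by (intro continuous_intros) auto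
    have cs: "continuous_on {0..} (\<lambda>t. \<sigma> t - 1)" unfolding \<sigma>_def divide_inverse by (intro continuous_intros c)
    have "continuous_on UNIV soft'"
      by (rule DERIV_continuous_on[of UNIV soft' soft'']) (auto intro: has_field_derivative_at_within soft'_deriv)
    from continuous_on_compose2[OF this cs] have c1: "continuous_on {0..} (\<lambda>t. soft' (\<sigma> t - 1))" by simp
    from continuous_on_compose2[OF continuous_soft''[of UNIV] cs] have c2: "continuous_on {0..} (\<lambda>t. soft'' (\<sigma> t - 1))" by simp
    show ?thesis unfolding g''_def[abs_def] divide_inverse by (intro continuous_intros c c1 c2)
  qed
  define \<psi> where "\<psi> = (\<lambda>x::real^'n. g (x \<bullet> x))"
  have sig: "\<sigma> t \<le> 1 \<longleftrightarrow> Y \<le> 1 + t" if "0 \<le> t" for t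
  proof -
    have "\<sigma> t \<le> 1 \<longleftrightarrow> (1 + t) powr (- a) \<le> Y powr (- a)" using e by (simp add: \<sigma>_def divide_le_eq e_def)
    also have "\<dots> \<longleftrightarrow> Y powr a \<le> (1 + t) powr a" using that Y by (simp add: powr_minus inverse_le_iff_le)
    also have "\<dots> \<longleftrightarrow> Y \<le> 1 + t" using that Y a(2) powr_mono2[of a Y "1 + t"] powr_less_mono2[of a "1 + t" Y] by (auto simp: not_le[symmetric])
    finally show ?thesis .
  qed
  have lap: "laplacian \<psi> x = - (2 * N * a * (1 + x \<bullet> x) powr (- a - 2) * soft' (\<sigma> (x \<bullet> x) - 1))
     + 4 * (x \<bullet> x) * (a\<^sup>2 * ((1 + x \<bullet> x) powr (- a - 1))\<^sup>2 / e * soft'' (\<sigma> (x \<bullet> x) - 1))" for x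
  proof -
    define t where "t = x \<bullet> x"
    have t: "0 \<le> t" by (simp add: t_def)
    have q: "(1 + t) powr (- a - 1) = (1 + t) * (1 + t) powr (- a - 2)"
    proof -
      have "1 + (- a - 2) = - a - 1" by simp
      from powr_add[of "1 + t" 1 "- a - 2", unfolded this] show ?thesis using t by simp
    qed
    have "laplacian \<psi> x = 4 * t * g'' t + 2 * N * g' t"
      unfolding \<psi>_def N_def t_def by (rule radial_laplacian[OF 1 2 3])
    then show ?thesis
      unfolding t_def[symmetric] g'_def g''_def q N by (simp add: algebra_simps)
  qed
  have sec: "4 * t * (a\<^sup>2 * ((1 + t) powr (- a - 1))\<^sup>2 / e * soft'' (\<sigma> t - 1)) \<le> 24 * a\<^sup>2 * Y powr (- a - 1)"
    if t: "0 \<le> t" "1 + t \<le> Y" for t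
  proof -
    define y where "y = 1 + t"
    have y: "1 \<le> y" "y \<le> Y" "t \<le> y" using t by (auto simp: y_def)
    have s1: "1 \<le> \<sigma> t"
    proof -
      have "Y powr (- a) \<le> y powr (- a)" using y a(2) by (intro powr_mono2') auto
      then show ?thesis using e by (simp add: \<sigma>_def e_def y_def)
    qed
    have "soft'' (\<sigma> t - 1) \<le> 6 / (1 + (\<sigma> t - 1))^3" by (rule soft''_le) (use s1 in simp)
    then have "soft'' (\<sigma> t - 1) \<le> 6 / (\<sigma> t)^3" by simp
    then have "4 * t * (a\<^sup>2 * (y powr (- a - 1))\<^sup>2 / e * soft'' (\<sigma> t - 1)) \<le> 4 * y * (a\<^sup>2 * (y powr (- a - 1))\<^sup>2 / e * (6 / (\<sigma> t)^3))"
      using t y e by (intro mult_mono mult_left_mono) (auto simp: soft_nonneg)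
    also have "\<dots> = 24 * a\<^sup>2 * (y powr 1 * (y powr (- a - 1))\<^sup>2 * e\<^sup>2 * y powr (3 * a))"
    proof -
      have "(\<sigma> t)^3 = y powr (- 3 * a) / e^3"
        using y by (simp add: \<sigma>_def y_def power_divide powr_powr mult.commute flip: powr_realpow)
      then have "6 / (\<sigma> t)^3 = 6 * e^3 * y powr (3 * a)" using y by (simp add: powr_minus field_simps)
      then show ?thesis using e y by (simp add: power2_eq_square power3_eq_cube)
    qed
    also have "\<dots> = 24 * a\<^sup>2 * (e\<^sup>2 * y powr (a - 1))"
    proof -
      have "y powr 1 * (y powr (- a - 1))\<^sup>2 * y powr (3 * a) = y powr (1 + (- a - 1) + (- a - 1) + 3 * a)"
        by (simp only: powr_add power2_eq_square mult_ac)
      then show ?thesis by (simp add: mult_ac)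
    qed
    also have "\<dots> \<le> 24 * a\<^sup>2 * (e\<^sup>2 * Y powr (a - 1))"
      using y a(2) by (intro mult_left_mono powr_mono2) auto
    also have "e\<^sup>2 * Y powr (a - 1) = Y powr (- a - 1)"
    proof -
      have "e\<^sup>2 * Y powr (a - 1) = Y powr (- a + - a + (a - 1))" by (simp only: e_def powr_add power2_eq_square)
      then show ?thesis by simp
    qed
    finally show ?thesis by (simp add: y_def)
  qed
  have fst: "0 \<le> 2 * N * a * (1 + x \<bullet> x) powr (- a - 2) * soft' (\<sigma> (x \<bullet> x) - 1)" for x :: "real^'n"
    using N a(2) by (simp add: soft_nonneg)
  have ball: "x \<bullet> x \<le> \<rho>\<^sup>2" if "x \<in> cball 0 \<rho>" for x :: "real^'n" and \<rho>
    using that power_mono[of "norm x" \<rho> 2] by (simp add: power2_norm_eq_inner)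
  show ?thesis
  proof (intro exI[of _ \<psi>] conjI allI ballI impI)
    show "Ck_on 2 UNIV \<psi>" unfolding \<psi>_def by (rule radial_Ck_on[OF 1 2 3])
    show "0 \<le> \<psi> x" for x using e by (simp add: \<psi>_def g_def soft_nonneg)
    show "\<psi> x = 0" if "x \<notin> cball 0 R" for x
    proof -
      have "R\<^sup>2 \<le> x \<bullet> x" using that R power_mono[of R "norm x" 2] by (simp add: power2_norm_eq_inner)
      then have "\<sigma> (x \<bullet> x) \<le> 1" using sig[of "x \<bullet> x"] by (simp add: Y_def)
      then show ?thesis by (simp add: \<psi>_def g_def)
    qed
    show "laplacian \<psi> x \<le> 24 * a\<^sup>2 * (1 + R\<^sup>2) powr (- a - 1)" if "x \<in> cball 0 R" for x
    proof -
      have "1 + x \<bullet> x \<le> Y" using ball[OF that] by (simp add: Y_def)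
      from sec[OF inner_ge_zero this] fst[of x] show ?thesis unfolding lap Y_def[symmetric] by linarith
    qed
    fix r :: real and x :: "real^'n" assume x: "x \<in> cball 0 r" and r: "6 * (1 + r\<^sup>2) \<le> 1 + R\<^sup>2"
    define t where "t = x \<bullet> x"
    have t: "0 \<le> t" "1 + t \<le> 1 + r\<^sup>2" using ball[OF x] by (auto simp: t_def)
    have tY: "6 * (1 + t) \<le> Y" using order_trans[OF mult_left_mono[OF t(2), of 6] r] unfolding Y_def by simp
    have "6 \<le> \<sigma> t"
    proof -
      have "6 * (1 + t) powr a \<le> 6 powr a * (1 + t) powr a"
        using a(2) powr_mono[of 1 a 6] by (intro mult_right_mono) auto
      also have "\<dots> = (6 * (1 + t)) powr a" by (rule powr_mult[symmetric])
      also have "\<dots> \<le> Y powr a" using tY t a(2) by (intro powr_mono2) auto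
      finally show ?thesis using t Y by (simp add: \<sigma>_def e_def powr_minus field_simps)
    qed
    then have "1 - 3 / (1 + (\<sigma> t - 1)) \<le> soft' (\<sigma> t - 1)" by (intro soft'_ge) simp
    moreover have "3 / (1 + (\<sigma> t - 1)) \<le> 1 / 2" using \<open>6 \<le> \<sigma> t\<close> by (simp add: divide_simps)
    ultimately have s: "1 / 2 \<le> soft' (\<sigma> t - 1)" by linarith
    have "N * a * (1 + r\<^sup>2) powr (- a - 2) \<le> N * a * (1 + t) powr (- a - 2)"
      using N a(2) t by (intro mult_left_mono powr_mono2') auto
    also have "\<dots> = 2 * N * a * (1 + t) powr (- a - 2) * (1 / 2)" by simp
    also have "\<dots> \<le> 2 * N * a * (1 + t) powr (- a - 2) * soft' (\<sigma> t - 1)"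
      using N a(2) s by (intro mult_left_mono) auto
    finally have "N * a * (1 + r\<^sup>2) powr (- a - 2) \<le> 2 * N * a * (1 + t) powr (- a - 2) * soft' (\<sigma> t - 1)" .
    moreover have "1 + t \<le> Y" by (rule order_trans[OF _ tY]) (use t(1) in simp)
    ultimately show "laplacian \<psi> x \<le> - (real CARD('n) * a * (1 + r\<^sup>2) powr (- a - 2)) + 24 * a\<^sup>2 * (1 + R\<^sup>2) powr (- a - 1)"
      using sec[OF t(1)] unfolding lap t_def[symmetric] Y_def[symmetric] N_def[symmetric] by linarith
  qed
qed

section \<open>The comparison function\<close>

lemma Ck_on_2D:
  assumes "Ck_on 2 S f"
  shows "x \<in> S \<Longrightarrow> f differentiable (at x)" "x \<in> S \<Longrightarrow> partial i f differentiable (at x)" "continuous_on S f"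
    "Ck_on 1 S (partial i f)" "Ck_on 1 S f" "continuous_on S (partial i (partial i f))" "continuous_on S (laplacian f)"
proof -
  show "x \<in> S \<Longrightarrow> f differentiable (at x)" "x \<in> S \<Longrightarrow> partial i f differentiable (at x)" "continuous_on S f"
    "Ck_on 1 S (partial i f)"
    using assms unfolding numeral_2_eq_2 One_nat_def Ck_on_Suc by auto
  show "Ck_on 1 S f" by (rule Ck_on_mono[OF assms]) simp
  have c: "continuous_on S (partial i (partial i f))" for i using assms unfolding numeral_2_eq_2 Ck_on_Suc Ck_on_0 by auto
  then show "continuous_on S (partial i (partial i f))" .
  show "continuous_on S (laplacian f)" unfolding laplacian_def[abs_def] by (intro continuous_on_sum c)
qed

lemma laplacian_compose:
  fixes f :: "real^'n::finite \<Rightarrow> real"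
  assumes S: "open S" and f: "Ck_on 2 S f" and x: "x \<in> S"
    and G: "\<And>x. x \<in> S \<Longrightarrow> (G has_real_derivative G' (f x)) (at (f x))"
      "\<And>x. x \<in> S \<Longrightarrow> (G' has_real_derivative G'' (f x)) (at (f x))"
  shows "laplacian (\<lambda>x. G (f x)) x = G'' (f x) * (\<Sum>i\<in>UNIV. (partial i f x)\<^sup>2) + G' (f x) * laplacian f x"
proof -
  note d = Ck_on_2D(1,2)[OF f]
  have "partial i (partial i (\<lambda>x. G (f x))) x = G'' (f x) * (partial i f x)\<^sup>2 + G' (f x) * partial i (partial i f) x" for i
  proof -
    have "partial i (partial i (\<lambda>x. G (f x))) x = partial i (\<lambda>x. G' (f x) * partial i f x) x"
      by (rule partial_cong_open[OF S x]) (rule partial_compose[OF d(1) G(1)])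
    also have "\<dots> = partial i (\<lambda>x. G' (f x)) x * partial i f x + G' (f x) * partial i (partial i f) x"
      by (rule partial_mult[OF differentiable_compose_real[OF d(1)[OF x] G(2)[OF x]] d(2)[OF x]])
    finally show ?thesis by (simp add: partial_compose[OF d(1)[OF x] G(2)[OF x]] power2_eq_square)
  qed
  then show ?thesis by (simp add: laplacian_def sum.distrib sum_distrib_left)
qed

lemma laplacian_add:
  fixes f :: "real^'n::finite \<Rightarrow> real"
  assumes S: "open S" and f: "Ck_on 2 S f" and g: "Ck_on 2 S g" and x: "x \<in> S"
  shows "laplacian (\<lambda>x. f x + g x) x = laplacian f x + laplacian g x"
proof -
  have "partial i (partial i (\<lambda>x. f x + g x)) x = partial i (partial i f) x + partial i (partial i g) x" for i
  proof -
    have "partial i (partial i (\<lambda>x. f x + g x)) x = partial i (\<lambda>x. partial i f x + partial i g x) x"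
      by (rule partial_cong_open[OF S x]) (rule partial_add[OF Ck_on_2D(1)[OF f] Ck_on_2D(1)[OF g]])
    also have "\<dots> = partial i (partial i f) x + partial i (partial i g) x"
      by (rule partial_add[OF Ck_on_2D(2)[OF f x] Ck_on_2D(2)[OF g x]])
    finally show ?thesis .
  qed
  then show ?thesis by (simp add: laplacian_def sum.distrib)
qed

text \<open>
  The field \<open>F \<nabla>\<psi> - \<psi> \<nabla>F\<close> vanishes outside the compact set \<open>C\<close>, so its divergence
  integrates to 0.
\<close>

lemma laplacian_self_adjoint:
  fixes F \<psi> :: "real^'n::finite \<Rightarrow> real"
  assumes S: "open S" and F: "Ck_on 2 S F" and \<psi>: "Ck_on 2 S \<psi>" and C: "compact C" "C \<subseteq> S"
    and z: "\<And>x. x \<in> S - C \<Longrightarrow> F x = 0 \<or> \<psi> x = 0" "\<And>x i. x \<in> S - C \<Longrightarrow> F x = 0 \<or> partial i \<psi> x = 0"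
      "\<And>x i. x \<in> S - C \<Longrightarrow> partial i F x = 0 \<or> \<psi> x = 0"
      "\<And>x. x \<in> S - C \<Longrightarrow> F x = 0 \<or> laplacian \<psi> x = 0"
      "\<And>x. x \<in> S - C \<Longrightarrow> laplacian F x = 0 \<or> \<psi> x = 0"
  shows "integrable (lebesgue_on S) (\<lambda>x. F x * laplacian \<psi> x)" "integrable (lebesgue_on S) (\<lambda>x. laplacian F x * \<psi> x)"
    "(LINT x|lebesgue_on S. F x * laplacian \<psi> x) = (LINT x|lebesgue_on S. laplacian F x * \<psi> x)"
proof -
  note Fd = Ck_on_2D[OF F] and pd = Ck_on_2D[OF \<psi>]
  show i1: "integrable (lebesgue_on S) (\<lambda>x. F x * laplacian \<psi> x)"
    by (rule integrable_continuous_compact_support[OF S _ C]) (use z(4) in \<open>auto intro!: continuous_intros Fd(3) pd(7)\<close>)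
  show i2: "integrable (lebesgue_on S) (\<lambda>x. laplacian F x * \<psi> x)"
    by (rule integrable_continuous_compact_support[OF S _ C]) (use z(5) in \<open>auto intro!: continuous_intros Fd(7) pd(3)\<close>)
  define h where "h i x = F x * partial i \<psi> x - partial i F x * \<psi> x" for i x
  have h1: "Ck_on 1 S (h i)" for i
    unfolding h_def[abs_def] by (intro Ck_on_diff Ck_on_mult S Fd(4,5) pd(4,5))
  have h0: "h i x = 0" if "x \<in> S" "x \<notin> C" for i x
    using z(2)[of x i] z(3)[of x i] that by (auto simp: h_def)
  have "integral\<^sup>L (lebesgue_on S) (partial i (h i)) = 0" for i
    by (rule integral_partial_compact_support[OF S h1 C h0])
  moreover have hi: "integrable (lebesgue_on S) (partial i (h i))" for i
  proof (rule integrable_continuous_compact_support[OF S _ C])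
    show "continuous_on S (partial i (h i))" using h1[of i] unfolding One_nat_def Ck_on_Suc Ck_on_0 by blast
    show "partial i (h i) x = 0" if "x \<in> S" "x \<notin> C" for x
      by (rule partial_zero_outside_compact[OF S C(1) h0 that])
  qed
  ultimately have "(LINT x|lebesgue_on S. (\<Sum>i\<in>UNIV. partial i (h i) x)) = 0"
    by (subst Bochner_Integration.integral_sum[OF hi]) simp
  also have "(LINT x|lebesgue_on S. (\<Sum>i\<in>UNIV. partial i (h i) x)) = (LINT x|lebesgue_on S. F x * laplacian \<psi> x - laplacian F x * \<psi> x)"
  proof (rule integral_lebesgue_on_cong)
    fix x assume x: "x \<in> S"
    have "partial i (h i) x = F x * partial i (partial i \<psi>) x - partial i (partial i F) x * \<psi> x" for i
      unfolding h_def[abs_def] using Fd(1,2)[OF x] pd(1,2)[OF x]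
      by (subst partial_diff) (auto simp: partial_mult)
    then show "(\<Sum>i\<in>UNIV. partial i (h i) x) = F x * laplacian \<psi> x - laplacian F x * \<psi> x"
      by (simp add: laplacian_def sum_subtractf sum_distrib_left sum_distrib_right)
  qed
  finally show "(LINT x|lebesgue_on S. F x * laplacian \<psi> x) = (LINT x|lebesgue_on S. laplacian F x * \<psi> x)"
    using i1 i2 by simp
qed

context stable_biharmonic
begin

definition q :: real where "q = (p + 1) / 2"
definition \<beta> :: real where "\<beta> = sqrt (2 / (p + 1))"
definition \<zeta> :: "real^'n \<Rightarrow> real" where "\<zeta> x = \<beta> * u x powr q + w x"

lemma q_beta: "1 < q" "0 < \<beta>" "\<beta> * \<beta> * q = 1"
proof -
  show "1 < q" "0 < \<beta>" using p by (auto simp: q_def \<beta>_def)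
  have "\<beta> * \<beta> = 2 / (p + 1)" unfolding \<beta>_def using p by (intro real_sqrt_mult_self[THEN trans]) auto
  then show "\<beta> * \<beta> * q = 1" using p by (simp add: q_def)
qed

lemma powr_derivs:
  assumes "x \<in> S"
  shows "((\<lambda>t. t powr q) has_real_derivative q * u x powr (q - 1)) (at (u x))"
    and "((\<lambda>t. q * t powr (q - 1)) has_real_derivative q * (q - 1) * u x powr (q - 2)) (at (u x))"
proof -
  note pos = solution_pos[OF assms]
  show "((\<lambda>t. t powr q) has_real_derivative q * u x powr (q - 1)) (at (u x))"
    by (rule has_real_derivative_powr[OF pos])
  have "q - 1 - 1 = q - 2" by simp
  then show "((\<lambda>t. q * t powr (q - 1)) has_real_derivative q * (q - 1) * u x powr (q - 2)) (at (u x))"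
    using DERIV_cmult[OF has_real_derivative_powr[OF pos, of "q - 1"], of q] by (simp add: mult_ac)
qed

lemma u_powr_C2: "Ck_on 2 S (\<lambda>x. u x powr q)"
proof -
  let ?G = "\<lambda>j t. [t powr q, q * t powr (q - 1), q * (q - 1) * t powr (q - 2)] ! j"
  have "Ck_on 2 S (\<lambda>x. ?G 0 (u x))"
  proof (rule Ck_on_compose[OF S Ck_bdd_imp_Ck_on[OF u_Ck_bdd], of 2 ?G])
    show "(?G j has_real_derivative ?G (Suc j) (u x)) (at (u x))" if "j < 2" "x \<in> S" for j x
      using that powr_derivs[OF that(2)] by (cases j) (auto simp: less_Suc_eq numeral_2_eq_2)
    show "continuous_on (u ` S) (?G 2)"
    proof -
      have "\<forall>t\<in>u ` S. t \<noteq> 0" using solution_pos by fastforce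
      then show ?thesis by (simp add: numeral_2_eq_2) (intro continuous_intros; simp)
    qed
  qed simp
  then show ?thesis by simp
qed

lemma zeta_C2: "Ck_on 2 S \<zeta>"
  unfolding \<zeta>_def[abs_def]
  by (intro Ck_on_add Ck_on_mult Ck_on_const S u_powr_C2 Ck_bdd_imp_Ck_on[OF solution_laplacian_Ck_bdd])

text \<open>
  The term with \<open>|\<nabla>u|\<^sup>2\<close> is dropped, being nonnegative as \<open>q > 1\<close>. The choice of \<open>\<beta>\<close>,
  \<open>\<beta>\<^sup>2 q = 1\<close>, makes \<open>\<Delta>w = u\<^sup>p\<close> equal to
  \<open>\<beta> q u\<^sup>q\<^sup>-\<^sup>1\<close> times \<open>\<beta> u\<^sup>q\<close>.
\<close>

lemma zeta_laplacian:
  assumes x: "x \<in> S"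
  shows "\<beta> * q * u x powr (q - 1) * \<zeta> x \<le> laplacian \<zeta> x"
proof -
  note pos = solution_pos[OF x]
  have "laplacian \<zeta> x = laplacian (\<lambda>x. \<beta> * u x powr q) x + laplacian w x"
    unfolding \<zeta>_def[abs_def]
    by (rule laplacian_add[OF S _ Ck_bdd_imp_Ck_on[OF solution_laplacian_Ck_bdd] x]) (intro Ck_on_mult Ck_on_const S u_powr_C2)
  also have "laplacian (\<lambda>x. \<beta> * u x powr q) x = \<beta> * laplacian (\<lambda>x. u x powr q) x"
    using laplacian_mult[OF S Ck_on_const u_powr_C2 x, of \<beta>] by (simp add: laplacian_def)
  also have "laplacian (\<lambda>x. u x powr q) x =
     q * (q - 1) * u x powr (q - 2) * (\<Sum>i\<in>UNIV. (partial i u x)\<^sup>2) + q * u x powr (q - 1) * w x"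
    by (rule laplacian_compose[OF S Ck_bdd_imp_Ck_on[OF u_Ck_bdd] x powr_derivs]) simp_all
  also have "laplacian w x = u x powr p" by (rule solution_eq[OF x])
  also have "u x powr p = \<beta> * q * u x powr (q - 1) * (\<beta> * u x powr q)"
  proof -
    have "q - 1 + q = p" by (simp add: q_def field_simps)
    then have "u x powr p = u x powr (q - 1) * u x powr q" by (metis powr_add)
    then show ?thesis using q_beta(3) by (simp add: mult_ac)
  qed
  finally have "laplacian \<zeta> x = \<beta> * (q * (q - 1) * u x powr (q - 2) * (\<Sum>i\<in>UNIV. (partial i u x)\<^sup>2))
     + \<beta> * q * u x powr (q - 1) * \<zeta> x"
  proof -
    assume "laplacian \<zeta> x = \<beta> * (q * (q - 1) * u x powr (q - 2) * (\<Sum>i\<in>UNIV. (partial i u x)\<^sup>2) + q * u x powr (q - 1) * w x)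
      + \<beta> * q * u x powr (q - 1) * (\<beta> * u x powr q)"
    moreover have "\<zeta> x = \<beta> * u x powr q + w x" by (rule \<zeta>_def)
    ultimately show ?thesis by (simp only: distrib_left add_ac mult_ac)
  qed
  moreover have "0 \<le> \<beta> * (q * (q - 1) * u x powr (q - 2) * (\<Sum>i\<in>UNIV. (partial i u x)\<^sup>2))"
    using q_beta by (intro mult_nonneg_nonneg sum_nonneg) auto
  ultimately show ?thesis by simp
qed

lemma zeta_vanishes: "vanishes_on_frontier S \<zeta>"
  unfolding vanishes_on_frontier_def
proof
  fix z assume z: "z \<in> frontier S"
  have u: "(u \<longlongrightarrow> 0) (at z within S)" and w: "(w \<longlongrightarrow> 0) (at z within S)"
    using solution_vanishes z by (auto simp: vanishes_on_frontier_def)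
  have "((\<lambda>x. u x powr q) \<longlongrightarrow> 0 powr q) (at z within S)"
  proof (rule tendsto_powr2[OF u tendsto_const])
    show "\<forall>\<^sub>F x in at z within S. 0 \<le> u x"
      using solution_pos by (auto simp: eventually_at_filter less_imp_le)
  qed (use q_beta in simp)
  then have "((\<lambda>x. \<beta> * u x powr q + w x) \<longlongrightarrow> \<beta> * 0 + 0) (at z within S)" by (intro tendsto_intros w) simp
  then show "(\<zeta> \<longlongrightarrow> 0) (at z within S)" by (simp add: \<zeta>_def[abs_def])
qed

lemma zeta_Ck_bdd: "Ck_loc 0 S \<zeta>"
  unfolding \<zeta>_def[abs_def] using q_beta
  by (intro Ck_bdd_bounded_add Ck_bdd_bounded_mult S Ck_bdd_const u_powr_Ck_bdd w_Ck_bdd) auto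

lemma soft_zeta_C2: "Ck_on 2 S (\<lambda>x. soft (\<zeta> x - e))"
proof -
  let ?G = "\<lambda>j t. [soft t, soft' t, soft'' t] ! j"
  have "Ck_on 2 S (\<lambda>x. ?G 0 (\<zeta> x - e))"
  proof (rule Ck_on_compose[OF S Ck_on_diff[OF S zeta_C2 Ck_on_const], of ?G])
    show "(?G j has_real_derivative ?G (Suc j) (\<zeta> x - e)) (at (\<zeta> x - e))" if "j < 2" "x \<in> S" for j x
      using that soft_deriv soft'_deriv by (cases j) (auto simp: less_Suc_eq numeral_2_eq_2)
    show "continuous_on ((\<lambda>x. \<zeta> x - e) ` S) (?G 2)"
      using continuous_soft'' by (simp add: numeral_2_eq_2)
  qed
  then show ?thesis by simp
qed

text \<open>
  Where \<open>\<zeta> > e\<close>, \<open>\<zeta>\<close> is subharmonic and \<open>soft\<close> is convex and nondecreasing; elsewhere the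
  function vanishes to second order.
\<close>

lemma soft_zeta_laplacian:
  assumes x: "x \<in> S" and e: "0 < e"
  shows "0 \<le> laplacian (\<lambda>x. soft (\<zeta> x - e)) x"
    and "\<zeta> x \<le> e \<Longrightarrow> laplacian (\<lambda>x. soft (\<zeta> x - e)) x = 0"
    and "\<zeta> x \<le> e \<Longrightarrow> partial i (\<lambda>x. soft (\<zeta> x - e)) x = 0"
proof -
  have z: "Ck_on 2 S (\<lambda>x. \<zeta> x - e)" by (intro Ck_on_diff S zeta_C2 Ck_on_const)
  have l: "laplacian (\<lambda>x. soft (\<zeta> x - e)) x = soft'' (\<zeta> x - e) * (\<Sum>i\<in>UNIV. (partial i (\<lambda>x. \<zeta> x - e) x)\<^sup>2)
     + soft' (\<zeta> x - e) * laplacian (\<lambda>x. \<zeta> x - e) x"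
    by (rule laplacian_compose[OF S z x soft_deriv soft'_deriv])
  have "laplacian (\<lambda>x. \<zeta> x - e) x = laplacian \<zeta> x"
    using laplacian_add[OF S zeta_C2 Ck_on_const x, of "- e"] by (simp add: laplacian_def)
  note l' = l[unfolded this]
  show "0 \<le> laplacian (\<lambda>x. soft (\<zeta> x - e)) x"
  proof (cases "\<zeta> x \<le> e")
    case False
    then have "0 \<le> \<beta> * q * u x powr (q - 1) * \<zeta> x" using e q_beta by (intro mult_nonneg_nonneg) auto
    then have "0 \<le> laplacian \<zeta> x" using zeta_laplacian[OF x] by linarith
    then show ?thesis unfolding l' by (intro add_nonneg_nonneg mult_nonneg_nonneg soft_nonneg sum_nonneg) auto
  qed (simp add: l')
  show "laplacian (\<lambda>x. soft (\<zeta> x - e)) x = 0" if "\<zeta> x \<le> e" using that by (simp add: l')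
  show "partial i (\<lambda>x. soft (\<zeta> x - e)) x = 0" if "\<zeta> x \<le> e"
    using partial_compose[OF Ck_on_2D(1)[OF z x] soft_deriv, of i] that by simp
qed

end

section \<open>The Liouville argument\<close>

context stable_biharmonic
begin

lemma soft_zeta_le: "0 < e \<Longrightarrow> soft (\<zeta> x - e) \<le> 2 * (1 + \<beta>\<^sup>2) * (u x powr (p + 1) + (w x)\<^sup>2)"
proof -
  assume e: "0 < e"
  have "soft (\<zeta> x - e) \<le> (\<zeta> x)\<^sup>2"
  proof (cases "\<zeta> x \<le> e")
    case False
    then have "(\<zeta> x - e)\<^sup>2 \<le> (\<zeta> x)\<^sup>2" using e by (intro power_mono) auto
    then show ?thesis using soft_le_sq[of "\<zeta> x - e"] by linarith
  qed simp
  also have "\<dots> \<le> 2 * (\<beta> * u x powr q)\<^sup>2 + 2 * (w x)\<^sup>2"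
    using sum_squares_ge_zero[of "\<beta> * u x powr q - w x" 0] by (simp add: \<zeta>_def power2_eq_square algebra_simps)
  also have "(\<beta> * u x powr q)\<^sup>2 = \<beta>\<^sup>2 * u x powr (p + 1)"
  proof -
    have "u x powr q * u x powr q = u x powr (q + q)" by (rule powr_add[symmetric])
    then show ?thesis by (simp add: power_mult_distrib power2_eq_square q_def)
  qed
  also have "2 * (\<beta>\<^sup>2 * u x powr (p + 1)) + 2 * (w x)\<^sup>2 \<le> 2 * (1 + \<beta>\<^sup>2) * (u x powr (p + 1) + (w x)\<^sup>2)"
    by (simp add: algebra_simps)
  finally show ?thesis .
qed

lemma integrable_on_ball:
  assumes "Ck_loc 0 S f"
  shows "integrable (lebesgue_on S) (\<lambda>x. f x * indicat_real (cball 0 r) x)"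
proof -
  have c: "continuous_on S f" "bounded (f ` (S \<inter> cball 0 r))" using Ck_bdd_boundedD[OF assms bounded_cball] by auto
  from c(2) obtain B where B: "\<forall>x\<in>S \<inter> cball 0 r. \<bar>f x\<bar> \<le> B" by (auto simp: bounded_iff)
  have "(\<lambda>x. f x * indicat_real (cball 0 r) x) \<in> borel_measurable (lebesgue_on S)"
  proof (rule borel_measurable_times)
    show "f \<in> borel_measurable (lebesgue_on S)"
      by (rule continuous_imp_measurable_on_sets_lebesgue[OF c(1) open_sets_lebesgue[OF S]])
    show "indicat_real (cball 0 r) \<in> borel_measurable (lebesgue_on S)"
      using integrable_indicator_cball[OF open_sets_lebesgue[OF S], of 1 0 r] by simp
  qed
  then show ?thesis
  proof (rule integrable_bounded_support[OF open_sets_lebesgue[OF S] _ bounded_cball[of 0 r], where c = "max 0 B"])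
    show "\<bar>f x * indicat_real (cball 0 r) x\<bar> \<le> max 0 B" if "x \<in> S" for x
      using B[rule_format, of x] that by (auto simp: indicator_def)
  qed (simp add: indicator_def)
qed

lemma soft_zeta_Ck_bdd: "Ck_loc 0 S (\<lambda>x. soft (\<zeta> x - e))"
proof -
  have "continuous_on UNIV soft"
    by (rule DERIV_continuous_on[of UNIV soft soft']) (auto intro: has_field_derivative_at_within soft_deriv)
  moreover have "continuous_on UNIV (\<lambda>t. t - e)" by (intro continuous_intros)
  ultimately have "continuous_on UNIV (\<lambda>t. soft (t - e))" by (rule continuous_on_compose2) simp
  from Ck_bdd_0_compose[OF zeta_Ck_bdd this] show ?thesis .
qed

text \<open>
  The cutoff at radius \<open>2 R\<close> is at least \<open>(3/4)\<^sup>m\<close> on the ball of radius \<open>R\<close>.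
\<close>

lemma zeta_mass_growth:
  assumes e: "0 < e"
  shows "\<exists>C\<ge>0. \<forall>R\<ge>1. (LINT x|lebesgue_on S. soft (\<zeta> x - e) * indicat_real (cball 0 R) x) \<le> C * (R ^ CARD('n) / R^4)"
proof -
  let ?F = "\<lambda>x. soft (\<zeta> x - e)"
  obtain C m where C: "C \<ge> 0" "1 \<le> m" "\<And>R. 1 \<le> R \<Longrightarrow> integrable (lebesgue_on S) (\<lambda>x. (u x powr (p + 1) + (w x)\<^sup>2) * cut R m x) \<and>
     (LINT x|lebesgue_on S. (u x powr (p + 1) + (w x)\<^sup>2) * cut R m x) \<le> C * (R ^ CARD('n) / R^4)"
    using energy_growth by blast
  define B where "B = 2 * (1 + \<beta>\<^sup>2) * (4 / 3) ^ m"
  have B: "0 \<le> B" by (simp add: B_def)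
  have "(LINT x|lebesgue_on S. ?F x * indicat_real (cball 0 R) x) \<le> (B * C * (2 ^ CARD('n) / 16)) * (R ^ CARD('n) / R^4)"
    if R: "1 \<le> R" for R
  proof -
    have R2: "1 \<le> 2 * R" "0 < R" using R by auto
    have iF: "integrable (lebesgue_on S) (\<lambda>x. ?F x * indicat_real (cball 0 R) x)"
      by (rule integrable_on_ball[OF soft_zeta_Ck_bdd])
    have "(LINT x|lebesgue_on S. ?F x * indicat_real (cball 0 R) x) \<le>
      (LINT x|lebesgue_on S. B * ((u x powr (p + 1) + (w x)\<^sup>2) * cut (2 * R) m x))"
    proof (rule integral_mono[OF iF])
      show "integrable (lebesgue_on S) (\<lambda>x. B * ((u x powr (p + 1) + (w x)\<^sup>2) * cut (2 * R) m x))"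
        using C(3)[OF R2(1)] by simp
      fix x
      let ?E = "u x powr (p + 1) + (w x)\<^sup>2"
      have E: "0 \<le> ?E" by simp
      show "?F x * indicat_real (cball 0 R) x \<le> B * (?E * cut (2 * R) m x)"
      proof (cases "x \<in> cball 0 R")
        case True
        then have "x \<bullet> x \<le> R\<^sup>2" using power_mono[of "norm x" R 2] by (simp add: power2_norm_eq_inner)
        then have "3 / 4 \<le> 1 - (x \<bullet> x) / (2 * R)\<^sup>2" using R2 by (simp add: divide_simps)
        then have "(3 / 4) ^ m \<le> cut (2 * R) m x"
          unfolding cutoff_def by (intro power_mono) auto
        then have "(4 / 3) ^ m * (3 / 4) ^ m \<le> (4 / 3) ^ m * cut (2 * R) m x" by (intro mult_left_mono) auto
        then have "1 \<le> (4 / 3) ^ m * cut (2 * R) m x" by (simp flip: power_mult_distrib)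
        from mult_left_mono[OF this, of "2 * (1 + \<beta>\<^sup>2) * ?E"] E
        have "2 * (1 + \<beta>\<^sup>2) * ?E \<le> B * (?E * cut (2 * R) m x)" by (simp add: B_def mult_ac)
        then show ?thesis using soft_zeta_le[OF e, of x] True by simp
      next
        case False
        then show ?thesis using B E cutoff_nonneg[of "2 * R"] R2 by simp
      qed
    qed
    also have "\<dots> = B * (LINT x|lebesgue_on S. (u x powr (p + 1) + (w x)\<^sup>2) * cut (2 * R) m x)" by simp
    also have "\<dots> \<le> B * (C * ((2 * R) ^ CARD('n) / (2 * R)^4))"
      using C(3)[OF R2(1)] B by (intro mult_left_mono) auto
    also have "\<dots> = (B * C * (2 ^ CARD('n) / 16)) * (R ^ CARD('n) / R^4)" by (simp add: power_mult_distrib)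
    finally show ?thesis .
  qed
  moreover have "0 \<le> B * C * (2 ^ CARD('n) / 16)" using B C(1) by simp
  ultimately show ?thesis by blast
qed

text \<open>
  Let \<open>F = soft (\<zeta> - e)\<close>, a nonnegative subharmonic function vanishing near the frontier, and let
  \<open>\<psi>\<close> be the barrier of radius \<open>R\<close>. Then
  \<open>0 \<le> \<integral> \<Delta>F \<psi> = \<integral> F \<Delta>\<psi>\<close>, and the last integral is at most \<open>- \<kappa>\<close> times the
  integral of \<open>F\<close> over a fixed ball of radius \<open>r\<close> plus \<open>\<kappa>'\<close> times that over the ball of
  radius \<open>R\<close>. The latter product is of order \<open>R\<^sup>-\<^sup>4\<close>, so the integral over the fixed ball is
  0.
\<close>

lemma zeta_le_eps:
  assumes N: "CARD('n) \<ge> 4" and e: "0 < e" and x0: "x0 \<in> S"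
  shows "\<zeta> x0 \<le> e"
proof (rule ccontr)
  assume "\<not> \<zeta> x0 \<le> e"
  then have z0: "0 < \<zeta> x0 - e" by simp
  let ?F = "\<lambda>x. soft (\<zeta> x - e)"
  define r where "r = norm x0 + 1"
  have r: "1 \<le> r" "x0 \<in> ball 0 r" by (auto simp: r_def)
  define a where "a = (real CARD('n) - 2) / 2"
  have a: "1 \<le> a" using N by (simp add: a_def)
  have F: "Ck_on 2 S ?F" by (rule soft_zeta_C2)
  note iF = integrable_on_ball[OF soft_zeta_Ck_bdd]
  obtain C where C: "C \<ge> 0" "\<And>R. 1 \<le> R \<Longrightarrow> (LINT x|lebesgue_on S. ?F x * indicat_real (cball 0 R) x) \<le> C * (R ^ CARD('n) / R^4)"
    using zeta_mass_growth[OF e] by blast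
  define \<kappa> where "\<kappa> = real CARD('n) * a * (1 + r\<^sup>2) powr (- a - 2)"
  have "0 < 1 + r\<^sup>2" using r by (intro add_pos_nonneg) auto
  then have k: "0 < \<kappa>" using N a by (simp add: \<kappa>_def)
  define I where "I = (LINT x|lebesgue_on S. ?F x * indicat_real (cball 0 r) x)"
  have step: "\<kappa> * I \<le> 24 * a\<^sup>2 * C / R^4" if R: "6 * (1 + r\<^sup>2) \<le> 1 + R\<^sup>2" "1 \<le> R" for R
  proof -
    have R0: "0 < R" using R by simp
    define \<kappa>' where "\<kappa>' = 24 * a\<^sup>2 * (1 + R\<^sup>2) powr (- a - 1)"
    obtain \<psi> :: "real^'n \<Rightarrow> real" where psi: "Ck_on 2 UNIV \<psi>" "\<And>x. 0 \<le> \<psi> x" "\<And>x. x \<notin> cball 0 R \<Longrightarrow> \<psi> x = 0"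
      "\<And>x. x \<in> cball 0 R \<Longrightarrow> laplacian \<psi> x \<le> \<kappa>'"
      "\<And>r x. x \<in> cball 0 r \<Longrightarrow> 6 * (1 + r\<^sup>2) \<le> 1 + R\<^sup>2 \<Longrightarrow>
        laplacian \<psi> x \<le> - (real CARD('n) * a * (1 + r\<^sup>2) powr (- a - 2)) + \<kappa>'"
      using barrier[OF a_def a R0] unfolding \<kappa>'_def by blast
    have pS: "Ck_on 2 S \<psi>" by (rule Ck_on_subset[OF psi(1)]) simp
    define K where "K = {x \<in> S \<inter> cball 0 R. e \<le> \<bar>\<zeta> x\<bar>}"
    have K: "compact K" "K \<subseteq> S"
      unfolding K_def using compact_superlevel[OF S Ck_on_2D(3)[OF zeta_C2] zeta_vanishes e] by auto
    have pp: "partial i \<psi> x = 0" "laplacian \<psi> x = 0" if "x \<notin> cball 0 R" for i x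
    proof -
      have z: "partial i \<psi> x = 0" if "x \<notin> cball 0 R" for i x
        by (rule partial_zero_outside_compact[OF open_UNIV compact_cball[of 0 R]]) (use psi(3) that in auto)
      then show "partial i \<psi> x = 0" using that .
      have "partial i (partial i \<psi>) x = 0" for i
        by (rule partial_zero_outside_compact[OF open_UNIV compact_cball[of 0 R]]) (use z that in auto)
      then show "laplacian \<psi> x = 0" by (simp add: laplacian_def)
    qed
    have out: "(\<zeta> x \<le> e) \<or> x \<notin> cball 0 R" if "x \<in> S - K" for x using that by (auto simp: K_def)
    note sa = laplacian_self_adjoint[OF S F pS K]
    have sa: "integrable (lebesgue_on S) (\<lambda>x. ?F x * laplacian \<psi> x)" "integrable (lebesgue_on S) (\<lambda>x. laplacian ?F x * \<psi> x)"
       "(LINT x|lebesgue_on S. ?F x * laplacian \<psi> x) = (LINT x|lebesgue_on S. laplacian ?F x * \<psi> x)"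
      by (rule laplacian_self_adjoint[OF S F pS K];
          use out soft_zeta_laplacian(2,3)[OF _ e] psi(3) pp in fastforce)+
    have "0 \<le> (LINT x|lebesgue_on S. laplacian ?F x * \<psi> x)"
      by (rule Bochner_Integration.integral_nonneg) (use soft_zeta_laplacian(1)[OF _ e] psi(2) in auto)
    also have "\<dots> = (LINT x|lebesgue_on S. ?F x * laplacian \<psi> x)" using sa(3) by simp
    also have "\<dots> \<le> (LINT x|lebesgue_on S. - \<kappa> * (?F x * indicat_real (cball 0 r) x) + \<kappa>' * (?F x * indicat_real (cball 0 R) x))"
    proof (rule integral_mono[OF sa(1)])
      show "integrable (lebesgue_on S) (\<lambda>x. - \<kappa> * (?F x * indicat_real (cball 0 r) x) + \<kappa>' * (?F x * indicat_real (cball 0 R) x))"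
        using iF by (intro Bochner_Integration.integrable_add Bochner_Integration.integrable_mult_right) auto
      fix x
      have rR: "r \<le> R"
      proof -
        have "6 * (1 + r\<^sup>2) = 6 + 6 * r\<^sup>2" by simp
        then have "r\<^sup>2 \<le> R\<^sup>2" using R(1) zero_le_power2[of r] by linarith
        then show ?thesis using R0 by (simp add: power2_le_iff_abs_le)
      qed
      have Fn: "0 \<le> ?F x" by (rule soft_nonneg)
      consider "x \<in> cball 0 r" | "x \<notin> cball 0 r" "x \<in> cball 0 R" | "x \<notin> cball 0 R" by blast
      then show "?F x * laplacian \<psi> x \<le> - \<kappa> * (?F x * indicat_real (cball 0 r) x) + \<kappa>' * (?F x * indicat_real (cball 0 R) x)"
      proof cases
        case 1
        then have "x \<in> cball 0 R" using rR by auto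
        moreover have "?F x * laplacian \<psi> x \<le> ?F x * (- \<kappa> + \<kappa>')"
          using psi(5)[OF 1 R(1)] Fn unfolding \<kappa>_def by (intro mult_left_mono) auto
        ultimately show ?thesis using 1 by (simp add: algebra_simps)
      next
        case 2
        have "?F x * laplacian \<psi> x \<le> ?F x * \<kappa>'" using psi(4)[OF 2(2)] Fn by (rule mult_left_mono)
        then show ?thesis using 2 by (simp add: mult.commute)
      next
        case 3
        moreover have "x \<notin> cball 0 r" using 3 rR by auto
        ultimately show ?thesis using pp(2)[OF 3] by simp
      qed
    qed
    also have "\<dots> = - \<kappa> * I + \<kappa>' * (LINT x|lebesgue_on S. ?F x * indicat_real (cball 0 R) x)"
      using iF by (simp add: I_def)
    finally have "\<kappa> * I \<le> \<kappa>' * (LINT x|lebesgue_on S. ?F x * indicat_real (cball 0 R) x)" by simp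
    also have "\<dots> \<le> \<kappa>' * (C * (R ^ CARD('n) / R^4))"
      using C(2)[OF R(2)] by (intro mult_left_mono) (auto simp: \<kappa>'_def)
    also have "\<dots> \<le> (24 * a\<^sup>2 * (R powr (- real CARD('n)))) * (C * (R ^ CARD('n) / R^4))"
    proof (rule mult_right_mono)
      have "(1 + R\<^sup>2) powr (- a - 1) \<le> (R\<^sup>2) powr (- a - 1)" using a R0 by (intro powr_mono2') auto
      also have "(R\<^sup>2) powr (- a - 1) = R powr (- real CARD('n))"
      proof -
        have "R\<^sup>2 = R powr 2" using R0 by (simp add: powr_numeral)
        moreover have "2 * (- a - 1) = - real CARD('n)" by (simp add: a_def field_simps)
        ultimately show ?thesis by (simp only: powr_powr)
      qed
      finally show "\<kappa>' \<le> 24 * a\<^sup>2 * (R powr (- real CARD('n)))" unfolding \<kappa>'_def by (intro mult_left_mono) auto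
    qed (use C(1) R0 in auto)
    also have "\<dots> = 24 * a\<^sup>2 * C / R^4"
      using R0 by (simp add: powr_minus powr_realpow field_simps)
    finally show ?thesis .
  qed
  have "I \<le> 0"
  proof (rule ccontr)
    assume "\<not> I \<le> 0"
    then have I: "0 < \<kappa> * I" using k by simp
    \<comment> \<open>large enough that the bound in \<open>step\<close> falls below \<open>\<kappa> * I\<close>\<close>
    define R where "R = 6 * (1 + r\<^sup>2) + 24 * a\<^sup>2 * C / (\<kappa> * I) + 1"
    have t: "0 \<le> 24 * a\<^sup>2 * C / (\<kappa> * I)" using C(1) I by (intro divide_nonneg_pos) auto
    have R: "1 \<le> R" "6 * (1 + r\<^sup>2) \<le> R" "24 * a\<^sup>2 * C / (\<kappa> * I) < R"
    proof -
      have "0 \<le> 6 * (1 + r\<^sup>2)" by simp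
      then show "1 \<le> R" "6 * (1 + r\<^sup>2) \<le> R" using t unfolding R_def by linarith+
      have "0 \<le> 6 * (1 + r\<^sup>2)" by simp
      then show "24 * a\<^sup>2 * C / (\<kappa> * I) < R" unfolding R_def by linarith
    qed
    have RR: "R \<le> R\<^sup>2" "R \<le> R^4" using R(1) self_le_power[of R 2] self_le_power[of R 4] by auto
    have "6 * (1 + r\<^sup>2) \<le> 1 + R\<^sup>2" using R(2) RR(1) by simp
    from step[OF this R(1)] have "\<kappa> * I * R^4 \<le> 24 * a\<^sup>2 * C" using R(1) by (simp add: pos_le_divide_eq)
    also have "\<dots> < R * (\<kappa> * I)" using R(3) I by (simp add: pos_divide_less_eq)
    also have "\<dots> \<le> R^4 * (\<kappa> * I)" using RR(2) I by (intro mult_right_mono) auto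
    finally show False by (simp add: mult.commute)
  qed
  then have "I = 0"
    unfolding I_def using soft_nonneg by (intro antisym Bochner_Integration.integral_nonneg) auto
  then have "AE x in lebesgue_on S. ?F x * indicat_real (cball 0 r) x = 0"
    unfolding I_def by (subst (asm) integral_nonneg_eq_0_iff_AE[OF iF]) (auto simp: soft_nonneg)
  then have "AE x in lebesgue. x \<in> S \<longrightarrow> ?F x * indicat_real (cball 0 r) x = 0"
    using open_sets_lebesgue[OF S] by (simp add: AE_restrict_space_iff)
  then obtain M where M: "{x. \<not> (x \<in> S \<longrightarrow> ?F x * indicat_real (cball 0 r) x = 0)} \<subseteq> M" "M \<in> null_sets lebesgue"
    by (auto simp: eventually_ae_filter)
  define V where "V = {x \<in> S \<inter> ball 0 r. e < \<zeta> x}"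
  have "V \<subseteq> M"
  proof
    fix x assume "x \<in> V"
    then have "0 < ?F x" "x \<in> cball 0 r" "x \<in> S" by (auto simp: V_def intro!: soft_pos)
    then show "x \<in> M" using M(1) by auto
  qed
  then have "negligible V" using M(2) negligible_subset[of M V] by (simp add: negligible_iff_null_sets)
  moreover have "open V"
  proof -
    have "open ((\<zeta> -` {e<..}) \<inter> (S \<inter> ball 0 r))"
      by (rule continuous_on_open_vimage[THEN iffD1, rule_format, OF _ continuous_on_subset[OF Ck_on_2D(3)[OF zeta_C2]]])
        (auto intro: S)
    also have "(\<zeta> -` {e<..}) \<inter> (S \<inter> ball 0 r) = V" by (auto simp: V_def)
    finally show ?thesis .
  qed
  moreover have "x0 \<in> V" using z0 r x0 by (simp add: V_def)
  ultimately show False using open_not_negligible by blast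
qed

theorem pointwise_inequality:
  assumes N: "CARD('n) \<ge> 4" and x: "x \<in> S"
  shows "sqrt (2 / (p + 1)) * u x powr ((p + 1) / 2) \<le> - w x"
proof -
  have "\<zeta> x \<le> 0" using zeta_le_eps[OF N _ x] field_le_epsilon[of "\<zeta> x" 0] by simp
  then show ?thesis by (simp add: \<zeta>_def \<beta>_def q_def)
qed

end

theorem proposition1p2:
  fixes \<Sigma> :: "(real^'n::finite) set" and k :: 'n and p :: real
    and u v :: "real^'n \<Rightarrow> real"
  assumes "CARD('n) \<ge> 5"
    and "p > 1"
    and "\<Sigma> = UNIV \<or> \<Sigma> = half_space k \<or>
         (\<exists>\<Omega>. bounded_smooth_domain \<Omega> \<and>
            (\<Sigma> = UNIV - closure \<Omega> \<or> \<Sigma> = half_space k - closure \<Omega>))"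
    and "stable_solution \<Sigma> p u"
    and "v = (\<lambda>x. - laplacian u x)"
  shows "(\<forall>x\<in>\<Sigma>. v x \<ge> sqrt (2 / (p + 1)) * u x powr ((p + 1) / 2)) \<and> (\<forall>x\<in>\<Sigma>. v x > 0)"
proof -
  have "open (half_space k :: (real^'n) set)"
    unfolding half_space_def by (intro open_Collect_less continuous_intros)
  then have "open \<Sigma>" using assms(3) by (auto intro: open_Diff)
  then interpret stable_biharmonic \<Sigma> u p
    using assms(2,4) by unfold_locales
  have ge: "v x \<ge> sqrt (2 / (p + 1)) * u x powr ((p + 1) / 2)" if "x \<in> \<Sigma>" for x
    using pointwise_inequality[OF _ that] assms(1,5) by simp
  moreover have "0 < sqrt (2 / (p + 1)) * u x powr ((p + 1) / 2)" if "x \<in> \<Sigma>" for x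
    using solution_pos[OF that] assms(2) by simp
  ultimately show ?thesis using less_le_trans by blast
qed

end
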